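(* Let $L$ be a link with a connected diagram $D$ such that the twist number of $D$ equals the twist number of $L$. Let $G$ be the $\{s,c\}$-colored plane graph associated to $D$, with ordered edges $e_1,\dots,e_k$, so that $D=D_{t^0}$ for some $t^0\in\mathbb{Z}^k$. For a spanning tree $F$ of $G$ put $$p_F=\#\{\text{edges colored } s \text{ (sheafs) that lie in } F\}+\#\{\text{edges colored } c \text{ (chains) that do not lie in } F\},$$ and let $p=\max_F p_F$, the maximum being over all spanning trees $F$ of $G$. Then $d^{p}\langle D_t\rangle$ is a polynomial in $k+1$ variables for all $t\in\mathbb{Z}^k$, in the following sense: there is $Q\in\mathbb{Z}[A^{\pm1},x_1,\dots,x_k]$, independent of $t$, such that for all $t\in\mathbb{Z}^k$ $$d^{p}\langle D_t\rangle=A^{r_1+\dots+r_k}\,Q\big(A,(-A^{-4})^{r_1},\dots,(-A^{-4})^{r_k}\big),$$ where $r_i=t_i$ if $e_i$ is colored $c$ and $r_i=-t_i$ if $e_i$ is colored $s$. Furthermore, $p\le$ the twist number of $L$.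
   Context: Kauffman bracket: $\langle\cdot\rangle\in\mathbb{Z}[A^{\pm1}]$ is defined on link diagrams by $\langle n \text{ disjoint simple closed curves}\rangle=d^{n-1}$ with $d=-A^{-2}-A^{2}$, and $\langle D\rangle=A\langle D_+\rangle+A^{-1}\langle D_-\rangle$, where $D_+$, $D_-$ are the positive ($A$-) and negative ($A^{-1}$-) smoothings of $D$ at a crossing. Twist number: two crossings of a diagram are twist equivalent if some circle in the projection plane meets the diagram at exactly these two crossings. The number of equivalence classes is the twist number of the diagram; the twist number of a link is the minimum over its diagrams. Diagrams $D$ are taken reduced with respect to Reidemeister moves I and II, and (after flypes) such that twist equivalent crossings are connected by a chain of bigons. Signed graph of a diagram: checkerboard color the plane with the unbounded region unshaded; vertices are shaded regions, edges are crossings (joining the shaded regions meeting there). An edge is positive if the positive smoothing of its crossing merges the two shaded regions there, and negative otherwise. Conversely a signed plane graph determines a link diagram. Chains and sheafs: a chain is a path of edges whose interior vertices have degree 2 and whose extreme vertices have degree greater than 2 or equal to 1; a sheaf is a collection of edges joining the same two vertices. The length is the sum of the signs of the edges. In the signed graph of $D$ every edge lies in a chain or a sheaf with all edges of the same sign; a crossing alone in its twist class may be taken as a chain or a sheaf of length $\pm1$. The colored graph $G$ of $D$: replace each chain by a single edge colored $c$ and each sheaf by a single edge colored $s$. The number $k$ of edges of $G$ is the twist number of $D$. The diagrams $D_t$: given a plane graph $G$ with edges $e_1,\dots,e_k$ colored by $s$ or $c$, and $t\in\mathbb{Z}^k$, replace each $e_i$ colored $c$ by a chain of $|t_i|$ edges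 of sign $\mathrm{sgn}(t_i)$, and each $e_i$ colored $s$ by a sheaf of $|t_i|$ parallel edges of sign $\mathrm{sgn}(t_i)$. $D_t$ is the link diagram of the resulting signed plane graph. If $t_i=0$, the corresponding place of the diagram is filled with no crossings, by the smoothing that merges the two shaded regions (color $c$) or separates them (color $s$). *)

theory Defs
  imports "HOL-Library.Poly_Mapping" "HOL-Combinatorics.Orbits"
begin

section \<open>Laurent polynomials\<close>

text \<open>The ring \<open>\<int>[A, A\<^sup>-\<^sup>1]\<close> is the group ring of the integers; the product of
  \<^theory>\<open>HOL-Library.Poly_Mapping\<close> is convolution.\<close>

type_synonym laurent = "int \<Rightarrow>\<^sub>0 int"

definition A_pow :: "int \<Rightarrow> laurent" where
  "A_pow n = Poly_Mapping.single n 1"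

definition loop_value :: laurent where
  "loop_value = - A_pow (- 2) - A_pow 2"

text \<open>\<open>(-A\<^sup>-\<^sup>4)\<^sup>r\<close> for an integer \<open>r\<close>; the inverse of the unit \<open>-A\<^sup>-\<^sup>4\<close> is \<open>-A\<^sup>4\<close>.\<close>

definition neg_A4_pow :: "int \<Rightarrow> laurent" where
  "neg_A4_pow r = (if 0 \<le> r then (- A_pow (- 4)) ^ nat r else (- A_pow 4) ^ nat (- r))"

text \<open>Polynomials over \<open>\<int>[A, A\<^sup>-\<^sup>1]\<close> in variables indexed by natural numbers.\<close>

type_synonym laurent_mpoly = "(nat \<Rightarrow>\<^sub>0 nat) \<Rightarrow>\<^sub>0 laurent"

definition mpoly_vars :: "laurent_mpoly \<Rightarrow> nat set" where
  "mpoly_vars Q = (\<Union>m\<in>Poly_Mapping.keys Q. Poly_Mapping.keys m)"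

definition mpoly_eval :: "laurent_mpoly \<Rightarrow> (nat \<Rightarrow> laurent) \<Rightarrow> laurent" where
  "mpoly_eval Q x =
     (\<Sum>m\<in>Poly_Mapping.keys Q. Poly_Mapping.lookup Q m *
        (\<Prod>i\<in>Poly_Mapping.keys m. x i ^ Poly_Mapping.lookup m i))"


section \<open>Link diagrams\<close>

text \<open>
  A link diagram is encoded as a map on the sphere all of whose vertices have degree 4 (crossings)
  or degree 2 (marked points, carrying no information, which allow circles without crossings).
  Darts are half-edges; \<open>rot\<close> sends a dart to the next one counterclockwise around its vertex,
  \<open>mate\<close> to the other half of its edge, and \<open>over\<close> consists of the darts on the upper strands at
  crossings. A dart \<open>h\<close> also names the corner between \<open>h\<close> and \<open>rot h\<close>; the equivalence relation
  \<open>region\<close> relates the corners lying in the same complementary region. For connected diagrams the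
  regions are the faces of the map; for disconnected diagrams a region may have several boundary
  components, and \<open>region\<close> records how the connected components are placed relative to each other.
  A diagram in the plane is a diagram on the sphere together with a choice of unbounded region.
\<close>

record 'a diagram =
  darts :: "'a set"
  rot :: "'a \<Rightarrow> 'a"
  mate :: "'a \<Rightarrow> 'a"
  over :: "'a set"
  region :: "('a \<times> 'a) set"

definition vertex_at :: "'a diagram \<Rightarrow> 'a \<Rightarrow> 'a set" where
  "vertex_at D h = orbit (rot D) h"

definition crossing_darts :: "'a diagram \<Rightarrow> 'a set" where
  "crossing_darts D = {h \<in> darts D. card (vertex_at D h) = 4}"

definition crossings :: "'a diagram \<Rightarrow> 'a set set" where
  "crossings D = vertex_at D ` crossing_darts D"

text \<open>The corner following \<open>h\<close> clockwise along the boundary of its region, seen from inside.\<close>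

definition face_step :: "'a diagram \<Rightarrow> 'a \<Rightarrow> 'a" where
  "face_step D h = mate D (rot D h)"

definition joined :: "'a diagram \<Rightarrow> ('a \<times> 'a) set" where
  "joined D =
     Restr (({(h, rot D h) | h. h \<in> darts D} \<union> {(h, mate D h) | h. h \<in> darts D})\<^sup>*) (darts D)"

definition components :: "'a diagram \<Rightarrow> 'a set set" where
  "components D = darts D // joined D"

definition connected_diagram :: "'a diagram \<Rightarrow> bool" where
  "connected_diagram D \<longleftrightarrow> (\<forall>h\<in>darts D. \<forall>g\<in>darts D. (h, g) \<in> joined D)"

text \<open>
  The last two groups of conditions express planarity. The Euler formula
  \<open>V - E + F = 2 C\<close> (with \<open>2 E\<close> the number of darts) says that every component is a map on the
  sphere; the last two conditions say that the bipartite graph on components and regions, with one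
  edge for each face of a component, is a tree, i.e. that the components are placed on one sphere.
\<close>

definition link_diagram :: "'a diagram \<Rightarrow> bool" where
  "link_diagram D \<longleftrightarrow>
     finite (darts D) \<and> darts D \<noteq> {} \<and>
     bij_betw (rot D) (darts D) (darts D) \<and>
     (\<forall>h\<in>darts D. card (vertex_at D h) \<in> {2, 4}) \<and>
     (\<forall>h\<in>darts D. mate D h \<in> darts D \<and> mate D h \<noteq> h \<and> mate D (mate D h) = h) \<and>
     over D \<subseteq> crossing_darts D \<and>
     (\<forall>h\<in>crossing_darts D. h \<in> over D \<longleftrightarrow> rot D h \<notin> over D) \<and>
     equiv (darts D) (region D) \<and>
     (\<forall>h\<in>darts D. (h, face_step D h) \<in> region D) \<and>
     2 * card (vertex_at D ` darts D) + 2 * card (orbit (face_step D) ` darts D)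
       = card (darts D) + 4 * card (components D) \<and>
     (\<forall>h\<in>darts D. \<forall>g\<in>darts D. (h, g) \<in> (joined D \<union> region D)\<^sup>*) \<and>
     card (darts D // region D) + card (components D) = card (orbit (face_step D) ` darts D) + 1"

definition diagram_iso :: "'a diagram \<Rightarrow> 'b diagram \<Rightarrow> bool" where
  "diagram_iso D D' \<longleftrightarrow> (\<exists>f. bij_betw f (darts D) (darts D') \<and>
     (\<forall>h\<in>darts D. f (rot D h) = rot D' (f h) \<and> f (mate D h) = mate D' (f h) \<and>
        (f h \<in> over D' \<longleftrightarrow> h \<in> over D)) \<and>
     (\<forall>h\<in>darts D. \<forall>g\<in>darts D. (f h, f g) \<in> region D' \<longleftrightarrow> (h, g) \<in> region D))"


section \<open>The Kauffman bracket\<close>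

text \<open>
  Smoothing at the crossing \<open>x\<close> so that the two opposite corners in \<open>P\<close> become connected.
  The regions swept by rotating the upper strand counterclockwise (those between an over dart and
  the next dart) are the ones connected by the positive smoothing.
\<close>

definition smoothing :: "'a diagram \<Rightarrow> 'a set \<Rightarrow> 'a set \<Rightarrow> 'a diagram" where
  "smoothing D x P = D\<lparr>
     rot := (\<lambda>h. if h \<in> x \<inter> P then rot D (rot D (rot D h)) else rot D h),
     over := over D - x,
     region := (region D \<union> {(h, rot D (rot D h)) | h. h \<in> P})\<^sup>+\<rparr>"

definition pos_smoothing :: "'a diagram \<Rightarrow> 'a set \<Rightarrow> 'a diagram" where
  "pos_smoothing D x = smoothing D x (x \<inter> over D)"

definition neg_smoothing :: "'a diagram \<Rightarrow> 'a set \<Rightarrow> 'a diagram" where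
  "neg_smoothing D x = smoothing D x (x - over D)"

inductive kauffman :: "'a diagram \<Rightarrow> laurent \<Rightarrow> bool" where
  circles: "crossings D = {} \<Longrightarrow> kauffman D (loop_value ^ (card (components D) - 1))"
| skein: "x \<in> crossings D \<Longrightarrow> kauffman (pos_smoothing D x) a \<Longrightarrow> kauffman (neg_smoothing D x) b \<Longrightarrow>
    kauffman D (A_pow 1 * a + A_pow (- 1) * b)"

definition bracket :: "'a diagram \<Rightarrow> laurent" where
  "bracket D = (THE v. kauffman D v)"


section \<open>Links\<close>

text \<open>Removal of a marked point \<open>{a, rot a}\<close> from a strand.\<close>

definition unmark_move :: "'a diagram \<Rightarrow> 'a diagram \<Rightarrow> bool" where
  "unmark_move D D' \<longleftrightarrow> (\<exists>a b. a \<in> darts D \<and> b = rot D a \<and> rot D b = a \<and> mate D a \<noteq> b \<and>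
     D' = \<lparr>darts = darts D - {a, b},
           rot = rot D,
           mate = (mate D)(mate D a := mate D b, mate D b := mate D a),
           over = over D,
           region = Restr (region D) (darts D - {a, b})\<rparr>)"

text \<open>Removal of a kink: \<open>a\<close> and \<open>b\<close> form the edge of a monogon at the crossing \<open>(a b c d)\<close>.
  The crossing becomes the marked point \<open>(c d)\<close>.\<close>

definition reidemeister1 :: "'a diagram \<Rightarrow> 'a diagram \<Rightarrow> bool" where
  "reidemeister1 D D' \<longleftrightarrow> (\<exists>a b c d. a \<in> crossing_darts D \<and>
     b = rot D a \<and> c = rot D b \<and> d = rot D c \<and>
     mate D a = b \<and> region D `` {a} = {a} \<and>
     D' = \<lparr>darts = darts D - {a, b},
           rot = (rot D)(c := d, d := c),
           mate = mate D,
           over = over D - {a, b, c, d},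
           region = Restr (region D) (darts D - {a, b})\<rparr>)"

text \<open>Removal of a bigon with corners \<open>a\<close>, \<open>e\<close> at the crossings \<open>(a b c d)\<close>, \<open>(e f g h)\<close>,
  bounded by the edges \<open>a f\<close> and \<open>b e\<close>. The strands \<open>c a f h\<close> and \<open>d b e g\<close> are pulled apart, which
  creates marked points \<open>(c h)\<close> and \<open>(d g)\<close> and connects the regions at the corners \<open>c\<close> and \<open>g\<close>.\<close>

definition reidemeister2 :: "'a diagram \<Rightarrow> 'a diagram \<Rightarrow> bool" where
  "reidemeister2 D D' \<longleftrightarrow> (\<exists>a b c d e f g h. a \<in> crossing_darts D \<and> e \<in> crossing_darts D \<and>
     b = rot D a \<and> c = rot D b \<and> d = rot D c \<and>
     f = rot D e \<and> g = rot D f \<and> h = rot D g \<and>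
     vertex_at D a \<noteq> vertex_at D e \<and>
     mate D a = f \<and> mate D b = e \<and> region D `` {a} = {a, e} \<and>
     (a \<in> over D \<longleftrightarrow> f \<in> over D) \<and>
     D' = \<lparr>darts = darts D - {a, b, e, f},
           rot = (rot D)(c := h, h := c, d := g, g := d),
           mate = mate D,
           over = over D - {a, b, c, d, e, f, g, h},
           region = Restr ((region D \<union> {(c, g), (g, c)})\<^sup>+) (darts D - {a, b, e, f})\<rparr>)"

text \<open>
  The triangle has its corners \<open>a i\<close> (\<open>i < 3\<close>, indices modulo 3) at three crossings
  \<open>(a i, b i, c i, d i)\<close> and edges joining \<open>a i\<close> to \<open>b (i + 1)\<close>; strand \<open>i\<close> runs through
  \<open>c i, a i, b (i + 1), d (i + 1)\<close>. It must not be the case that each strand passes over the next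
  one cyclically. After the move the strand meets the other two in the opposite order. This is
  achieved by keeping all edges and forming new crossings: \<open>(d (i + 1), c (i + 2), b (i + 1), a (i + 2))\<close>
  replaces \<open>(a i, b i, c i, d i)\<close> as crossing of strand \<open>i\<close> (whose darts there are \<open>d (i + 1)\<close>,
  \<open>b (i + 1)\<close>) with strand \<open>i + 2\<close>. The function \<open>old\<close> names, for each new corner, an old corner in
  the same region, the new triangle inheriting the place of the old one.
\<close>

definition reidemeister3 :: "'a diagram \<Rightarrow> 'a diagram \<Rightarrow> bool" where
  "reidemeister3 D D' \<longleftrightarrow> (\<exists>a b c d :: nat \<Rightarrow> 'a. \<exists>old.
     (\<forall>i<3. a i \<in> crossing_darts D \<and>
        b i = rot D (a i) \<and> c i = rot D (b i) \<and> d i = rot D (c i) \<and>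
        mate D (a i) = b ((i + 1) mod 3)) \<and>
     inj_on (\<lambda>i. vertex_at D (a i)) {..<3} \<and>
     region D `` {a 0} = {a 0, a 1, a 2} \<and>
     \<not> (a 0 \<in> over D \<and> a 1 \<in> over D \<and> a 2 \<in> over D) \<and>
     \<not> (a 0 \<notin> over D \<and> a 1 \<notin> over D \<and> a 2 \<notin> over D) \<and>
     darts D' = darts D \<and>
     (\<forall>x\<in>darts D. mate D' x = mate D x) \<and>
     (\<forall>i<3. rot D' (d ((i + 1) mod 3)) = c ((i + 2) mod 3) \<and>
            rot D' (c ((i + 2) mod 3)) = b ((i + 1) mod 3) \<and>
            rot D' (b ((i + 1) mod 3)) = a ((i + 2) mod 3) \<and>
            rot D' (a ((i + 2) mod 3)) = d ((i + 1) mod 3)) \<and>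
     (\<forall>i<3. (d ((i + 1) mod 3) \<in> over D' \<longleftrightarrow> a i \<in> over D) \<and>
            (b ((i + 1) mod 3) \<in> over D' \<longleftrightarrow> a i \<in> over D) \<and>
            (c ((i + 2) mod 3) \<in> over D' \<longleftrightarrow> a i \<notin> over D) \<and>
            (a ((i + 2) mod 3) \<in> over D' \<longleftrightarrow> a i \<notin> over D)) \<and>
     (\<forall>x\<in>darts D - (\<Union>i<3. {a i, b i, c i, d i}).
        rot D' x = rot D x \<and> (x \<in> over D' \<longleftrightarrow> x \<in> over D) \<and> old x = x) \<and>
     (\<forall>i<3. old (a i) = c ((i + 2) mod 3) \<and> old (b i) = a i \<and> old (c i) = c i \<and> old (d i) = d i) \<and>
     region D' = {(x, y) \<in> darts D \<times> darts D. (old x, old y) \<in> region D})"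

definition diagram_move :: "'a diagram \<Rightarrow> 'a diagram \<Rightarrow> bool" where
  "diagram_move D D' \<longleftrightarrow> link_diagram D \<and> link_diagram D' \<and>
     (diagram_iso D D' \<or> unmark_move D D' \<or>
      reidemeister1 D D' \<or> reidemeister2 D D' \<or> reidemeister3 D D')"

text \<open>A link is a class of diagrams with respect to the Reidemeister moves. Every finite diagram has
  isomorphic copies with darts in \<^typ>\<open>nat\<close>.\<close>

definition links :: "nat diagram set set" where
  "links = {D. link_diagram D} // {(D, D'). link_diagram D \<and> equivclp diagram_move D D'}"


section \<open>Twist number\<close>

text \<open>
  A circle through exactly the crossings \<open>x\<close> and \<open>y\<close> passes at each of them from a corner \<open>h\<close> to the
  opposite corner \<open>rot (rot h)\<close>, and stays within one region in between. The relation is already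
  transitive on connected diagrams; taking the generated equivalence avoids relying on this.
\<close>

definition twist_equiv :: "'a diagram \<Rightarrow> ('a set \<times> 'a set) set" where
  "twist_equiv D = {(x, y). x \<in> crossings D \<and> y \<in> crossings D \<and>
     (\<exists>h\<in>x. \<exists>g\<in>y. (h, g) \<in> region D \<and> (rot D (rot D h), rot D (rot D g)) \<in> region D)}\<^sup>+"

definition twist_number :: "'a diagram \<Rightarrow> nat" where
  "twist_number D = card (crossings D // twist_equiv D)"

definition link_twist_number :: "nat diagram set \<Rightarrow> nat" where
  "link_twist_number L = (LEAST n. \<exists>D\<in>L. twist_number D = n)"

text \<open>Besides the first two Reidemeister moves, superfluous marked points are removed; then bigons
  are regions with exactly two corners.\<close>

definition reduced_diagram :: "'a diagram \<Rightarrow> bool" where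
  "reduced_diagram D \<longleftrightarrow>
     \<not> (\<exists>D'. unmark_move D D' \<or> reidemeister1 D D' \<or> reidemeister2 D D')"

definition bigon_adjacent :: "'a diagram \<Rightarrow> ('a set \<times> 'a set) set" where
  "bigon_adjacent D = {(x, y). x \<in> crossings D \<and> y \<in> crossings D \<and> x \<noteq> y \<and>
     (\<exists>h\<in>x. \<exists>g\<in>y. region D `` {h} = {h, g})}"

definition twists_bigon_connected :: "'a diagram \<Rightarrow> bool" where
  "twists_bigon_connected D \<longleftrightarrow> twist_equiv D \<subseteq> (bigon_adjacent D)\<^sup>*"


section \<open>Signed plane graphs and their diagrams\<close>

text \<open>
  Plane graphs as rotation systems: \<open>rev\<close> reverses a dart, \<open>org\<close> is its initial vertex and \<open>nxt\<close>
  the counterclockwise next dart at the same vertex. Loops and multiple edges are allowed.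
\<close>

record ('v, 'e) plane_graph =
  verts :: "'v set"
  gdarts :: "'e set"
  org :: "'e \<Rightarrow> 'v"
  rev :: "'e \<Rightarrow> 'e"
  nxt :: "'e \<Rightarrow> 'e"

text \<open>Connected plane graphs. A single vertex without edges has one face, which is not seen by the
  orbits on darts.\<close>

definition connected_plane_graph :: "('v, 'e, 'z) plane_graph_scheme \<Rightarrow> bool" where
  "connected_plane_graph G \<longleftrightarrow>
     finite (verts G) \<and> verts G \<noteq> {} \<and> finite (gdarts G) \<and>
     (\<forall>x\<in>gdarts G. rev G x \<in> gdarts G \<and> rev G x \<noteq> x \<and> rev G (rev G x) = x) \<and>
     bij_betw (nxt G) (gdarts G) (gdarts G) \<and>
     (\<forall>x\<in>gdarts G. org G x \<in> verts G \<and> orbit (nxt G) x = {y \<in> gdarts G. org G y = org G x}) \<and>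
     (\<forall>v\<in>verts G. \<forall>w\<in>verts G. (v, w) \<in> {(org G x, org G (rev G x)) | x. x \<in> gdarts G}\<^sup>*) \<and>
     2 * card (verts G)
       + 2 * (if gdarts G = {} then 1 else card (orbit (nxt G \<circ> rev G) ` gdarts G))
       = card (gdarts G) + 4"

text \<open>Edges carry signs; \<open>Merged\<close> and \<open>Separated\<close> mark edges at which, instead of a crossing, the
  smoothing that merges respectively separates the two shaded regions is inserted.\<close>

datatype mark = Pos | Neg | Merged | Separated

record ('v, 'e) marked_graph = "('v, 'e) plane_graph" +
  mark :: "'e \<Rightarrow> mark"

text \<open>
  The diagram of a connected marked plane graph. An edge with darts \<open>x\<close> (pointing east) and \<open>rev x\<close>
  (pointing west) gives a crossing with darts \<open>(x, True)\<close> at NW, \<open>(x, False)\<close> at SW, \<open>(rev x, True)\<close>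
  at SE and \<open>(rev x, False)\<close> at NE: the second component tells whether the dart leaves on the left
  or on the right hand side of \<open>x\<close>. Thus the corners at darts \<open>(x, True)\<close> are shaded and lie in the
  region of the vertex \<open>org x\<close>, and the crossing is positive iff these darts are over. A vertex
  without edges gives a circle with one marked point. The edges of the diagram run along the
  boundaries of the shaded regions, one for each corner of the graph.
\<close>

definition graph_diagram :: "('v, 'e) marked_graph \<Rightarrow> (('e \<times> bool) + ('v \<times> bool)) diagram" where
  "graph_diagram G =
    (let H = Inl ` (gdarts G \<times> UNIV) \<union> Inr ` ((verts G - org G ` gdarts G) \<times> UNIV);
         rt = (\<lambda>h. case h of
             Inl (x, True) \<Rightarrow> (if mark G x = Merged then Inl (rev G x, False) else Inl (x, False))
           | Inl (x, False) \<Rightarrow> (if mark G x = Separated then Inl (x, True) else Inl (rev G x, True))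
           | Inr (v, s) \<Rightarrow> Inr (v, \<not> s));
         mt = (\<lambda>h. case h of
             Inl (x, True) \<Rightarrow> Inl (nxt G x, False)
           | Inl (x, False) \<Rightarrow> Inl (inv_into (gdarts G) (nxt G) x, True)
           | Inr (v, s) \<Rightarrow> Inr (v, \<not> s))
     in \<lparr>darts = H,
         rot = rt,
         mate = mt,
         over = {Inl (x, True) | x. x \<in> gdarts G \<and> mark G x = Pos} \<union>
                {Inl (x, False) | x. x \<in> gdarts G \<and> mark G x = Neg},
         region = Restr {(h, g). equivclp (\<lambda>h g.
              (h \<in> H \<and> g = mt (rt h)) \<or>
              (\<exists>x\<in>gdarts G. mark G x = Merged \<and> h = Inl (x, True) \<and> g = Inl (rev G x, True)) \<or>
              (\<exists>x\<in>gdarts G. mark G x = Separated \<and> h = Inl (x, False) \<and> g = Inl (rev G x, False))) h g} H\<rparr>)"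

text \<open>Checkerboard colorings of a diagram in the plane, given by the set \<open>S\<close> of shaded corners;
  \<open>u\<close> is a corner in the unbounded region.\<close>

definition checkerboard :: "'a diagram \<Rightarrow> 'a \<Rightarrow> 'a set \<Rightarrow> bool" where
  "checkerboard D u S \<longleftrightarrow> S \<subseteq> darts D \<and> u \<notin> S \<and> region D `` S \<subseteq> S \<and>
     (\<forall>h\<in>darts D. h \<in> S \<longleftrightarrow> rot D h \<notin> S)"

text \<open>
  The signed graph of a connected diagram with shaded corners \<open>S\<close>. Its darts are the shaded corners
  at crossings, each standing for the half-edge running from inside the shaded region to the
  crossing. Counterclockwise order around a vertex is the counterclockwise order of corners along
  the boundary of the region, skipping marked points.
\<close>

definition signed_graph :: "'a diagram \<Rightarrow> 'a set \<Rightarrow> ('a set, 'a) marked_graph" where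
  "signed_graph D S =
    (let step = (\<lambda>h. inv_into (darts D) (rot D) (mate D h))
     in \<lparr>verts = {C \<in> darts D // region D. C \<subseteq> S},
         gdarts = S \<inter> crossing_darts D,
         org = (\<lambda>h. region D `` {h}),
         rev = (\<lambda>h. rot D (rot D h)),
         nxt = (\<lambda>h. (step ^^ (LEAST n. 0 < n \<and> (step ^^ n) h \<in> crossing_darts D)) h),
         mark = (\<lambda>h. if h \<in> over D then Pos else Neg)\<rparr>)"

definition marked_graph_iso ::
    "('v \<Rightarrow> 'w) \<Rightarrow> ('e \<Rightarrow> 'f) \<Rightarrow> ('v, 'e) marked_graph \<Rightarrow> ('w, 'f) marked_graph \<Rightarrow> bool" where
  "marked_graph_iso \<phi> \<psi> G H \<longleftrightarrow>
     bij_betw \<phi> (verts G) (verts H) \<and> bij_betw \<psi> (gdarts G) (gdarts H) \<and>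
     (\<forall>x\<in>gdarts G. org H (\<psi> x) = \<phi> (org G x) \<and> rev H (\<psi> x) = \<psi> (rev G x) \<and>
        nxt H (\<psi> x) = \<psi> (nxt G x) \<and> mark H (\<psi> x) = mark G x)"


section \<open>Colored plane graphs and the diagrams \<open>D\<^sub>t\<close>\<close>

text \<open>\<open>Chain\<close> and \<open>Sheaf\<close> are the colors \<open>c\<close> and \<open>s\<close>. The ordered edges are numbered
  \<open>0, \<dots>, k - 1\<close>; the two darts of edge \<open>i\<close> are \<open>(i, False)\<close> and \<open>(i, True)\<close>.\<close>

datatype color = Chain | Sheaf

definition ordered_plane_graph :: "nat \<Rightarrow> ('v, nat \<times> bool) plane_graph \<Rightarrow> bool" where
  "ordered_plane_graph k G \<longleftrightarrow> connected_plane_graph G \<and> gdarts G = {..<k} \<times> UNIV \<and>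
     (\<forall>i<k. \<forall>s. rev G (i, s) = (i, \<not> s))"

text \<open>
  Replacing edge \<open>i\<close> by a chain or a sheaf of \<open>\<bar>t i\<bar>\<close> edges \<open>(i, j)\<close>, oriented like edge \<open>i\<close>.
  In a chain the edges are numbered from the origin of \<open>(i, False)\<close> on, and \<open>Inr (i, j)\<close> is the new
  vertex between edges \<open>j - 1\<close> and \<open>j\<close>. In a sheaf they are numbered counterclockwise as seen from
  the origin of \<open>(i, False)\<close>. If \<open>t i = 0\<close>, one edge is kept and marked with the smoothing
  replacing its crossing.
\<close>

definition blow_up ::
    "nat \<Rightarrow> ('v, nat \<times> bool) plane_graph \<Rightarrow> (nat \<Rightarrow> color) \<Rightarrow> (nat \<Rightarrow> int) \<Rightarrow>
     ('v + nat \<times> nat, (nat \<times> nat) \<times> bool) marked_graph" where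
  "blow_up k G col t =
    (let m = (\<lambda>i. if t i = 0 then 1 else nat \<bar>t i\<bar>);
         first = (\<lambda>(i, s). if s then ((i, m i - 1), True) else ((i, 0), False))
     in \<lparr>verts = Inl ` verts G \<union> {Inr (i, j) | i j. i < k \<and> col i = Chain \<and> 0 < j \<and> j < m i},
         gdarts = {((i, j), s) | i j s. i < k \<and> j < m i},
         org = (\<lambda>((i, j), s).
            if col i = Sheaf then Inl (org G (i, s))
            else if s then (if j = m i - 1 then Inl (org G (i, True)) else Inr (i, j + 1))
            else (if j = 0 then Inl (org G (i, False)) else Inr (i, j))),
         rev = (\<lambda>(e, s). (e, \<not> s)),
         nxt = (\<lambda>((i, j), s). case col i of
            Sheaf \<Rightarrow>
              (if s then (if j = 0 then first (nxt G (i, True)) else ((i, j - 1), True))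
               else (if j = m i - 1 then first (nxt G (i, False)) else ((i, j + 1), False)))
          | Chain \<Rightarrow>
              (if s then (if j = m i - 1 then first (nxt G (i, True)) else ((i, j + 1), False))
               else (if j = 0 then first (nxt G (i, False)) else ((i, j - 1), True)))),
         mark = (\<lambda>((i, j), s).
            if 0 < t i then Pos else if t i < 0 then Neg
            else case col i of Chain \<Rightarrow> Merged | Sheaf \<Rightarrow> Separated)\<rparr>)"

definition twisted_diagram ::
    "nat \<Rightarrow> ('v, nat \<times> bool) plane_graph \<Rightarrow> (nat \<Rightarrow> color) \<Rightarrow> (nat \<Rightarrow> int) \<Rightarrow>
     ((((nat \<times> nat) \<times> bool) \<times> bool) + (('v + nat \<times> nat) \<times> bool)) diagram" where
  "twisted_diagram k G col t = graph_diagram (blow_up k G col t)"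

text \<open>
  \<open>G\<close> with coloring \<open>col\<close> is a colored graph of the connected diagram \<open>D\<close> (with a corner \<open>u\<close> in the
  unbounded region), with signed lengths \<open>t\<close>: replacing the edges of \<open>G\<close> by chains and sheafs
  recovers the signed graph of \<open>D\<close>, and the chains and sheafs are the twist classes of \<open>D\<close>.
  A one element class may be colored either way.
\<close>

definition colored_graph_of ::
    "'a diagram \<Rightarrow> 'a \<Rightarrow> nat \<Rightarrow> ('v, nat \<times> bool) plane_graph \<Rightarrow> (nat \<Rightarrow> color) \<Rightarrow> (nat \<Rightarrow> int) \<Rightarrow> bool"
  where
  "colored_graph_of D u k G col t \<longleftrightarrow> ordered_plane_graph k G \<and> (\<forall>i<k. t i \<noteq> 0) \<and>
     (\<exists>S \<phi> \<psi>. checkerboard D u S \<and> marked_graph_iso \<phi> \<psi> (blow_up k G col t) (signed_graph D S) \<and>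
       (\<forall>((i, j), s) \<in> gdarts (blow_up k G col t). \<forall>((i', j'), s') \<in> gdarts (blow_up k G col t).
          (vertex_at D (\<psi> ((i, j), s)), vertex_at D (\<psi> ((i', j'), s'))) \<in> twist_equiv D \<longleftrightarrow> i = i'))"


section \<open>Spanning trees\<close>

text \<open>Sets of edges are given by their numbers.\<close>

definition edge_cycle :: "('v, nat \<times> bool) plane_graph \<Rightarrow> nat set \<Rightarrow> (nat \<times> bool) list \<Rightarrow> bool" where
  "edge_cycle G F xs \<longleftrightarrow> xs \<noteq> [] \<and> set xs \<subseteq> F \<times> UNIV \<and>
     distinct (map fst xs) \<and> distinct (map (org G) xs) \<and>
     (\<forall>n<length xs. org G (rev G (xs ! n)) = org G (xs ! (Suc n mod length xs)))"

definition spanning_tree :: "nat \<Rightarrow> ('v, nat \<times> bool) plane_graph \<Rightarrow> nat set \<Rightarrow> bool" where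
  "spanning_tree k G F \<longleftrightarrow> F \<subseteq> {..<k} \<and>
     (\<forall>v\<in>verts G. \<forall>w\<in>verts G. (v, w) \<in> {(org G x, org G (rev G x)) | x. x \<in> F \<times> UNIV}\<^sup>*) \<and>
     \<not> (\<exists>xs. edge_cycle G F xs)"

definition tree_weight :: "nat \<Rightarrow> (nat \<Rightarrow> color) \<Rightarrow> nat set \<Rightarrow> nat" where
  "tree_weight k col F =
     card {i. i < k \<and> col i = Sheaf \<and> i \<in> F} + card {i. i < k \<and> col i = Chain \<and> i \<notin> F}"

definition max_tree_weight :: "nat \<Rightarrow> ('v, nat \<times> bool) plane_graph \<Rightarrow> (nat \<Rightarrow> color) \<Rightarrow> nat" where
  "max_tree_weight k G col = Max (tree_weight k col ` {F. spanning_tree k G F})"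

definition signed_exponent :: "(nat \<Rightarrow> color) \<Rightarrow> (nat \<Rightarrow> int) \<Rightarrow> nat \<Rightarrow> int" where
  "signed_exponent col t i = (case col i of Chain \<Rightarrow> t i | Sheaf \<Rightarrow> - t i)"

end

theory Submission
  imports Defs
begin

text \<open>
  The bracket is the state sum over the sets \<open>S\<close> of edges at which the shaded regions are merged.
  In a chain or sheaf of length \<open>r\<close> only two cases matter for the rest of the diagram: no edge is
  special (separated in a chain, merged in a sheaf), with total weight \<open>A\<^sup>r\<close>, or some edge is, in
  which case \<open>j\<close> special edges split off \<open>j - 1\<close> circles. By the binomial theorem the latter states
  have total weight \<open>d\<^sup>-\<^sup>1 A\<^sup>r ((-A\<^sup>-\<^sup>4)\<^sup>r - 1)\<close>, as \<open>A + A\<^sup>-\<^sup>1 d = -A\<^sup>-\<^sup>3\<close>. So the bracket is a sum over the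
  sets \<open>T\<close> of edges of \<open>G\<close> of such factors times \<open>d\<^bsup>c - 1 - |T|\<^esup>\<close>, where \<open>c\<close> is the number of circles
  of the corresponding state of \<open>G\<close>. It remains to see that \<open>|T| \<le> p + c - 1\<close>. As long as \<open>c > 1\<close>,
  connectedness provides an edge with different circles on its two sides, and switching the state
  there decreases \<open>c\<close> by one; a state with \<open>c = 1\<close> is a spanning tree by the Euler formula. Hence
  \<open>T\<close> differs in at most \<open>c - 1\<close> places from the set of edges counted in \<open>p\<^sub>F\<close> for some tree \<open>F\<close>.
\<close>

section \<open>Classes of generated equivalence relations\<close>

text \<open>A state \<open>S\<close> thickens to a ribbon surface, with a disc for each vertex and a
  band for each edge in \<open>S\<close>. Apart from isolated vertices, its boundary circles,
  followed in the direction of the boundary, are the cycles of one permutation of half-edges,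
  \<open>flip S \<circ> nx\<close>. Switching an edge multiplies it by a transposition, which makes
  the number of circles controllable. Cycles are counted as classes of a generated equivalence
  because the same circles have to be compared on three carriers (darts of the diagram, half-edges
  of the blown-up graph, half-edges of \<open>G\<close>), by maps that are inverse to each other
  only up to moving along a circle.

  The exponent \<open>c - 1 - |T|\<close> may be negative; \<open>p\<close> bounds the deficit
  independently of \<open>t\<close>. Calling an edge special according to its color exchanges
  merging and separating in sheafs. Thus \<open>p\<^sub>F\<close> becomes the number of special
  edges of the state \<open>F\<close>, and only the sign of the exponent remembers the
  color.\<close>

definition gen_equiv :: "('a \<times> 'a) set \<Rightarrow> ('a \<times> 'a) set" where
  "gen_equiv R = (R \<union> R\<inverse>)\<^sup>*"

text \<open>Classes are taken in the whole type and may extend beyond \<open>X\<close>;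
  \<open>X\<close> only selects those that meet it.\<close>

definition num_classes :: "'a set \<Rightarrow> ('a \<times> 'a) set \<Rightarrow> nat" where
  "num_classes X R = card (X // gen_equiv R)"

lemma equiv_gen_equiv: "equiv UNIV (gen_equiv R)"
proof -
  have "sym (gen_equiv R)"
    unfolding gen_equiv_def by (rule sym_rtrancl) (auto simp: sym_def)
  then show ?thesis
    by (auto simp: gen_equiv_def equiv_def refl_on_def trans_rtrancl)
qed

lemma gen_equiv_refl [simp]: "(x, x) \<in> gen_equiv R"
  by (simp add: gen_equiv_def)

lemma gen_equiv_sym: "(x, y) \<in> gen_equiv R \<Longrightarrow> (y, x) \<in> gen_equiv R"
  using equiv_gen_equiv[of R] by (meson equiv_def symE)

lemma gen_equiv_trans [trans]:
  "(x, y) \<in> gen_equiv R \<Longrightarrow> (y, z) \<in> gen_equiv R \<Longrightarrow> (x, z) \<in> gen_equiv R"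
  by (auto simp: gen_equiv_def)

lemma gen_equiv_base: "(x, y) \<in> R \<Longrightarrow> (x, y) \<in> gen_equiv R"
  by (auto simp: gen_equiv_def)

lemma gen_equiv_induct [consumes 1, case_names refl step sym trans]:
  assumes "(x, y) \<in> gen_equiv R"
    and "\<And>x. P x x" and "\<And>x y. (x, y) \<in> R \<Longrightarrow> P x y"
    and "\<And>x y. P x y \<Longrightarrow> P y x" and "\<And>x y z. P x y \<Longrightarrow> P y z \<Longrightarrow> P x z"
  shows "P x y"
  using assms(1) unfolding gen_equiv_def
proof (induction rule: rtrancl_induct)
  case base
  show ?case by (rule assms(2))
next
  case (step y z)
  have "P y z" using step.hyps(2) assms(3,4) by blast
  then show ?case using step.IH assms(5) by blast
qed

lemma gen_equiv_image:
  assumes "(x, y) \<in> gen_equiv R" and "\<And>x y. (x, y) \<in> R \<Longrightarrow> (f x, f y) \<in> gen_equiv S"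
  shows "(f x, f y) \<in> gen_equiv S"
  using assms(1)
proof (induction rule: gen_equiv_induct)
  case (step x y) then show ?case by (rule assms(2))
qed (auto intro: gen_equiv_sym gen_equiv_trans)

lemma gen_equiv_least:
  assumes "(x, y) \<in> gen_equiv R" and "\<And>x y. (x, y) \<in> R \<Longrightarrow> (x, y) \<in> gen_equiv S"
  shows "(x, y) \<in> gen_equiv S"
  using gen_equiv_image[OF assms(1), of id S] assms(2) by simp

lemma gen_equiv_closed:
  assumes "(x, y) \<in> gen_equiv R" "R \<subseteq> X \<times> X"
  shows "x \<in> X \<longleftrightarrow> y \<in> X"
  using assms(1) by (induction rule: gen_equiv_induct) (use assms(2) in auto)

text \<open>\<open>f\<close> and \<open>g\<close> respect the relations and are inverse up to them,
  so they induce mutually inverse bijections of the quotients.\<close>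

lemma card_quotient_eqI:
  assumes r: "equiv A r" and s: "equiv B s" and "X \<subseteq> A" "Y \<subseteq> B"
    and f: "\<And>x. x \<in> X \<Longrightarrow> f x \<in> Y" and g: "\<And>y. y \<in> Y \<Longrightarrow> g y \<in> X"
    and fr: "\<And>x y. x \<in> X \<Longrightarrow> y \<in> X \<Longrightarrow> (x, y) \<in> r \<Longrightarrow> (f x, f y) \<in> s"
    and gs: "\<And>x y. x \<in> Y \<Longrightarrow> y \<in> Y \<Longrightarrow> (x, y) \<in> s \<Longrightarrow> (g x, g y) \<in> r"
    and gf: "\<And>x. x \<in> X \<Longrightarrow> (x, g (f x)) \<in> r" and fg: "\<And>y. y \<in> Y \<Longrightarrow> (y, f (g y)) \<in> s"
  shows "card (X // r) = card (Y // s)"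
proof (rule bij_betw_same_card)
  let ?h = "\<lambda>C. \<Union>x\<in>C \<inter> X. s `` {f x}"
  have h: "?h (r `` {x}) = s `` {f x}" if "x \<in> X" for x
  proof -
    have "s `` {f y} = s `` {f x}" if "y \<in> r `` {x} \<inter> X" for y
      using fr[of x y] that \<open>x \<in> X\<close> equiv_class_eq[OF s] by blast
    moreover have "x \<in> r `` {x}" using r \<open>x \<in> X\<close> \<open>X \<subseteq> A\<close> by (meson equiv_class_self subsetD)
    ultimately show ?thesis using \<open>x \<in> X\<close> by blast
  qed
  show "bij_betw ?h (X // r) (Y // s)"
    unfolding bij_betw_def
  proof
    show "inj_on ?h (X // r)"
    proof (rule inj_onI)
      fix C D assume "C \<in> X // r" "D \<in> X // r" and eq: "?h C = ?h D"
      then obtain x y where x: "x \<in> X" "C = r `` {x}" and y: "y \<in> X" "D = r `` {y}"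
        by (meson quotientE)
      have "(f x, f y) \<in> s"
        using eq h x y f s \<open>Y \<subseteq> B\<close> by (metis eq_equiv_class subsetD)
      then have "(g (f x), g (f y)) \<in> r" using gs f x y by blast
      then have "(x, y) \<in> r"
        using gf[OF x(1)] gf[OF y(1)] r by (meson equiv_def symE transE)
      then show "C = D" using x y equiv_class_eq[OF r] by blast
    qed
    show "?h ` (X // r) = Y // s"
    proof (intro equalityI subsetI)
      fix C assume "C \<in> ?h ` (X // r)"
      then obtain x where "x \<in> X" "C = ?h (r `` {x})" by (auto elim: quotientE)
      then show "C \<in> Y // s" using h f by (auto intro: quotientI)
    next
      fix C assume "C \<in> Y // s"
      then obtain y where y: "y \<in> Y" "C = s `` {y}" by (meson quotientE)
      then have "C = ?h (r `` {g y})" using h g fg equiv_class_eq[OF s] by metis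
      then show "C \<in> ?h ` (X // r)" using y g by (blast intro: quotientI)
    qed
  qed
qed

text \<open>Compatibility has to be checked on generating pairs only, which for circles means on
  single steps.\<close>

lemma num_classes_eqI:
  assumes "\<And>x. x \<in> X \<Longrightarrow> f x \<in> Y" and "\<And>y. y \<in> Y \<Longrightarrow> g y \<in> X"
    and "\<And>x y. (x, y) \<in> R \<Longrightarrow> (f x, f y) \<in> gen_equiv S"
    and "\<And>x y. (x, y) \<in> S \<Longrightarrow> (g x, g y) \<in> gen_equiv R"
    and "\<And>x. x \<in> X \<Longrightarrow> (x, g (f x)) \<in> gen_equiv R"
    and "\<And>y. y \<in> Y \<Longrightarrow> (y, f (g y)) \<in> gen_equiv S"
  shows "num_classes X R = num_classes Y S"
  unfolding num_classes_def
  by (rule card_quotient_eqI[OF equiv_gen_equiv equiv_gen_equiv, where f=f and g=g])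
    (use assms in \<open>auto intro: gen_equiv_image\<close>)

text \<open>The right summand carries no relation, so each of its elements is a class of its own. It
  will hold the circles around isolated vertices and the circles closed off inside a chain or
  sheaf.\<close>

lemma num_classes_Plus:
  fixes A :: "'a set" and B :: "'b set"
  assumes "finite A" "finite B"
  shows "num_classes (A <+> B) (map_prod Inl Inl ` R) = num_classes A R + card B"
proof -
  let ?R = "map_prod Inl Inl ` R :: (('a + 'b) \<times> ('a + 'b)) set"
  let ?Inl = "Inl :: 'a \<Rightarrow> 'a + 'b" and ?Inr = "Inr :: 'b \<Rightarrow> 'a + 'b"
  have 1: "gen_equiv ?R `` {Inl x} = Inl ` (gen_equiv R `` {x})" for x
  proof -
    \<comment> \<open>The relation is described on both summands at once, so that the description is
      closed under symmetry and transitivity in the induction.\<close>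
    have "(case z of Inl x \<Rightarrow> (case w of Inl y \<Rightarrow> (x, y) \<in> gen_equiv R | Inr _ \<Rightarrow> False)
            | Inr b \<Rightarrow> w = Inr b)" if "(z, w) \<in> gen_equiv ?R" for z w
      using that
      by (induction rule: gen_equiv_induct)
        (auto split: sum.splits intro: gen_equiv_base gen_equiv_sym gen_equiv_trans)
    from this[of "Inl x"] have "\<exists>y. w = Inl y \<and> (x, y) \<in> gen_equiv R"
      if "(Inl x, w) \<in> gen_equiv ?R" for w
      using that by (fastforce split: sum.splits)
    moreover have "(Inl x, Inl y) \<in> gen_equiv ?R" if "(x, y) \<in> gen_equiv R" for y
      using that by (rule gen_equiv_image) (auto intro!: gen_equiv_base)
    ultimately show ?thesis by blast
  qed
  have 2: "gen_equiv ?R `` {Inr b} = {Inr b}" for b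
  proof -
    have "z = Inr b \<longleftrightarrow> w = Inr b" if "(z, w) \<in> gen_equiv ?R" for z w
      using that by (induction rule: gen_equiv_induct) auto
    then show ?thesis by auto
  qed
  have "(A <+> B) // gen_equiv ?R = (\<lambda>C. ?Inl ` C) ` (A // gen_equiv R) \<union> (\<lambda>b. {?Inr b}) ` B"
    by (auto simp: quotient_def 1 2 Plus_def)
  moreover have "card ((\<lambda>C. ?Inl ` C) ` (A // gen_equiv R)) = card (A // gen_equiv R)"
    by (rule card_image) (auto intro!: inj_onI simp: inj_image_eq_iff)
  moreover have "card ((\<lambda>b. {?Inr b}) ` B) = card B"
    by (rule card_image) (auto intro!: inj_onI)
  moreover have "finite (A // gen_equiv R)" using assms(1) by (simp add: quotient_def)
  ultimately show ?thesis
    unfolding num_classes_def using assms(2)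
    by (subst \<open>(A <+> B) // _ = _\<close>, subst card_Un_disjoint) auto
qed

text \<open>Identifying \<open>a\<close> and \<open>b\<close> unites their two classes and leaves
  all others alone.\<close>

lemma gen_equiv_insert:
  "gen_equiv (insert (a, b) R) = gen_equiv R \<union>
     (gen_equiv R `` {a, b}) \<times> (gen_equiv R `` {a, b})" (is "?L = ?M")
proof (intro equalityI subrelI)
  fix x y assume "(x, y) \<in> ?L"
  then show "(x, y) \<in> ?M"
  proof (induction rule: gen_equiv_induct)
    case (trans x y z)
    then show ?case unfolding Un_iff mem_Sigma_iff Image_iff
      by (meson gen_equiv_sym gen_equiv_trans)
  next
    case (step x y)
    moreover have "a \<in> gen_equiv R `` {a, b}" "b \<in> gen_equiv R `` {a, b}"
      using gen_equiv_refl[of a R] gen_equiv_refl[of b R] by blast+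
    ultimately show ?case by (auto intro: gen_equiv_base)
  qed (auto intro: gen_equiv_sym)
next
  have mono: "(x, y) \<in> ?L" if "(x, y) \<in> gen_equiv R" for x y
    using that by (rule gen_equiv_least) (auto intro: gen_equiv_base)
  fix x y assume "(x, y) \<in> ?M"
  then consider "(x, y) \<in> gen_equiv R"
    | u v where "u \<in> {a, b}" "v \<in> {a, b}" "(u, x) \<in> gen_equiv R" "(v, y) \<in> gen_equiv R"
    by blast
  then show "(x, y) \<in> ?L"
  proof cases
    case 1 then show ?thesis by (rule mono)
  next
    case 2
    have "(a, b) \<in> ?L" by (auto intro: gen_equiv_base)
    then have "(u, v) \<in> ?L" using 2 by (auto intro: gen_equiv_sym)
    then show ?thesis using 2 by (meson mono gen_equiv_sym gen_equiv_trans)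
  qed
qed

lemma num_classes_insert:
  assumes "(a, b) \<in> gen_equiv R"
  shows "num_classes X (insert (a, b) R) = num_classes X R"
proof -
  have "gen_equiv (insert (a, b) R) = gen_equiv R"
    using assms by (auto intro: gen_equiv_base elim: gen_equiv_least)
  then show ?thesis by (simp add: num_classes_def)
qed

text \<open>The two distinct classes of \<open>a\<close> and \<open>b\<close> give way to the single
  class \<open>?J\<close>.\<close>

lemma num_classes_insert_new:
  assumes "(a, b) \<notin> gen_equiv R" "a \<in> X" "b \<in> X" "finite X"
  shows "num_classes X R = Suc (num_classes X (insert (a, b) R))"
proof -
  let ?c = "\<lambda>x. gen_equiv R `` {x}" and ?J = "gen_equiv R `` {a, b}"
  let ?N = "(X // gen_equiv R) - {?c a, ?c b}"
  have eq_iff: "?c x = ?c y \<longleftrightarrow> (x, y) \<in> gen_equiv R" for x y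
    using equiv_gen_equiv[of R] by (simp add: eq_equiv_class_iff)
  have "gen_equiv (insert (a, b) R) `` {x} = (if x \<in> ?J then ?J else ?c x)" for x
    unfolding gen_equiv_insert by (auto intro: gen_equiv_sym gen_equiv_trans)
  then have "X // gen_equiv (insert (a, b) R) = (\<lambda>x. if x \<in> ?J then ?J else ?c x) ` X"
    by (simp only: quotient_def UNION_singleton_eq_range)
  also have "\<dots> = insert ?J ((\<lambda>x. ?c x) ` (X - ?J))"
  proof -
    have "a \<in> ?J" using gen_equiv_refl[of a R] by blast
    then show ?thesis using assms(2) by auto
  qed
  also have "(\<lambda>x. ?c x) ` (X - ?J) = ?N"
  proof -
    have "x \<in> ?J \<longleftrightarrow> ?c x = ?c a \<or> ?c x = ?c b" for x
      unfolding eq_iff by (auto intro: gen_equiv_sym)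
    moreover have "(\<And>x. x \<in> J \<longleftrightarrow> c x = p \<or> c x = q) \<Longrightarrow> c ` (X - J) = c ` X - {p, q}"
      for c :: "'a \<Rightarrow> 'a set" and J p q by auto
    ultimately have "?c ` (X - ?J) = ?c ` X - {?c a, ?c b}" by presburger
    then show ?thesis by (simp only: quotient_def UNION_singleton_eq_range)
  qed
  finally have eq: "X // gen_equiv (insert (a, b) R) = insert ?J ?N" .
  have "?J \<notin> ?N"
  proof
    assume J: "?J \<in> ?N"
    then obtain x where "?J = ?c x" by (auto simp: quotient_def)
    moreover have "a \<in> ?J" using gen_equiv_refl[of a R] by blast
    ultimately have "(x, a) \<in> gen_equiv R" by blast
    then show False using J \<open>?J = ?c x\<close> eq_iff by auto
  qed
  moreover have fin: "finite (X // gen_equiv R)" using assms(4) by (simp add: quotient_def)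
  ultimately have "num_classes X (insert (a, b) R) = Suc (card ?N)"
    unfolding num_classes_def eq by simp
  moreover have "card ?N = card (X // gen_equiv R) - card {?c a, ?c b}"
    using assms(2,3) fin by (intro card_Diff_subset) (auto intro: quotientI)
  moreover have "card {?c a, ?c b} = 2" using assms(1) eq_iff by auto
  moreover have "card {?c a, ?c b} \<le> card (X // gen_equiv R)"
    using assms(2,3) fin by (intro card_mono) (auto intro: quotientI)
  ultimately show ?thesis unfolding num_classes_def by linarith
qed

lemma num_classes_pos: "finite X \<Longrightarrow> X \<noteq> {} \<Longrightarrow> 0 < num_classes X R"
  by (auto simp: num_classes_def card_gt_0_iff quotient_def)

lemma num_classes_one:
  assumes "finite X" "num_classes X R = 1" "x \<in> X" "y \<in> X"
  shows "(x, y) \<in> gen_equiv R"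
proof -
  obtain C where "X // gen_equiv R = {C}"
    using assms(2) by (auto simp: num_classes_def card_1_singleton_iff)
  then have "gen_equiv R `` {x} = gen_equiv R `` {y}"
    using assms(3,4) by (metis quotientI singletonD)
  then show ?thesis by (auto dest: eq_equiv_class[OF _ equiv_gen_equiv])
qed

lemma num_classes_oneI:
  assumes "x \<in> X" "\<And>y. y \<in> X \<Longrightarrow> (x, y) \<in> gen_equiv R"
  shows "num_classes X R = 1"
proof -
  have "gen_equiv R `` {y} = gen_equiv R `` {x}" if "y \<in> X" for y
    using assms(2)[OF that] equiv_class_eq[OF equiv_gen_equiv] by metis
  then have "(\<lambda>y. gen_equiv R `` {y}) ` X = (\<lambda>y. gen_equiv R `` {x}) ` X"
    by (rule image_cong[OF refl])
  then have "X // gen_equiv R = {gen_equiv R `` {x}}"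
    using assms(1) by (simp only: quotient_def UNION_singleton_eq_range) auto
  then show ?thesis by (simp add: num_classes_def)
qed

section \<open>Cycles of permutations and products with transpositions\<close>

definition graph_on :: "'a set \<Rightarrow> ('a \<Rightarrow> 'a) \<Rightarrow> ('a \<times> 'a) set" where
  "graph_on X f = {(x, f x) | x. x \<in> X}"

lemma mem_graph_on: "(x, y) \<in> graph_on X f \<longleftrightarrow> x \<in> X \<and> y = f x"
  by (auto simp: graph_on_def)

lemma gen_equiv_funpow:
  assumes "x \<in> X" "\<And>x. x \<in> X \<Longrightarrow> f x \<in> X"
  shows "(f ^^ n) x \<in> X \<and> (x, (f ^^ n) x) \<in> gen_equiv (graph_on X f)"
proof (induction n)
  case (Suc n)
  then have "((f ^^ n) x, f ((f ^^ n) x)) \<in> gen_equiv (graph_on X f)"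
    by (auto simp: graph_on_def intro!: gen_equiv_base)
  with Suc show ?case by (auto intro: gen_equiv_trans assms(2))
qed (simp add: assms)

text \<open>\<open>orbit f x\<close> consists of the iterates after at least one step, so the claim
  is that the cycle closes. Extending \<open>f\<close> by the identity outside \<open>X\<close>
  makes it a permutation of finite support.\<close>

lemma finite_bij_self_in_orbit:
  assumes "finite X" "bij_betw f X X" "x \<in> X"
  shows "x \<in> orbit f x"
proof -
  let ?g = "perm_restrict f X"
  have "bij_betw ?g X X" using assms(2) by (rule bij_betw_cong[THEN iffD1, rotated]) (simp add: perm_restrict_def)
  then have "?g permutes X" by (rule bij_imp_permutes) (simp add: perm_restrict_def)
  then have "x \<in> orbit ?g x"
    using assms(1) by (intro permutation_self_in_orbit) (auto simp: permutation_permutes)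
  moreover have "orbit f x = orbit ?g x"
    using assms(2,3) by (intro orbit_cong0[where A=X]) (auto simp: perm_restrict_def bij_betw_def)
  ultimately show ?thesis by simp
qed

lemma orbit_eq_gen_equiv:
  assumes "finite X" "bij_betw f X X" "x \<in> X"
  shows "orbit f x = gen_equiv (graph_on X f) `` {x}"
proof (intro equalityI subsetI)
  fix y assume "y \<in> orbit f x"
  then show "y \<in> gen_equiv (graph_on X f) `` {x}"
    using gen_equiv_funpow[OF assms(3), of f] assms(2)
    by (auto simp: orbit_altdef bij_betw_def)
next
  fix y assume "y \<in> gen_equiv (graph_on X f) `` {x}"
  then have "(x, y) \<in> (graph_on X f \<union> (graph_on X f)\<inverse>)\<^sup>*" by (simp add: gen_equiv_def)
  then show "y \<in> orbit f x"
  proof (induction rule: rtrancl_induct)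
    case base show ?case by (rule finite_bij_self_in_orbit[OF assms])
  next
    case (step y z)
    then consider "z = f y" | "z \<in> X" "y = f z" by (auto simp: graph_on_def)
    then show ?case
    proof cases
      case 1 then show ?thesis using step.IH by (auto intro: orbit.step)
    next
      case 2
      \<comment> \<open>A backward step from \<open>f z\<close> to \<open>z\<close> is a forward
        walk around the rest of the cycle.\<close>
      have "z \<in> orbit f z" by (rule finite_bij_self_in_orbit[OF assms(1,2) 2(1)])
      then have "z \<in> orbit f y" using 2 self_in_orbit_step by metis
      then show ?thesis using step.IH by (rule orbit_trans)
    qed
  qed
qed

lemma card_orbits:
  assumes "finite X" "bij_betw f X X"
  shows "card (orbit f ` X) = num_classes X (graph_on X f)"
proof -
  have "orbit f ` X = X // gen_equiv (graph_on X f)"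
    using orbit_eq_gen_equiv[OF assms] by (auto simp: quotient_def)
  then show ?thesis by (simp add: num_classes_def)
qed

text \<open>Following the cycle of \<open>a\<close> under \<open>f\<close> until it returns to \<open>a\<close>, the composition with the
  transposition is diverted to \<open>b\<close>.\<close>

lemma transpose_joins:
  assumes "finite X" "bij_betw f X X" "a \<in> X" "b \<in> X" "(a, b) \<notin> gen_equiv (graph_on X f)"
  shows "(a, b) \<in> gen_equiv (graph_on X (transpose a b \<circ> f))"
proof -
  let ?g = "transpose a b \<circ> f"
  have fX: "f x \<in> X" if "x \<in> X" for x using assms(2) that by (auto simp: bij_betw_def)
  have "a \<in> orbit f a" by (rule finite_bij_self_in_orbit[OF assms(1-3)])
  then have ex: "\<exists>n. 0 < n \<and> (f ^^ n) a = a" by (auto simp: orbit_altdef)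
  define n where "n = (LEAST n. 0 < n \<and> (f ^^ n) a = a)"
  have n: "0 < n" "(f ^^ n) a = a" using LeastI_ex[OF ex] by (auto simp: n_def)
  have least: "(f ^^ m) a \<noteq> a" if "0 < m" "m < n" for m :: nat
    using not_less_Least[of m "\<lambda>n. 0 < n \<and> (f ^^ n) a = a"] that by (auto simp: n_def)
  have notb: "(f ^^ m) a \<noteq> b" for m :: nat
    using gen_equiv_funpow[OF assms(3) fX, where n=m] assms(5) by auto
  \<comment> \<open>Before the first return the iterates avoid both \<open>a\<close> and
    \<open>b\<close>, so the transposition does not act on them.\<close>
  have same: "(?g ^^ m) a = (f ^^ m) a" if "m < n" for m :: nat
    using that
  proof (induction m)
    case (Suc m)
    then show ?case using least[of "Suc m"] notb[of "Suc m"] by simp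
  qed simp
  obtain m where m: "n = Suc m" using n(1) gr0_implies_Suc by blast
  then have "(?g ^^ n) a = transpose a b ((f ^^ n) a)" using same[of m] by simp
  then have "(?g ^^ n) a = b" using n by simp
  moreover have "?g x \<in> X" if "x \<in> X" for x
    using fX[OF that] assms(3,4) by (auto simp: transpose_def)
  ultimately show ?thesis using gen_equiv_funpow[OF assms(3), where f="?g" and n=n] by auto
qed

text \<open>Once \<open>a\<close> and \<open>b\<close> are identified, following \<open>f\<close> by
  their transposition makes no difference. The converse is the same statement for the product, the
  transposition being an involution.\<close>

lemma gen_equiv_insert_transpose:
  "(x, y) \<in> gen_equiv (insert (a, b) (graph_on X f)) \<Longrightarrow>
   (x, y) \<in> gen_equiv (insert (a, b) (graph_on X (transpose a b \<circ> f)))"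
proof (erule gen_equiv_least)
  let ?R = "insert (a, b) (graph_on X (transpose a b \<circ> f))"
  fix x y assume "(x, y) \<in> insert (a, b) (graph_on X f)"
  then consider "x = a" "y = b" | "x \<in> X" "y = f x" by (auto simp: graph_on_def)
  then show "(x, y) \<in> gen_equiv ?R"
  proof cases
    case 1 then show ?thesis by (auto intro: gen_equiv_base)
  next
    case 2
    then have 3: "(x, transpose a b y) \<in> gen_equiv ?R"
      by (auto simp: graph_on_def intro!: gen_equiv_base)
    have ab: "(a, b) \<in> gen_equiv ?R" by (auto intro: gen_equiv_base)
    have "(transpose a b y, y) \<in> gen_equiv ?R"
      using ab gen_equiv_sym[OF ab] by (auto simp: transpose_def)
    with 3 show ?thesis by (rule gen_equiv_trans)
  qed
qed

lemma num_classes_insert_transpose: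
  "num_classes X (insert (a, b) (graph_on X (transpose a b \<circ> f)))
   = num_classes X (insert (a, b) (graph_on X f))"
proof -
  have "transpose a b \<circ> (transpose a b \<circ> f) = f" by (auto simp: fun_eq_iff)
  then have "gen_equiv (insert (a, b) (graph_on X (transpose a b \<circ> f)))
      = gen_equiv (insert (a, b) (graph_on X f))"
    using gen_equiv_insert_transpose[of _ _ a b X f]
      gen_equiv_insert_transpose[of _ _ a b X "transpose a b \<circ> f"] by auto
  then show ?thesis by (simp add: num_classes_def)
qed

text \<open>Both permutations generate the same relation after \<open>(a, b)\<close> is added. For
  \<open>f\<close> the pair unites two classes; for the product it is redundant, as the cycles have
  already been joined.\<close>

lemma num_classes_transpose_merge:
  assumes "finite X" "bij_betw f X X" "a \<in> X" "b \<in> X" "(a, b) \<notin> gen_equiv (graph_on X f)"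
  shows "num_classes X (graph_on X f) = Suc (num_classes X (graph_on X (transpose a b \<circ> f)))"
  using num_classes_insert_new[OF assms(5,3,4,1)]
    num_classes_insert[OF transpose_joins[OF assms], of X]
  by (simp add: num_classes_insert_transpose)

text \<open>Both counts exceed that of the common relation with \<open>(a, b)\<close> added by at
  most one, and neither is below it.\<close>

lemma num_classes_transpose_le:
  assumes "finite X" "a \<in> X" "b \<in> X"
  shows "num_classes X (graph_on X (transpose a b \<circ> f)) \<le> Suc (num_classes X (graph_on X f))"
proof -
  have "num_classes X R \<le> Suc (num_classes X (insert (a, b) R)) \<and>
    num_classes X (insert (a, b) R) \<le> num_classes X R" for R
    using num_classes_insert[of a b R X] num_classes_insert_new[of a b R X] assms
    by (cases "(a, b) \<in> gen_equiv R") simp_all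
  from this[of "graph_on X (transpose a b \<circ> f)"] this[of "graph_on X f"]
  show ?thesis unfolding num_classes_insert_transpose by linarith
qed

section \<open>The state sum of the diagram of a marked graph\<close>

text \<open>Crossings, smoothings and components are computed from \<open>darts\<close>,
  \<open>rot\<close>, \<open>mate\<close> and \<open>over\<close>. This allows a smoothing to be
  identified with a graph diagram carrying a new mark up to \<open>region\<close>.\<close>

lemma kauffman_region_update:
  "kauffman D v \<Longrightarrow> kauffman (D\<lparr>region := r\<rparr>) v"
proof (induction arbitrary: r rule: kauffman.induct)
  case (circles D)
  have "crossings (D\<lparr>region := r\<rparr>) = {}"
    using circles by (simp add: crossings_def crossing_darts_def vertex_at_def)
  from kauffman.circles[OF this] show ?case
    by (simp add: components_def joined_def)
next
  case (skein x D a b)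
  have x: "x \<in> crossings (D\<lparr>region := r\<rparr>)"
    using skein.hyps by (simp add: crossings_def crossing_darts_def vertex_at_def)
  have smoothing: "smoothing (D\<lparr>region := r\<rparr>) x P =
      (smoothing D x P)\<lparr>region := region (smoothing (D\<lparr>region := r\<rparr>) x P)\<rparr>" for P
    by (simp add: smoothing_def cong: if_cong)
  have "over (D\<lparr>region := r\<rparr>) = over D" by simp
  then have "\<exists>r'. pos_smoothing (D\<lparr>region := r\<rparr>) x = (pos_smoothing D x)\<lparr>region := r'\<rparr>"
    "\<exists>r'. neg_smoothing (D\<lparr>region := r\<rparr>) x = (neg_smoothing D x)\<lparr>region := r'\<rparr>"
    unfolding pos_smoothing_def neg_smoothing_def using smoothing by metis+
  with x show ?case
    using skein.IH by (metis kauffman.skein)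
qed

text \<open>Inequality of truth values is exclusive or. A circle arriving at a half-edge runs along
  the band to the other end if the edge is merged, and stays at the same vertex if it is
  separated.\<close>

definition flip :: "'e set \<Rightarrow> 'e \<times> bool \<Rightarrow> 'e \<times> bool" where
  "flip S x = (fst x, snd x \<noteq> (fst x \<in> S))"

text \<open>The number of circles left after smoothing all crossings of the diagram of a graph with edge
  set \<open>E\<close>, merging the shaded regions exactly at the edges in \<open>S\<close>. Each circle passes corners of the
  graph, from \<open>x\<close> to \<open>nx x\<close>, except that a vertex without edges is a circle of its own.\<close>

definition loops :: "'v set \<Rightarrow> 'e set \<Rightarrow> ('e \<times> bool \<Rightarrow> 'v) \<Rightarrow> ('e \<times> bool \<Rightarrow> 'e \<times> bool) \<Rightarrow> 'e set \<Rightarrow> nat"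
  where "loops V E src nx S =
    num_classes (E \<times> UNIV) (graph_on (E \<times> UNIV) (flip S \<circ> nx)) + card (V - src ` (E \<times> UNIV))"

text \<open>\<open>b\<close> tells whether the state merges the shaded regions at the edge. A
  smoothed edge stays in the sum with the indicator of its smoothing, so that all diagrams of the
  skein recursion have the same set of states.\<close>

fun mark_weight :: "mark \<Rightarrow> bool \<Rightarrow> laurent" where
  "mark_weight Pos b = A_pow (if b then 1 else - 1)"
| "mark_weight Neg b = A_pow (if b then - 1 else 1)"
| "mark_weight Merged b = (if b then 1 else 0)"
| "mark_weight Separated b = (if b then 0 else 1)"

locale rotation_system =
  fixes V :: "'v set" and E :: "'e set" and src :: "'e \<times> bool \<Rightarrow> 'v"
    and nx :: "'e \<times> bool \<Rightarrow> 'e \<times> bool"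
  assumes finite_V: "finite V" and finite_E: "finite E"
    and nx: "bij_betw nx (E \<times> UNIV) (E \<times> UNIV)"
begin

definition marked :: "('e \<Rightarrow> mark) \<Rightarrow> ('v, 'e \<times> bool) marked_graph" where
  "marked \<mu> = \<lparr>verts = V, gdarts = E \<times> UNIV, org = src, rev = (\<lambda>(e, s). (e, \<not> s)), nxt = nx,
     mark = (\<lambda>(e, s). \<mu> e)\<rparr>"

abbreviation diag :: "('e \<Rightarrow> mark) \<Rightarrow> ((('e \<times> bool) \<times> bool) + ('v \<times> bool)) diagram" where
  "diag \<mu> \<equiv> graph_diagram (marked \<mu>)"

definition unsmoothed :: "('e \<Rightarrow> mark) \<Rightarrow> 'e set" where
  "unsmoothed \<mu> = {e \<in> E. \<mu> e = Pos \<or> \<mu> e = Neg}"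

definition cross :: "'e \<Rightarrow> ((('e \<times> bool) \<times> bool) + ('v \<times> bool)) set" where
  "cross e = {Inl ((e, s), b) | s b. True}"

definition state_sum :: "('e \<Rightarrow> mark) \<Rightarrow> laurent" where
  "state_sum \<mu> = (\<Sum>S\<in>Pow E. (\<Prod>e\<in>E. mark_weight (\<mu> e) (e \<in> S)) *
     loop_value ^ (loops V E src nx S - 1))"

lemma rot_diag [simp]:
  "rot (diag \<mu>) (Inl ((e, s), True)) =
     (if \<mu> e = Merged then Inl ((e, \<not> s), False) else Inl ((e, s), False))"
  "rot (diag \<mu>) (Inl ((e, s), False)) =
     (if \<mu> e = Separated then Inl ((e, s), True) else Inl ((e, \<not> s), True))"
  "rot (diag \<mu>) (Inr (v, s)) = Inr (v, \<not> s)"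
  by (auto simp: graph_diagram_def marked_def Let_def)

lemma mate_diag [simp]:
  "mate (diag \<mu>) (Inl (x, True)) = Inl (nx x, False)"
  "mate (diag \<mu>) (Inl (x, False)) = Inl (inv_into (E \<times> UNIV) nx x, True)"
  "mate (diag \<mu>) (Inr (v, s)) = Inr (v, \<not> s)"
  by (auto simp: graph_diagram_def marked_def Let_def)

lemma darts_diag:
  "darts (diag \<mu>) = Inl ` ((E \<times> UNIV) \<times> UNIV) \<union> Inr ` ((V - src ` (E \<times> UNIV)) \<times> UNIV)"
  by (simp add: graph_diagram_def marked_def Let_def)

lemma darts_diag_cases [consumes 1, case_names edge vertex]:
  assumes "h \<in> darts (diag \<mu>)"
  obtains e s b where "e \<in> E" "h = Inl ((e, s), b)"
    | v s where "v \<in> V - src ` (E \<times> UNIV)" "h = Inr (v, s)"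
  using assms unfolding darts_diag by auto

lemma over_diag: "over (diag \<mu>) =
    {Inl ((e, s), True) | e s. e \<in> E \<and> \<mu> e = Pos} \<union> {Inl ((e, s), False) | e s. e \<in> E \<and> \<mu> e = Neg}"
  by (auto simp: graph_diagram_def marked_def Let_def)

lemma vertex_at_diag:
  assumes "\<mu> e = Pos \<or> \<mu> e = Neg"
  shows "vertex_at (diag \<mu>) (Inl ((e, s), b)) = cross e"
proof -
  let ?r = "rot (diag \<mu>)"
  have "(?r ^^ 4) (Inl ((e, s), b)) = Inl ((e, s), b)"
    using assms by (cases b) (auto simp: eval_nat_numeral)
  then have "vertex_at (diag \<mu>) (Inl ((e, s), b)) = {(?r ^^ m) (Inl ((e, s), b)) | m. m < 4}"
    unfolding vertex_at_def by (rule orbit_altdef_bounded) simp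
  also have "\<dots> = (\<lambda>m. (?r ^^ m) (Inl ((e, s), b))) ` {..<4}" by auto
  also have "{..<4} = {0, 1, 2, 3 :: nat}" by auto
  also have "(\<lambda>m. (?r ^^ m) (Inl ((e, s), b))) ` {0, 1, 2, 3} = cross e"
    using assms unfolding cross_def by (cases b; cases s) (auto simp: eval_nat_numeral)
  finally show ?thesis .
qed

text \<open>At smoothed edges and isolated vertices \<open>rot\<close> is an involution, so at most
  two darts meet.\<close>

lemma card_vertex_at_diag:
  assumes "\<And>e s b. h = Inl ((e, s), b) \<Longrightarrow> \<mu> e \<noteq> Pos \<and> \<mu> e \<noteq> Neg"
  shows "card (vertex_at (diag \<mu>) h) \<noteq> 4"
proof -
  let ?r = "rot (diag \<mu>)"
  have "(?r ^^ 2) h = h"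
  proof (cases h)
    case (Inl y)
    obtain e s b where y: "y = ((e, s), b)" by (metis surj_pair)
    have "h = Inl ((e, s), b)" using Inl y by simp
    then show ?thesis using assms
      by (cases "\<mu> e"; cases b) (auto simp: eval_nat_numeral)
  next
    case (Inr y) then show ?thesis by (cases y) (simp add: eval_nat_numeral)
  qed
  then have "vertex_at (diag \<mu>) h = {(?r ^^ m) h | m. m < 2}"
    unfolding vertex_at_def by (rule orbit_altdef_bounded) simp
  also have "\<dots> = (\<lambda>m. (?r ^^ m) h) ` {..<2}" by auto
  finally have "card (vertex_at (diag \<mu>) h) \<le> 2"
    using card_image_le[of "{..<2::nat}"] by (metis card_lessThan finite_lessThan)
  then show ?thesis by simp
qed

lemma card_cross: "card (cross e) = 4"
proof -
  have "cross e = {Inl ((e, False), False), Inl ((e, False), True), Inl ((e, True), False), Inl ((e, True), True)}"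
    unfolding cross_def by auto
  then show ?thesis by simp
qed

lemma mem_cross: "h \<in> cross e \<longleftrightarrow> (\<exists>s b. h = Inl ((e, s), b))"
  by (auto simp: cross_def)

lemma crossings_diag: "crossings (diag \<mu>) = cross ` unsmoothed \<mu>"
proof -
  have "crossing_darts (diag \<mu>) = (\<Union>e\<in>unsmoothed \<mu>. cross e)"
  proof (intro equalityI subsetI)
    fix h assume "h \<in> crossing_darts (diag \<mu>)"
    then have h: "h \<in> darts (diag \<mu>)" "card (vertex_at (diag \<mu>) h) = 4"
      by (auto simp: crossing_darts_def)
    then obtain e s b where "h = Inl ((e, s), b)" "\<mu> e = Pos \<or> \<mu> e = Neg"
      using card_vertex_at_diag[of h \<mu>] by metis
    with h show "h \<in> (\<Union>e\<in>unsmoothed \<mu>. cross e)"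
      by (auto simp: unsmoothed_def darts_diag mem_cross)
  next
    fix h assume "h \<in> (\<Union>e\<in>unsmoothed \<mu>. cross e)"
    then obtain e s b where "h = Inl ((e, s), b)" "e \<in> E" "\<mu> e = Pos \<or> \<mu> e = Neg"
      by (auto simp: unsmoothed_def mem_cross)
    then show "h \<in> crossing_darts (diag \<mu>)"
      by (auto simp: crossing_darts_def darts_diag vertex_at_diag card_cross)
  qed
  then have "crossings (diag \<mu>) = (\<Union>e\<in>unsmoothed \<mu>. vertex_at (diag \<mu>) ` cross e)"
    unfolding crossings_def by blast
  also have "\<dots> = (\<Union>e\<in>unsmoothed \<mu>. {cross e})"
  proof (intro SUP_cong refl)
    fix e assume "e \<in> unsmoothed \<mu>"
    then have "vertex_at (diag \<mu>) h = cross e" if "h \<in> cross e" for h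
      using that by (auto simp: unsmoothed_def mem_cross vertex_at_diag)
    moreover have "cross e \<noteq> {}" by (auto simp: cross_def)
    ultimately show "vertex_at (diag \<mu>) ` cross e = {cross e}" by auto
  qed
  finally show ?thesis by auto
qed

text \<open>At the darts of the crossing in \<open>P\<close>, smoothing replaces \<open>rot\<close>
  by its inverse, written as a third power. On flag \<open>True\<close> this is the rotation of a
  \<open>Merged\<close> edge, on flag \<open>False\<close> that of a \<open>Separated\<close>
  one.\<close>

lemma smoothing_diag:
  assumes "e \<in> E" "\<mu> e = Pos \<or> \<mu> e = Neg" "\<nu> = Merged \<or> \<nu> = Separated"
    and P: "\<And>s b. Inl ((e, s), b) \<in> P \<longleftrightarrow> b = (\<nu> = Merged)"
  shows "\<exists>r. smoothing (diag \<mu>) (cross e) P = (diag (\<mu>(e := \<nu>)))\<lparr>region := r\<rparr>"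
proof -
  let ?D = "diag \<mu>" and ?D' = "diag (\<mu>(e := \<nu>))"
  have "(if h \<in> cross e \<inter> P then rot ?D (rot ?D (rot ?D h)) else rot ?D h) = rot ?D' h" for h
  proof (cases h)
    case (Inl y)
    obtain f s b where y: "y = ((f, s), b)" by (metis surj_pair)
    have h: "h = Inl ((f, s), b)" using Inl y by simp
    show ?thesis
    proof (cases "f = e")
      case True
      have "h \<in> cross e" "h \<in> P \<longleftrightarrow> b = (\<nu> = Merged)" by (simp_all add: h True mem_cross P)
      then show ?thesis using assms(2,3) unfolding h True
        by (cases b; cases "\<mu> e"; cases \<nu>) simp_all
    next
      case False
      then have "h \<notin> cross e" by (simp add: h mem_cross)
      then show ?thesis using False unfolding h by (cases b) simp_all
    qed
  next
    case (Inr y) then show ?thesis by (cases y) (simp add: mem_cross)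
  qed
  moreover have "over ?D - cross e = over ?D'"
    using assms(3) by (auto simp: over_diag mem_cross)
  moreover have "darts ?D = darts ?D'" by (simp add: darts_diag)
  moreover have "mate ?D = mate ?D'" by (simp add: graph_diagram_def marked_def Let_def)
  ultimately have "smoothing ?D (cross e) P = ?D'\<lparr>region := region (smoothing ?D (cross e) P)\<rparr>"
    by (intro diagram.equality) (simp_all add: smoothing_def fun_eq_iff)
  then show ?thesis ..
qed

lemma pos_neg_smoothing_diag:
  assumes "e \<in> E"
  shows "\<mu> e = Pos \<Longrightarrow> \<exists>r. pos_smoothing (diag \<mu>) (cross e) = (diag (\<mu>(e := Merged)))\<lparr>region := r\<rparr>"
    "\<mu> e = Pos \<Longrightarrow> \<exists>r. neg_smoothing (diag \<mu>) (cross e) = (diag (\<mu>(e := Separated)))\<lparr>region := r\<rparr>"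
    "\<mu> e = Neg \<Longrightarrow> \<exists>r. pos_smoothing (diag \<mu>) (cross e) = (diag (\<mu>(e := Separated)))\<lparr>region := r\<rparr>"
    "\<mu> e = Neg \<Longrightarrow> \<exists>r. neg_smoothing (diag \<mu>) (cross e) = (diag (\<mu>(e := Merged)))\<lparr>region := r\<rparr>"
  unfolding pos_smoothing_def neg_smoothing_def
  by (rule smoothing_diag; use assms in \<open>auto simp: over_diag mem_cross\<close>)+

text \<open>Away from isolated vertices a component alternates between \<open>rot\<close>, which
  pairs \<open>(x, False)\<close> with \<open>(flip S x, True)\<close>, and \<open>mate\<close>,
  which pairs \<open>(x, True)\<close> with \<open>(nx x, False)\<close>. The double step between
  darts with flag \<open>True\<close> is \<open>flip S \<circ> nx\<close>.\<close>

lemma card_components_diag: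
  assumes "unsmoothed \<mu> = {}"
  shows "card (components (diag \<mu>)) = loops V E src nx {e \<in> E. \<mu> e = Merged}"
proof -
  let ?D = "diag \<mu>" and ?S = "{e \<in> E. \<mu> e = Merged}" and ?I = "V - src ` (E \<times> UNIV)"
  let ?X = "E \<times> (UNIV :: bool set)"
  let ?g = "graph_on ?X (flip ?S \<circ> nx)"
  let ?R = "map_prod Inl Inl ` ?g :: ((('e \<times> bool) + 'v) \<times> (('e \<times> bool) + 'v)) set"
  let ?J = "{(h, rot ?D h) | h. h \<in> darts ?D} \<union> {(h, mate ?D h) | h. h \<in> darts ?D}"
  have \<mu>: "\<mu> e = Merged \<or> \<mu> e = Separated" if "e \<in> E" for e
    using assms that by (cases "\<mu> e") (auto simp: unsmoothed_def)
  have nxt_in: "nx x \<in> ?X" if "x \<in> ?X" for x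
    using that nx by (metis bij_betw_apply)
  have inv_in: "inv_into ?X nx x \<in> ?X" and nxt_inv: "nx (inv_into ?X nx x) = x" if "x \<in> ?X" for x
    using that nx by (metis bij_betw_def inv_into_into, metis bij_betw_inv_into_right)
  have inv_nxt: "inv_into ?X nx (nx x) = x" if "x \<in> ?X" for x
    using that nx by (metis bij_betw_inv_into_left)
  define f :: "(('e \<times> bool) \<times> bool) + ('v \<times> bool) \<Rightarrow> ('e \<times> bool) + 'v"
    where "f = (\<lambda>h. case h of Inl (x, b) \<Rightarrow> Inl (if b then x else flip ?S x) | Inr (v, s) \<Rightarrow> Inr v)"
  define g :: "('e \<times> bool) + 'v \<Rightarrow> (('e \<times> bool) \<times> bool) + ('v \<times> bool)"
    where "g = (\<lambda>h. case h of Inl x \<Rightarrow> Inl (x, True) | Inr v \<Rightarrow> Inr (v, True))"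
  have dartI: "Inl (x, b) \<in> darts ?D" if "x \<in> ?X" for x b
    using that by (simp add: darts_diag image_iff)
  have rot_in: "rot ?D h \<in> darts ?D" and rot_rot: "rot ?D (rot ?D h) = h"
    if "h \<in> darts ?D" for h
  proof -
    have "rot ?D h \<in> darts ?D \<and> rot ?D (rot ?D h) = h" using that
    proof (cases rule: darts_diag_cases)
      case (edge e s b)
      then show ?thesis using \<mu>[of e] dartI by (cases b; cases "\<mu> e") simp_all
    next
      case (vertex v s) then show ?thesis using that by (simp add: darts_diag image_iff)
    qed
    then show "rot ?D h \<in> darts ?D" "rot ?D (rot ?D h) = h" by auto
  qed
  have mate_in: "mate ?D h \<in> darts ?D" and mate_mate: "mate ?D (mate ?D h) = h"
    if "h \<in> darts ?D" for h
  proof -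
    have "mate ?D h \<in> darts ?D \<and> mate ?D (mate ?D h) = h" using that
    proof (cases rule: darts_diag_cases)
      case (edge e s b)
      then have "(e, s) \<in> ?X" by simp
      then show ?thesis unfolding edge(2)
        using dartI nxt_in inv_in inv_nxt nxt_inv by (cases b) (simp_all del: mem_Sigma_iff)
    next
      case (vertex v s) then show ?thesis using that by (simp add: darts_diag image_iff)
    qed
    then show "mate ?D h \<in> darts ?D" "mate ?D (mate ?D h) = h" by auto
  qed
  have J_sub: "?J \<subseteq> darts ?D \<times> darts ?D" using rot_in mate_in by auto
  \<comment> \<open>Without crossings \<open>rot\<close> is an involution like \<open>mate\<close>,
    so the directed closure in \<open>joined\<close> is already an equivalence.\<close>
  have "?J\<inverse> \<subseteq> ?J" using rot_in mate_in rot_rot mate_mate by force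
  then have "?J \<union> ?J\<inverse> = ?J" by blast
  then have J: "gen_equiv ?J = ?J\<^sup>*" by (simp add: gen_equiv_def)
  have quot: "joined ?D `` {h} = gen_equiv ?J `` {h}" if "h \<in> darts ?D" for h
    using that gen_equiv_closed[OF _ J_sub, of h] unfolding joined_def J by blast
  have "darts ?D // joined ?D = darts ?D // gen_equiv ?J"
    unfolding quotient_def using quot by (intro SUP_cong refl) simp
  then have "card (components ?D) = num_classes (darts ?D) ?J"
    by (simp add: components_def num_classes_def)
  also have "\<dots> = num_classes (?X <+> ?I) ?R"
  proof (rule num_classes_eqI[where f=f and g=g])
    show "f h \<in> ?X <+> ?I" if "h \<in> darts ?D" for h
      using that by (auto simp: darts_diag f_def flip_def)
    show "g h \<in> darts ?D" if "h \<in> ?X <+> ?I" for h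
      using that by (auto simp: darts_diag g_def)
    have R: "(Inl x, Inl (flip ?S (nx x))) \<in> gen_equiv ?R" if "x \<in> ?X" for x
      by (rule gen_equiv_base) (use that in \<open>auto simp: graph_on_def\<close>)
    have rot_step: "f (rot ?D h) = f h" if "h \<in> darts ?D" for h
      using that
    proof (cases rule: darts_diag_cases)
      case (edge e s b)
      then show ?thesis using \<mu>[of e] by (cases b; cases "\<mu> e") (auto simp: f_def flip_def)
    qed (simp add: f_def)
    have mate_step: "(f h, f (mate ?D h)) \<in> gen_equiv ?R" if h: "h \<in> darts ?D" for h
    proof -
      consider x where "x \<in> ?X" "h = Inl (x, True)" | x where "x \<in> ?X" "h = Inl (x, False)"
        | v s where "h = Inr (v, s)"
        using h by (cases rule: darts_diag_cases; cases "snd (projl h)"; cases "snd (projr h)") auto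
      then show ?thesis
      proof cases
        case 1 then show ?thesis using R by (simp add: f_def)
      next
        case 2 then show ?thesis
          using gen_equiv_sym[OF R[OF inv_in[OF 2(1)]]] nxt_inv by (simp add: f_def)
      next
        case 3 then show ?thesis by (simp add: f_def)
      qed
    qed
    show "(f h, f h') \<in> gen_equiv ?R" if "(h, h') \<in> ?J" for h h'
      using that rot_step mate_step by auto
    have J_rot: "(h, rot ?D h) \<in> gen_equiv ?J" and J_mate: "(h, mate ?D h) \<in> gen_equiv ?J"
      if "h \<in> darts ?D" for h
      using that by (auto intro!: gen_equiv_base)
    have J_flip: "(Inl (x, False), Inl (flip ?S x, True)) \<in> gen_equiv ?J" if x: "x \<in> ?X" for x
    proof -
      have "rot ?D (Inl (x, False)) = Inl (flip ?S x, True)"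
        using x \<mu>[of "fst x"] by (cases x) (auto simp: flip_def)
      with J_rot[OF dartI[OF x, of False]] show ?thesis by (simp only:)
    qed
    show "(g h, g h') \<in> gen_equiv ?J" if hh: "(h, h') \<in> ?R" for h h'
    proof -
      obtain x where x: "x \<in> ?X" "h = Inl x" "h' = Inl (flip ?S (nx x))"
        using hh unfolding graph_on_def comp_def by blast
      have "Inl (x, True) \<in> darts ?D" by (rule dartI[OF x(1)])
      from J_mate[OF this] J_flip[OF nxt_in[OF x(1)]] show ?thesis
        using x by (auto simp: g_def intro: gen_equiv_trans)
    qed
    show "(h, g (f h)) \<in> gen_equiv ?J" if h: "h \<in> darts ?D" for h
    proof -
      consider x where "x \<in> ?X" "h = Inl (x, True)" | x where "x \<in> ?X" "h = Inl (x, False)"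
        | v where "h = Inr (v, True)" | v where "h = Inr (v, False)"
        using h by (cases rule: darts_diag_cases; cases "snd (projl h)"; cases "snd (projr h)") auto
      then show ?thesis
      proof cases
        case 4 then show ?thesis using J_rot[OF h] by (simp add: f_def g_def)
      qed (use J_flip in \<open>auto simp: f_def g_def\<close>)
    qed
    show "(h, f (g h)) \<in> gen_equiv ?R" if "h \<in> ?X <+> ?I" for h
      using that by (auto simp: f_def g_def)
  qed
  also have "\<dots> = loops V E src nx ?S"
    unfolding loops_def by (rule num_classes_Plus) (use finite_E finite_V in auto)
  finally show ?thesis .
qed

text \<open>The factor at \<open>e\<close> satisfies the skein relation as a function of the mark,
  and neither the other factors nor the number of circles involve this mark.\<close>

lemma state_sum_skein:
  assumes "e \<in> E"
  shows "\<mu> e = Pos \<Longrightarrow> state_sum \<mu> =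
      A_pow 1 * state_sum (\<mu>(e := Merged)) + A_pow (- 1) * state_sum (\<mu>(e := Separated))"
    and "\<mu> e = Neg \<Longrightarrow> state_sum \<mu> =
      A_pow 1 * state_sum (\<mu>(e := Separated)) + A_pow (- 1) * state_sum (\<mu>(e := Merged))"
proof -
  let ?w = "\<lambda>\<mu> S. \<Prod>e\<in>E. mark_weight (\<mu> e) (e \<in> S)"
  have split: "?w \<mu>' S = mark_weight (\<mu>' e) (e \<in> S) * (\<Prod>e\<in>E - {e}. mark_weight (\<mu>' e) (e \<in> S))"
    for \<mu>' S
    using assms finite_E by (simp add: prod.remove)
  have rest: "(\<Prod>f\<in>E - {e}. mark_weight ((\<mu>(e := \<nu>)) f) (f \<in> S)) = (\<Prod>f\<in>E - {e}. mark_weight (\<mu> f) (f \<in> S))"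
    for \<nu> S by (rule prod.cong) auto
  have lin: "?w \<mu> S = a * ?w (\<mu>(e := \<nu>)) S + b * ?w (\<mu>(e := \<nu>')) S"
    if "mark_weight (\<mu> e) (e \<in> S) = a * mark_weight \<nu> (e \<in> S) + b * mark_weight \<nu>' (e \<in> S)" for a b \<nu> \<nu>' S
    unfolding split[of \<mu>] split[of "\<mu>(e := _)"] rest that by (simp add: algebra_simps)
  have "state_sum \<mu> = a * state_sum (\<mu>(e := \<nu>)) + b * state_sum (\<mu>(e := \<nu>'))"
    if "\<And>S. mark_weight (\<mu> e) (e \<in> S) = a * mark_weight \<nu> (e \<in> S) + b * mark_weight \<nu>' (e \<in> S)" for a b \<nu> \<nu>'
    unfolding state_sum_def lin[OF that] by (simp add: sum_distrib_left sum.distrib distrib_right mult.assoc)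
  then show "\<mu> e = Pos \<Longrightarrow> state_sum \<mu> =
      A_pow 1 * state_sum (\<mu>(e := Merged)) + A_pow (- 1) * state_sum (\<mu>(e := Separated))"
    and "\<mu> e = Neg \<Longrightarrow> state_sum \<mu> =
      A_pow 1 * state_sum (\<mu>(e := Separated)) + A_pow (- 1) * state_sum (\<mu>(e := Merged))"
    by auto
qed

text \<open>All weights are indicators, so exactly one state survives.\<close>

lemma state_sum_smoothed:
  assumes "unsmoothed \<mu> = {}"
  shows "state_sum \<mu> = loop_value ^ (loops V E src nx {e \<in> E. \<mu> e = Merged} - 1)"
proof -
  let ?S = "{e \<in> E. \<mu> e = Merged}"
  have \<mu>: "\<mu> e = Merged \<or> \<mu> e = Separated" if "e \<in> E" for e
    using assms that by (cases "\<mu> e") (auto simp: unsmoothed_def)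
  have "(\<Prod>e\<in>E. mark_weight (\<mu> e) (e \<in> S)) = (if S = ?S then 1 else 0)" if SE: "S \<in> Pow E" for S
  proof (cases "S = ?S")
    case True
    then have "mark_weight (\<mu> e) (e \<in> S) = 1" if "e \<in> E" for e
      using \<mu>[OF that] that by auto
    then show ?thesis using True by (simp add: prod.neutral)
  next
    case False
    then obtain e where "e \<in> E" "e \<in> S \<longleftrightarrow> \<mu> e \<noteq> Merged" using SE by blast
    then have "mark_weight (\<mu> e) (e \<in> S) = 0" using \<mu>[of e] by auto
    then show ?thesis using False \<open>e \<in> E\<close> finite_E by auto
  qed
  then have "state_sum \<mu> = (\<Sum>S\<in>Pow E. if S = ?S then loop_value ^ (loops V E src nx S - 1) else 0)"
    unfolding state_sum_def by (intro sum.cong refl) simp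
  also have "\<dots> = loop_value ^ (loops V E src nx ?S - 1)"
    using finite_E by (subst sum.delta) auto
  finally show ?thesis .
qed

text \<open>The definite description in \<open>bracket\<close> needs both directions: some order of
  smoothing reaches the state sum, and every order yields this value.\<close>

theorem kauffman_diag: "kauffman (diag \<mu>) v \<longleftrightarrow> v = state_sum \<mu>"
proof (induction "card (unsmoothed \<mu>)" arbitrary: \<mu> v rule: less_induct)
  case less
  have region: "kauffman ((diag \<mu>')\<lparr>region := r\<rparr>) w \<longleftrightarrow> w = state_sum \<mu>'"
    if "card (unsmoothed \<mu>') < card (unsmoothed \<mu>)" for \<mu>' r w
  proof -
    have "kauffman ((diag \<mu>')\<lparr>region := r\<rparr>) w \<Longrightarrow> kauffman (diag \<mu>') w"
      using kauffman_region_update[of "(diag \<mu>')\<lparr>region := r\<rparr>" w "region (diag \<mu>')"] by simp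
    then show ?thesis using less[OF that] kauffman_region_update by metis
  qed
  have smaller: "card (unsmoothed (\<mu>(e := \<nu>))) < card (unsmoothed \<mu>)"
    if "e \<in> unsmoothed \<mu>" "\<nu> = Merged \<or> \<nu> = Separated" for e \<nu>
  proof (rule psubset_card_mono)
    show "finite (unsmoothed \<mu>)" using finite_E by (simp add: unsmoothed_def)
    show "unsmoothed (\<mu>(e := \<nu>)) \<subset> unsmoothed \<mu>"
      using that by (auto simp: unsmoothed_def split: if_splits)
  qed
  have smoothings: "\<exists>a b. A_pow 1 * a + A_pow (- 1) * b = state_sum \<mu> \<and>
      (\<forall>w. kauffman (pos_smoothing (diag \<mu>) (cross e)) w \<longleftrightarrow> w = a) \<and>
      (\<forall>w. kauffman (neg_smoothing (diag \<mu>) (cross e)) w \<longleftrightarrow> w = b)" if "e \<in> unsmoothed \<mu>" for e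
  proof -
    have "e \<in> E" using that by (simp add: unsmoothed_def)
    from that consider "\<mu> e = Pos" | "\<mu> e = Neg" by (auto simp: unsmoothed_def)
    then show ?thesis
    proof cases
      case 1
      then obtain r r' where "pos_smoothing (diag \<mu>) (cross e) = (diag (\<mu>(e := Merged)))\<lparr>region := r\<rparr>"
        "neg_smoothing (diag \<mu>) (cross e) = (diag (\<mu>(e := Separated)))\<lparr>region := r'\<rparr>"
        using pos_neg_smoothing_diag[OF \<open>e \<in> E\<close>] by meson
      then show ?thesis
        using region smaller[OF that] state_sum_skein(1)[of e \<mu>, OF \<open>e \<in> E\<close> 1] by auto
    next
      case 2
      then obtain r r' where "pos_smoothing (diag \<mu>) (cross e) = (diag (\<mu>(e := Separated)))\<lparr>region := r\<rparr>"
        "neg_smoothing (diag \<mu>) (cross e) = (diag (\<mu>(e := Merged)))\<lparr>region := r'\<rparr>"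
        using pos_neg_smoothing_diag[OF \<open>e \<in> E\<close>] by meson
      then show ?thesis
        using region smaller[OF that] state_sum_skein(2)[of e \<mu>, OF \<open>e \<in> E\<close> 2] by auto
    qed
  qed
  show ?case
  proof (cases "unsmoothed \<mu> = {}")
    case True
    then have "crossings (diag \<mu>) = {}" by (simp add: crossings_diag)
    then have "kauffman (diag \<mu>) v \<longleftrightarrow> v = loop_value ^ (card (components (diag \<mu>)) - 1)"
      using kauffman.circles[of "diag \<mu>"] by (auto elim: kauffman.cases simp del: One_nat_def)
    then show ?thesis using True by (simp add: card_components_diag state_sum_smoothed)
  next
    case False
    then have ne: "crossings (diag \<mu>) \<noteq> {}" by (simp add: crossings_diag)
    show ?thesis
    proof
      assume "kauffman (diag \<mu>) v"
      then show "v = state_sum \<mu>"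
      proof cases
        case circles then show ?thesis using ne by simp
      next
        case (skein x a b)
        then obtain e where e: "e \<in> unsmoothed \<mu>" "x = cross e" by (auto simp: crossings_diag)
        then show ?thesis using smoothings[OF e(1)] skein by metis
      qed
    next
      assume v: "v = state_sum \<mu>"
      from False obtain e where e: "e \<in> unsmoothed \<mu>" by blast
      then have "cross e \<in> crossings (diag \<mu>)" by (simp add: crossings_diag)
      then show "kauffman (diag \<mu>) v" using smoothings[OF e] v kauffman.skein by metis
    qed
  qed
qed

corollary bracket_diag: "bracket (diag \<mu>) = state_sum \<mu>"
  unfolding bracket_def by (rule the_equality) (simp_all add: kauffman_diag)

end

section \<open>Circles in chains and sheafs\<close>

locale blown_up =
  fixes k :: nat and G :: "('v, nat \<times> bool) plane_graph" and col :: "nat \<Rightarrow> color"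
    and t :: "nat \<Rightarrow> int"
  assumes ordered: "ordered_plane_graph k G"
begin

abbreviation "X \<equiv> {..<k} \<times> (UNIV :: bool set)"

definition m :: "nat \<Rightarrow> nat" where
  "m i = (if t i = 0 then 1 else nat \<bar>t i\<bar>)"

lemma m_pos: "0 < m i"
  by (simp add: m_def)

definition edges :: "(nat \<times> nat) set" where
  "edges = Sigma {..<k} (\<lambda>i. {..<m i})"

lemma mem_edges [simp]: "(i, j) \<in> edges \<longleftrightarrow> i < k \<and> j < m i"
  by (auto simp: edges_def)

lemma finite_edges: "finite edges"
  by (simp add: edges_def)

abbreviation "X' \<equiv> edges \<times> (UNIV :: bool set)"

text \<open>Chains and sheafs are dual to each other. The names below are chosen so that the circles follow
  the same rules for both: along the sides \<open>L\<close> and \<open>R\<close> they run on past ordinary edges and turn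
  from one side to the other at special edges, that is, at edges separated in a chain or merged in
  a sheaf. The set of special edges is \<open>Z\<close> below.\<close>

definition L :: "nat \<Rightarrow> nat \<Rightarrow> (nat \<times> nat) \<times> bool" where
  "L i j = ((i, j), col i = Sheaf)"

definition R :: "nat \<Rightarrow> nat \<Rightarrow> (nat \<times> nat) \<times> bool" where
  "R i j = ((i, j), col i = Chain)"

lemma LR_cases:
  assumes "x \<in> X'"
  obtains i j where "i < k" "j < m i" "x = L i j" | i j where "i < k" "j < m i" "x = R i j"
proof -
  obtain i j s where x: "x = ((i, j), s)" by (metis surj_pair)
  then have ij: "i < k" "j < m i" using assms by auto
  consider "s \<longleftrightarrow> col i = Sheaf" | "s \<longleftrightarrow> col i = Chain" by (cases "col i"; cases s) auto
  then show thesis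
  proof cases
    case 1 then show ?thesis using that(1)[OF ij] x by (simp add: L_def)
  next
    case 2 then show ?thesis using that(2)[OF ij] x by (simp add: R_def)
  qed
qed

lemma L_in [simp]: "L i j \<in> X' \<longleftrightarrow> i < k \<and> j < m i"
  and R_in [simp]: "R i j \<in> X' \<longleftrightarrow> i < k \<and> j < m i"
  by (simp_all add: L_def R_def)

text \<open>\<open>\<alpha> i\<close> is the end of edge \<open>i\<close> at which side
  \<open>L\<close> leaves the chain or sheaf, past index 0; at \<open>\<beta> i\<close> side
  \<open>R\<close> leaves it past the last index.\<close>

definition \<alpha> :: "nat \<Rightarrow> nat \<times> bool" where "\<alpha> i = (i, col i = Sheaf)"
definition \<beta> :: "nat \<Rightarrow> nat \<times> bool" where "\<beta> i = (i, col i = Chain)"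

lemma \<alpha>\<beta>_cases:
  assumes "d \<in> X"
  obtains i where "i < k" "d = \<alpha> i" | i where "i < k" "d = \<beta> i"
proof -
  obtain i s where d: "d = (i, s)" by (metis surj_pair)
  then have i: "i < k" using assms by auto
  consider "s \<longleftrightarrow> col i = Sheaf" | "s \<longleftrightarrow> col i = Chain" by (cases "col i"; cases s) auto
  then show thesis
  proof cases
    case 1 then show ?thesis using that(1)[OF i] d by (simp add: \<alpha>_def)
  next
    case 2 then show ?thesis using that(2)[OF i] d by (simp add: \<beta>_def)
  qed
qed

lemma \<alpha>\<beta>_in [simp]: "\<alpha> i \<in> X \<longleftrightarrow> i < k" "\<beta> i \<in> X \<longleftrightarrow> i < k"
  by (simp_all add: \<alpha>_def \<beta>_def)

text \<open>\<open>entry d\<close> and \<open>outer d\<close> are the first and the last dart,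
  counterclockwise, of the chain or sheaf at the end \<open>d\<close>. For a chain they
  coincide.\<close>

definition entry :: "nat \<times> bool \<Rightarrow> (nat \<times> nat) \<times> bool" where
  "entry d = (case d of (i, s) \<Rightarrow> if s then ((i, m i - 1), True) else ((i, 0), False))"

definition outer :: "nat \<times> bool \<Rightarrow> (nat \<times> nat) \<times> bool" where
  "outer d = (case d of (i, s) \<Rightarrow> if s = (col i = Sheaf) then L i 0 else R i (m i - 1))"

lemma outer_\<alpha>: "outer (\<alpha> i) = L i 0"
  and outer_\<beta>: "outer (\<beta> i) = R i (m i - 1)"
  by (cases "col i"; simp add: outer_def \<alpha>_def \<beta>_def)+

abbreviation "nx' \<equiv> nxt (blow_up k G col t)"
abbreviation "src' \<equiv> org (blow_up k G col t)"
abbreviation "V' \<equiv> verts (blow_up k G col t)"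

lemma nx'_L: "nx' (L i j) = (if j = 0 then entry (nxt G (\<alpha> i))
    else if col i = Chain then R i (j - 1) else L i (j - 1))"
  by (cases "col i") (auto simp: blow_up_def Let_def L_def R_def \<alpha>_def entry_def m_def split: prod.splits)

lemma nx'_R: "nx' (R i j) = (if j = m i - 1 then entry (nxt G (\<beta> i))
    else if col i = Chain then L i (Suc j) else R i (Suc j))"
  by (cases "col i") (auto simp: blow_up_def Let_def L_def R_def \<beta>_def entry_def m_def split: prod.splits)

lemma nx'_outer:
  assumes "d \<in> X"
  shows "nx' (outer d) = entry (nxt G d)"
  using assms by (cases rule: \<alpha>\<beta>_cases) (simp_all add: outer_\<alpha> outer_\<beta> nx'_L nx'_R)

lemma outer_in: "d \<in> X \<Longrightarrow> outer d \<in> X'"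
  by (erule \<alpha>\<beta>_cases) (simp_all add: outer_\<alpha> outer_\<beta> m_pos)

lemma entry_in: "d \<in> X \<Longrightarrow> entry d \<in> X'"
  by (auto simp: entry_def m_pos split: prod.splits)

lemma nxt_G: "bij_betw (nxt G) X X"
  using ordered unfolding ordered_plane_graph_def connected_plane_graph_def by metis

lemma nxt_in: "d \<in> X \<Longrightarrow> nxt G d \<in> X"
  using nxt_G by (metis bij_betw_apply)

lemma nx'_in:
  assumes "x \<in> X'"
  shows "nx' x \<in> X'"
  using assms
proof (cases rule: LR_cases)
  case (1 i j)
  then show ?thesis using entry_in[OF nxt_in[of "\<alpha> i"]] by (auto simp: nx'_L)
next
  case (2 i j)
  then show ?thesis using entry_in[OF nxt_in[of "\<beta> i"]] by (auto simp: nx'_R)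
qed

text \<open>Every dart has an explicit predecessor: its neighbor in the sheaf, the other dart at an
  interior vertex of the chain, or, for an \<open>entry\<close>, the \<open>outer\<close> dart of
  the preceding edge of \<open>G\<close>. Bijectivity follows by finiteness.\<close>

lemma nx'_surj:
  assumes "y \<in> X'"
  shows "y \<in> nx' ` X'"
proof -
  have entry: "entry d \<in> nx' ` X'" if "d \<in> X" for d
  proof -
    from that nxt_G obtain d' where "d' \<in> X" "d = nxt G d'" by (metis bij_betw_def imageE)
    then show ?thesis using nx'_outer outer_in by (metis imageI)
  qed
  have inner: "y \<in> nx' ` X'" if "x \<in> X'" "nx' x = y" for x using that by blast
  obtain i j s where y: "y = ((i, j), s)" by (metis surj_pair)
  then have ij: "i < k" "j < m i" using assms by auto
  show ?thesis
  proof (cases "col i"; cases s)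
    assume c: "col i = Chain" and s: "s"
    then have yy: "y = R i j" by (simp add: y R_def)
    show ?thesis
    proof (cases "j = m i - 1")
      case True then show ?thesis using entry[of "(i, True)"] ij s by (simp add: entry_def y)
    next
      case False
      have "nx' (L i (Suc j)) = y" using c yy by (simp add: nx'_L)
      then show ?thesis using inner[of "L i (Suc j)"] ij False by simp
    qed
  next
    assume c: "col i = Chain" and s: "\<not> s"
    then have yy: "y = L i j" by (simp add: y L_def)
    show ?thesis
    proof (cases j)
      case 0 then show ?thesis using entry[of "(i, False)"] ij s by (simp add: entry_def y)
    next
      case (Suc j')
      then have "nx' (R i j') = y" using ij c yy by (auto simp: nx'_R)
      then show ?thesis using inner[of "R i j'"] ij Suc by simp
    qed
  next
    assume c: "col i = Sheaf" and s: "s"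
    then have yy: "y = L i j" by (simp add: y L_def)
    show ?thesis
    proof (cases "j = m i - 1")
      case True then show ?thesis using entry[of "(i, True)"] ij s by (simp add: entry_def y)
    next
      case False
      have "nx' (L i (Suc j)) = y" using c yy by (simp add: nx'_L)
      then show ?thesis using inner[of "L i (Suc j)"] ij False by simp
    qed
  next
    assume c: "col i = Sheaf" and s: "\<not> s"
    then have yy: "y = R i j" by (simp add: y R_def)
    show ?thesis
    proof (cases j)
      case 0 then show ?thesis using entry[of "(i, False)"] ij s by (simp add: entry_def y)
    next
      case (Suc j')
      then have "nx' (R i j') = y" using ij c yy by (auto simp: nx'_R)
      then show ?thesis using inner[of "R i j'"] ij Suc by simp
    qed
  qed
qed

lemma bij_nx': "bij_betw nx' X' X'"
proof -
  have "nx' ` X' = X'" using nx'_in nx'_surj by blast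
  moreover from this have "inj_on nx' X'"
    using finite_edges by (intro eq_card_imp_inj_on) auto
  ultimately show ?thesis by (simp add: bij_betw_def)
qed

text \<open>Each edge of \<open>G\<close> is replaced by at least one edge, also for
  \<open>t i = 0\<close>, so no end vertex becomes isolated; interior vertices of chains carry
  darts.\<close>

lemma isolated_vertices: "V' - src' ` X' = Inl ` (verts G - org G ` X)"
proof -
  have "src' ` X' = Inl ` org G ` X \<union> {Inr (i, j) | i j. i < k \<and> col i = Chain \<and> 0 < j \<and> j < m i}"
  proof (intro equalityI subsetI)
    fix v assume "v \<in> src' ` X'"
    then obtain i j s where "i < k" "j < m i" "v = src' ((i, j), s)" by auto
    then show "v \<in> Inl ` org G ` X \<union> {Inr (i, j) | i j. i < k \<and> col i = Chain \<and> 0 < j \<and> j < m i}"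
      by (cases "col i") (auto simp: blow_up_def Let_def m_def split: if_splits)
  next
    fix v assume "v \<in> Inl ` org G ` X \<union> {Inr (i, j) | i j. i < k \<and> col i = Chain \<and> 0 < j \<and> j < m i}"
    then consider d where "d \<in> X" "v = Inl (org G d)"
      | i j where "i < k" "col i = Chain" "0 < j" "j < m i" "v = Inr (i, j)" by blast
    then show "v \<in> src' ` X'"
    proof cases
      case 1
      obtain i s where d: "d = (i, s)" by (metis surj_pair)
      have "src' (outer d) = v" unfolding 1(2) d
        by (cases "col i"; cases s) (simp_all add: outer_def L_def R_def blow_up_def Let_def m_def)
      then show ?thesis using imageI[OF outer_in[OF 1(1)], of src'] by (simp only:)
    next
      case 2
      then have "src' ((i, j), False) = v" by (simp add: blow_up_def Let_def)
      moreover have "((i, j), False) \<in> X'" using 2 by simp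
      ultimately show ?thesis using imageI[of _ X' src'] by metis
    qed
  qed
  moreover have "V' = Inl ` verts G \<union> {Inr (i, j) | i j. i < k \<and> col i = Chain \<and> 0 < j \<and> j < m i}"
    by (simp add: blow_up_def Let_def m_def)
  ultimately show ?thesis by auto
qed

section \<open>Tracing circles past the special edges\<close>

context
  fixes Z :: "(nat \<times> nat) set"
  assumes Z: "Z \<subseteq> edges"
begin

definition nonempty :: "nat set" where "nonempty = {i. \<exists>j. (i, j) \<in> Z}"
definition merged' :: "(nat \<times> nat) set" where
  "merged' = {(i, j) \<in> edges. (i, j) \<in> Z \<longleftrightarrow> col i = Sheaf}"
text \<open>The state of \<open>G\<close> with the same connections: one separated edge cuts a
  chain, one merged edge connects a sheaf.\<close>

definition merged :: "nat set" where
  "merged = {i. i < k \<and> (i \<in> nonempty \<longleftrightarrow> col i = Sheaf)}"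

text \<open>Each special edge but the first of its chain or sheaf closes off one circle.\<close>

definition extra :: "(nat \<times> nat) set" where
  "extra = {(i, j) \<in> Z. \<exists>j'<j. (i, j') \<in> Z}"

abbreviation "\<pi>' \<equiv> flip merged' \<circ> nx'"
abbreviation "\<pi> \<equiv> flip merged \<circ> nxt G"

definition steps :: "(((nat \<times> nat) \<times> bool) \<times> ((nat \<times> nat) \<times> bool)) set" where
  "steps = graph_on X' \<pi>'"

abbreviation "sim \<equiv> gen_equiv steps"

lemma Z_lt: "(i, j) \<in> Z \<Longrightarrow> i < k \<and> j < m i"
  using Z by auto

lemma flip_L: "i < k \<Longrightarrow> j < m i \<Longrightarrow> flip merged' (L i j) =
    (if ((i, j) \<in> Z) \<longleftrightarrow> col i = Sheaf then R i j else L i j)"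
  by (cases "col i") (auto simp: flip_def L_def R_def merged'_def)

lemma flip_R: "i < k \<Longrightarrow> j < m i \<Longrightarrow> flip merged' (R i j) =
    (if ((i, j) \<in> Z) \<longleftrightarrow> col i = Sheaf then L i j else R i j)"
  by (cases "col i") (auto simp: flip_def L_def R_def merged'_def)

text \<open>In terms of \<open>L\<close> and \<open>R\<close> the colors disappear: circles run down
  side \<open>L\<close> and up side \<open>R\<close>, and change sides at special edges.\<close>

lemma \<pi>'_L: "i < k \<Longrightarrow> Suc j < m i \<Longrightarrow>
    \<pi>' (L i (Suc j)) = (if (i, j) \<in> Z then R i j else L i j)"
  by (cases "col i") (simp_all add: nx'_L flip_L flip_R)

lemma \<pi>'_R: "i < k \<Longrightarrow> Suc j < m i \<Longrightarrow>
    \<pi>' (R i j) = (if (i, Suc j) \<in> Z then L i (Suc j) else R i (Suc j))"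
  by (cases "col i") (auto simp: nx'_R flip_L flip_R)

lemma flip_entry:
  assumes "i < k"
  shows "flip merged' (entry (i, False)) = (if (i, 0) \<in> Z then L i 0 else R i 0)"
    and "flip merged' (entry (i, True)) = (if (i, m i - 1) \<in> Z then R i (m i - 1) else L i (m i - 1))"
  using assms m_pos[of i]
  by (cases "col i"; auto simp: entry_def flip_def merged'_def L_def R_def)+

lemma flip_merged:
  assumes "i < k"
  shows "flip merged (i, False) = (if i \<in> nonempty then \<alpha> i else \<beta> i)"
    and "flip merged (i, True) = (if i \<in> nonempty then \<beta> i else \<alpha> i)"
  using assms by (cases "col i"; auto simp: flip_def merged_def \<alpha>_def \<beta>_def)+

lemma sim_step: "x \<in> X' \<Longrightarrow> (x, \<pi>' x) \<in> sim"
  unfolding steps_def graph_on_def by (rule gen_equiv_base) blast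

lemma sim_L: "i < k \<Longrightarrow> Suc j < m i \<Longrightarrow> (L i (Suc j), if (i, j) \<in> Z then R i j else L i j) \<in> sim"
  using sim_step[of "L i (Suc j)"] by (simp only: \<pi>'_L L_in)

lemma sim_R: "i < k \<Longrightarrow> Suc j < m i \<Longrightarrow> (R i j, if (i, Suc j) \<in> Z then L i (Suc j) else R i (Suc j)) \<in> sim"
  using sim_step[of "R i j"] Suc_lessD[of j "m i"] by (simp only: \<pi>'_R R_in)

lemma sim_L_down:
  assumes "i < k" "a \<le> b" "b < m i" "\<And>j. a \<le> j \<Longrightarrow> j < b \<Longrightarrow> (i, j) \<notin> Z"
  shows "(L i b, L i a) \<in> sim"
  using assms(2-4)
proof (induction b rule: dec_induct)
  case (step b)
  then show ?case using sim_L[OF assms(1), of b] by (auto intro: gen_equiv_trans)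
qed simp

lemma sim_R_up:
  assumes "i < k" "a \<le> b" "b < m i" "\<And>j. a < j \<Longrightarrow> j \<le> b \<Longrightarrow> (i, j) \<notin> Z"
  shows "(R i a, R i b) \<in> sim"
  using assms(2-4)
proof (induction b rule: dec_induct)
  case (step b)
  then show ?case using sim_R[OF assms(1), of b] by (auto intro: gen_equiv_trans)
qed simp

lemma sim_R_L:
  assumes "i < k" "a < b" "(i, b) \<in> Z" "\<And>j. a < j \<Longrightarrow> j < b \<Longrightarrow> (i, j) \<notin> Z"
  shows "(R i a, L i b) \<in> sim"
proof -
  obtain c where c: "b = Suc c" using assms(2) by (cases b) auto
  have "Suc c < m i" using Z_lt[OF assms(3)] c by simp
  then have "(R i c, L i b) \<in> sim" using sim_R[OF assms(1), of c] assms(3) c by simp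
  moreover have "(R i a, R i c) \<in> sim"
    using assms \<open>Suc c < m i\<close> c by (intro sim_R_up) auto
  ultimately show ?thesis by (blast intro: gen_equiv_trans)
qed

text \<open>The circle through the place between edges \<open>g - 1\<close> and \<open>g\<close> of the chain or sheaf \<open>i\<close>.\<close>

definition circle_at :: "nat \<Rightarrow> nat \<Rightarrow> (nat \<times> bool) + (nat \<times> nat)" where
  "circle_at i g = (if \<forall>j<g. (i, j) \<notin> Z then Inl (\<alpha> i) else if \<forall>j\<ge>g. (i, j) \<notin> Z then Inl (\<beta> i)
     else Inr (i, LEAST j. g \<le> j \<and> (i, j) \<in> Z))"

text \<open>The gaps on both sides of an ordinary edge lie on the same circle.\<close>

lemma circle_at_Suc: "(i, g) \<notin> Z \<Longrightarrow> circle_at i (Suc g) = circle_at i g"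
proof -
  assume g: "(i, g) \<notin> Z"
  then have "(Suc g \<le> j \<and> (i, j) \<in> Z) = (g \<le> j \<and> (i, j) \<in> Z)" for j
    by (metis Suc_leD le_neq_implies_less Suc_leI)
  moreover have "(\<forall>j<Suc g. (i, j) \<notin> Z) = (\<forall>j<g. (i, j) \<notin> Z)" using g by (auto simp: less_Suc_eq)
  moreover have "(\<forall>j\<ge>Suc g. (i, j) \<notin> Z) = (\<forall>j\<ge>g. (i, j) \<notin> Z)"
    using g by (metis Suc_leD le_neq_implies_less Suc_leI)
  ultimately show ?thesis unfolding circle_at_def by presburger
qed

lemma circle_at_0: "circle_at i 0 = Inl (\<alpha> i)"
  by (simp add: circle_at_def)

lemma circle_at_m:
  assumes "i \<in> nonempty"
  shows "circle_at i (m i) = Inl (\<beta> i)"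
proof -
  have "\<not> (\<forall>j<m i. (i, j) \<notin> Z)" using assms Z_lt by (auto simp: nonempty_def)
  moreover have "\<forall>j\<ge>m i. (i, j) \<notin> Z" using Z_lt not_less by blast
  ultimately show ?thesis by (auto simp: circle_at_def)
qed

lemma circle_at_empty: "i \<notin> nonempty \<Longrightarrow> circle_at i g = Inl (\<alpha> i)"
  by (auto simp: circle_at_def nonempty_def)

text \<open>Corner \<open>L i j\<close> lies in the gap before edge \<open>j\<close>, corner
  \<open>R i j\<close> in the gap after it. A label \<open>Inl d\<close> belongs to the circle
  leaving at the end \<open>d\<close>, a label \<open>Inr (i, b)\<close> to the circle closed off
  between the special edge \<open>b\<close> and the one before. Without special edges the sides are
  not connected inside, and get the separate labels \<open>\<alpha> i\<close> and
  \<open>\<beta> i\<close>.\<close>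

definition circle_of :: "(nat \<times> nat) \<times> bool \<Rightarrow> (nat \<times> bool) + (nat \<times> nat)" where
  "circle_of x = (case x of ((i, j), s) \<Rightarrow> if s = (col i = Sheaf) then circle_at i j
     else if i \<in> nonempty then circle_at i (Suc j) else Inl (\<beta> i))"

lemma circle_of_L: "circle_of (L i j) = circle_at i j"
  by (simp add: circle_of_def L_def)

lemma circle_of_R: "circle_of (R i j) = (if i \<in> nonempty then circle_at i (Suc j) else Inl (\<beta> i))"
  by (cases "col i") (simp_all add: circle_of_def R_def)

text \<open>A representative for each label; for \<open>Inr (i, j)\<close> it sits just before the
  special edge \<open>j\<close>, where the circle turns.\<close>

definition corner_on :: "(nat \<times> bool) + (nat \<times> nat) \<Rightarrow> (nat \<times> nat) \<times> bool" where
  "corner_on y = (case y of Inl d \<Rightarrow> outer d | Inr (i, j) \<Rightarrow> L i j)"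

text \<open>A circle entering at \<open>d\<close> is turned to the other side by the first special
  edge it meets, or runs past the whole chain or sheaf. Either way it leaves where the state
  \<open>merged\<close> of \<open>G\<close> sends it.\<close>

lemma circle_of_entry:
  assumes "d \<in> X"
  shows "circle_of (flip merged' (entry d)) = Inl (flip merged d)"
proof -
  obtain i s where d: "d = (i, s)" and i: "i < k" using assms by auto
  have m: "m i = Suc (m i - 1)" using m_pos[of i] by simp
  show ?thesis
  proof (cases s)
    case True
    have "(i, m i - 1) \<in> Z \<Longrightarrow> i \<in> nonempty" by (auto simp: nonempty_def)
    moreover have "(i, m i - 1) \<notin> Z \<Longrightarrow> i \<in> nonempty \<Longrightarrow> circle_at i (m i - 1) = Inl (\<beta> i)"
      using circle_at_Suc circle_at_m m by metis
    ultimately show ?thesis using True i circle_at_m[of i] circle_at_empty[of i] m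
      by (auto simp: d flip_entry flip_merged circle_of_L circle_of_R)
  next
    case False
    have "(i, 0) \<in> Z \<Longrightarrow> i \<in> nonempty" by (auto simp: nonempty_def)
    then show ?thesis using False i
      by (auto simp: d flip_entry flip_merged circle_of_L circle_of_R circle_at_0 circle_at_Suc)
  qed
qed

text \<open>The corner is moved along its circle to the representative: down side \<open>L\<close>
  to the last special edge before it, which turns the circle to side \<open>R\<close>, and up side
  \<open>R\<close> to the next special edge or to the end \<open>\<beta> i\<close>. Where no special
  edge precedes, side \<open>L\<close> leads to the end \<open>\<alpha> i\<close>.\<close>

lemma sim_corner:
  assumes "x \<in> X'"
  shows "(x, corner_on (circle_of x)) \<in> sim"
proof -
  have least: "\<exists>b. (LEAST j. g \<le> j \<and> (i, j) \<in> Z) = b \<and> g \<le> b \<and> (i, b) \<in> Z \<and> (\<forall>j. g \<le> j \<and> j < b \<longrightarrow> (i, j) \<notin> Z)"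
    if "g \<le> j" "(i, j) \<in> Z" for g i j
    using LeastI[of "\<lambda>j. g \<le> j \<and> (i, j) \<in> Z", OF conjI[OF that]]
      not_less_Least[of _ "\<lambda>j. g \<le> j \<and> (i, j) \<in> Z"] by blast
  from assms show ?thesis
  proof (cases rule: LR_cases)
    case (1 i j)
    note ij = 1(1,2)
    consider "\<forall>j'<j. (i, j') \<notin> Z" | j' where "j' < j" "(i, j') \<in> Z" by blast
    then show ?thesis
    proof cases
      case 1
      then have "circle_of x = Inl (\<alpha> i)" by (simp add: \<open>x = _\<close> circle_of_L circle_at_def)
      moreover have "(L i j, L i 0) \<in> sim" using ij 1 by (intro sim_L_down) auto
      ultimately show ?thesis by (simp add: \<open>x = _\<close> corner_on_def outer_\<alpha>)
    next
      case (2 j0)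
      \<comment> \<open>The special edge at which the circle turns from \<open>L\<close> to
        \<open>R\<close>; being the last one before \<open>j\<close>, it leaves the way to
        \<open>j\<close> free.\<close>
      define a where "a = Max {j'. j' < j \<and> (i, j') \<in> Z}"
      have fin: "finite {j'. j' < j \<and> (i, j') \<in> Z}" by simp
      have a: "a < j" "(i, a) \<in> Z"
        using Max_in[OF fin] 2 unfolding a_def by blast+
      have above: "(i, j') \<notin> Z" if "a < j'" "j' < j" for j'
        using Max_ge[OF fin, of j'] that unfolding a_def[symmetric] by fastforce
      have "(L i j, L i (Suc a)) \<in> sim" using ij a above by (intro sim_L_down) auto
      also have "(L i (Suc a), R i a) \<in> sim" using sim_L[of i a] ij a by simp
      finally have Ra: "(L i j, R i a) \<in> sim" .
      show ?thesis
      proof (cases "\<forall>j'\<ge>j. (i, j') \<notin> Z")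
        case True
        then have "circle_of x = Inl (\<beta> i)" using 2
          by (auto simp: \<open>x = _\<close> circle_of_L circle_at_def)
        moreover have "(R i a, R i (m i - 1)) \<in> sim"
        proof (rule sim_R_up)
          show "(i, j') \<notin> Z" if "a < j'" for j' using above True that by (cases "j' < j") auto
        qed (use ij a in auto)
        ultimately show ?thesis using Ra
          by (auto simp: \<open>x = _\<close> corner_on_def outer_\<beta> intro: gen_equiv_trans)
      next
        case False
        then obtain b where b: "(LEAST j'. j \<le> j' \<and> (i, j') \<in> Z) = b" "j \<le> b" "(i, b) \<in> Z"
          "\<forall>j'. j \<le> j' \<and> j' < b \<longrightarrow> (i, j') \<notin> Z" using least[of j _ i] by blast
        have "circle_of x = Inr (i, b)" using 2 False b(1)
          by (auto simp: \<open>x = _\<close> circle_of_L circle_at_def)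
        moreover have "(R i a, L i b) \<in> sim"
        proof (rule sim_R_L)
          show "(i, j') \<notin> Z" if "a < j'" "j' < b" for j' using above b that by (cases "j' < j") auto
        qed (use ij a b in auto)
        ultimately show ?thesis using Ra
          by (auto simp: \<open>x = _\<close> corner_on_def intro: gen_equiv_trans)
      qed
    qed
  next
    case (2 i j)
    note ij = 2(1,2)
    show ?thesis
    proof (cases "\<forall>j'\<ge>Suc j. (i, j') \<notin> Z")
      case True
      have "circle_of x = Inl (\<beta> i)"
      proof (cases "i \<in> nonempty")
        case ne: True
        then obtain j' where "(i, j') \<in> Z" by (auto simp: nonempty_def)
        then have "\<not> (\<forall>j'<Suc j. (i, j') \<notin> Z)" using True by (meson not_less)
        then show ?thesis using True ne by (auto simp: \<open>x = _\<close> circle_of_R circle_at_def)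
      qed (simp add: \<open>x = _\<close> circle_of_R)
      moreover have "(R i j, R i (m i - 1)) \<in> sim" using True ij by (intro sim_R_up) auto
      ultimately show ?thesis by (simp add: \<open>x = _\<close> corner_on_def outer_\<beta>)
    next
      case False
      then obtain b where b: "(LEAST j'. Suc j \<le> j' \<and> (i, j') \<in> Z) = b" "Suc j \<le> b" "(i, b) \<in> Z"
        "\<forall>j'. Suc j \<le> j' \<and> j' < b \<longrightarrow> (i, j') \<notin> Z" using least[of "Suc j" _ i] by blast
      have ne: "i \<in> nonempty" using b(3) by (auto simp: nonempty_def)
      have RL: "(R i j, L i b) \<in> sim" using ij b by (intro sim_R_L) auto
      show ?thesis
      proof (cases "\<forall>j'<Suc j. (i, j') \<notin> Z")
        case True
        then have "circle_of x = Inl (\<alpha> i)" using ne by (simp add: \<open>x = _\<close> circle_of_R circle_at_def)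
        moreover have "(L i b, L i 0) \<in> sim"
        proof (rule sim_L_down)
          show "(i, j') \<notin> Z" if "j' < b" for j' using True b that by (cases "j' < Suc j") auto
        qed (use ij b Z_lt in auto)
        ultimately show ?thesis using RL
          by (auto simp: \<open>x = _\<close> corner_on_def outer_\<alpha> intro: gen_equiv_trans)
      next
        case some: False
        then have "circle_of x = Inr (i, b)" using ne False b(1)
          by (auto simp: \<open>x = _\<close> circle_of_R circle_at_def)
        then show ?thesis using RL by (simp add: \<open>x = _\<close> corner_on_def)
      qed
    qed
  qed
qed

lemma circle_of_corner:
  assumes "y \<in> X <+> extra"
  shows "circle_of (corner_on y) = y"
proof -
  consider d where "d \<in> X" "y = Inl d" | e where "e \<in> extra" "y = Inr e" using assms by blast
  then show ?thesis
  proof cases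
    case (1 d)
    from 1(1) show ?thesis
    proof (cases rule: \<alpha>\<beta>_cases)
      case (1 i)
      then show ?thesis by (simp add: \<open>y = _\<close> corner_on_def outer_\<alpha> circle_of_L circle_at_0)
    next
      case (2 i)
      then show ?thesis using circle_at_m[of i] m_pos[of i]
        by (simp add: \<open>y = _\<close> corner_on_def outer_\<beta> circle_of_R)
    qed
  next
    case (2 e)
    then obtain i j j' where e: "e = (i, j)" "(i, j) \<in> Z" "j' < j" "(i, j') \<in> Z"
      by (auto simp: extra_def)
    then have "(LEAST j'. j \<le> j' \<and> (i, j') \<in> Z) = j" by (intro Least_equality) auto
    then have "circle_at i j = Inr (i, j)" using e by (auto simp: circle_at_def)
    then show ?thesis by (simp add: \<open>y = _\<close> e(1) corner_on_def circle_of_L)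
  qed
qed

text \<open>A step inside a chain or sheaf keeps the label, and a step out of it through
  \<open>d\<close> changes \<open>Inl d\<close> to \<open>Inl (\<pi> d)\<close>. The labels in
  \<open>extra\<close> are never left.\<close>

lemma num_classes_blow_up:
  "num_classes X' (graph_on X' \<pi>') = num_classes X (graph_on X \<pi>) + card extra"
proof -
  let ?R = "map_prod Inl Inl ` graph_on X \<pi> :: (((nat \<times> bool) + (nat \<times> nat)) \<times> _) set"
  have "num_classes X' steps = num_classes (X <+> extra) ?R"
  proof (rule num_classes_eqI[where f=circle_of and g=corner_on])
    have at: "circle_at i g \<in> X <+> extra" if "i < k" for i g
    proof -
      consider "\<forall>j<g. (i, j) \<notin> Z" | "\<not> (\<forall>j<g. (i, j) \<notin> Z)" "\<forall>j\<ge>g. (i, j) \<notin> Z"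
        | a b where "a < g" "(i, a) \<in> Z" "g \<le> b" "(i, b) \<in> Z" by blast
      then show ?thesis
      proof cases
        case 1
        then have "circle_at i g = Inl (\<alpha> i)" unfolding circle_at_def by (rule if_P)
        then show ?thesis using that by (auto simp: \<alpha>_def \<beta>_def)
      next
        case 2
        then have "circle_at i g = Inl (\<beta> i)" unfolding circle_at_def by argo
        then show ?thesis using that by (auto simp: \<alpha>_def \<beta>_def)
      next
        case 3
        let ?l = "LEAST j. g \<le> j \<and> (i, j) \<in> Z"
        have l: "g \<le> ?l \<and> (i, ?l) \<in> Z" by (rule LeastI[of _ b]) (use 3 in simp)
        then have "a < ?l" using 3 by linarith
        then have "(i, ?l) \<in> extra" using l 3 unfolding extra_def by blast
        moreover have "\<not> (\<forall>j<g. (i, j) \<notin> Z)" "\<not> (\<forall>j\<ge>g. (i, j) \<notin> Z)" using 3 by blast+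
        then have "circle_at i g = Inr (i, ?l)" unfolding circle_at_def by argo
        ultimately show ?thesis by auto
      qed
    qed
    show "circle_of x \<in> X <+> extra" if "x \<in> X'" for x
      using that by (cases rule: LR_cases) (auto simp: circle_of_L circle_of_R at \<beta>_def)
    show "corner_on y \<in> X'" if yX: "y \<in> X <+> extra" for y
    proof -
      consider d where "d \<in> X" "y = Inl d" | e where "e \<in> extra" "y = Inr e" using yX by blast
      then show ?thesis
      proof cases
        case (1 d) then show ?thesis using outer_in by (simp add: corner_on_def)
      next
        case (2 e)
        then obtain i j where e: "e = (i, j)" "(i, j) \<in> Z" by (auto simp: extra_def)
        then show ?thesis using Z_lt by (simp add: 2 corner_on_def)
      qed
    qed
    have R: "(Inl d, Inl (\<pi> d)) \<in> gen_equiv ?R" if "d \<in> X" for d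
      by (rule gen_equiv_base, rule image_eqI[of _ _ "(d, \<pi> d)"])
        (use that in \<open>auto simp: graph_on_def\<close>)
    show "(circle_of x, circle_of y) \<in> gen_equiv ?R" if xy: "(x, y) \<in> steps" for x y
    proof -
      from xy have x: "x \<in> X'" and y: "y = \<pi>' x" unfolding steps_def graph_on_def by blast+
      from x show ?thesis
      proof (cases rule: LR_cases)
        case (1 i j)
        show ?thesis
        proof (cases j)
          case 0
          have "circle_of y = Inl (\<pi> (\<alpha> i))"
            using circle_of_entry[OF nxt_in[of "\<alpha> i"]] 1 0 by (simp add: y nx'_L)
          moreover have "circle_of x = Inl (\<alpha> i)" by (simp add: 1 0 circle_of_L circle_at_0)
          ultimately show ?thesis using R[of "\<alpha> i"] 1(1) by (simp only: \<alpha>\<beta>_in)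
        next
          case (Suc j')
          then have "y = (if (i, j') \<in> Z then R i j' else L i j')"
            using \<pi>'_L[of i j'] 1 y by simp
          moreover have "(i, j') \<in> Z \<Longrightarrow> i \<in> nonempty" by (auto simp: nonempty_def)
          ultimately have "circle_of y = circle_of x"
            by (simp add: 1 Suc circle_of_L circle_of_R circle_at_Suc)
          then show ?thesis by simp
        qed
      next
        case (2 i j)
        show ?thesis
        proof (cases "Suc j < m i")
          case False
          then have j: "j = m i - 1" "Suc j = m i" using 2 by auto
          have "circle_of y = Inl (\<pi> (\<beta> i))"
            using circle_of_entry[OF nxt_in[of "\<beta> i"]] 2 j by (simp add: y nx'_R)
          moreover have "circle_of x = Inl (\<beta> i)" using circle_at_m j(2) by (simp add: 2 circle_of_R)
          ultimately show ?thesis using R[of "\<beta> i"] 2(1) by (simp only: \<alpha>\<beta>_in)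
        next
          case True
          then have "y = (if (i, Suc j) \<in> Z then L i (Suc j) else R i (Suc j))"
            using \<pi>'_R[of i j] 2 y by simp
          moreover have "(i, Suc j) \<in> Z \<Longrightarrow> i \<in> nonempty" by (auto simp: nonempty_def)
          ultimately have "circle_of y = circle_of x"
            using circle_at_Suc[of i "Suc j"] by (simp add: 2 circle_of_L circle_of_R)
          then show ?thesis by simp
        qed
      qed
    qed
    show "(corner_on x, corner_on y) \<in> sim" if xy: "(x, y) \<in> ?R" for x y
    proof -
      obtain d where d: "d \<in> X" "x = Inl d" "y = Inl (flip merged (nxt G d))"
        using xy unfolding graph_on_def comp_def by blast
      have "(outer d, flip merged' (entry (nxt G d))) \<in> sim"
        using sim_step[OF outer_in[OF d(1)]] nx'_outer[OF d(1)] by simp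
      moreover have "(flip merged' (entry (nxt G d)), corner_on y) \<in> sim"
      proof -
        have "flip merged' (entry (nxt G d)) \<in> X'"
          using entry_in[OF nxt_in[OF d(1)]] by (auto simp: flip_def)
        from sim_corner[OF this] show ?thesis using circle_of_entry[OF nxt_in[OF d(1)]] d(3) by simp
      qed
      ultimately show ?thesis by (auto simp: d(2) corner_on_def intro: gen_equiv_trans)
    qed
    show "(x, corner_on (circle_of x)) \<in> sim" if "x \<in> X'" for x
      using that by (rule sim_corner)
    show "(y, circle_of (corner_on y)) \<in> gen_equiv ?R" if "y \<in> X <+> extra" for y
      using that by (simp add: circle_of_corner)
  qed
  also have "\<dots> = num_classes X (graph_on X \<pi>) + card extra"
  proof (rule num_classes_Plus)
    show "finite extra" using Z finite_edges by (auto simp: extra_def intro: finite_subset[where B=edges])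
  qed simp
  finally show ?thesis unfolding steps_def .
qed

lemma card_extra: "card extra = (\<Sum>i\<in>nonempty. card {j. (i, j) \<in> Z} - 1)"
proof -
  have fin: "finite {j. (i, j) \<in> Z}" for i
    by (rule finite_subset[of _ "{..<m i}"]) (use Z_lt in blast)+
  have "extra = Sigma nonempty (\<lambda>i. {j. (i, j) \<in> Z} - {Min {j. (i, j) \<in> Z}})"
  proof (intro equalityI subsetI)
    fix e assume "e \<in> extra"
    then obtain i j j' where e: "e = (i, j)" "(i, j) \<in> Z" "j' < j" "(i, j') \<in> Z"
      by (auto simp: extra_def)
    then have "Min {j. (i, j) \<in> Z} \<le> j'" using fin by (intro Min_le) auto
    then show "e \<in> Sigma nonempty (\<lambda>i. {j. (i, j) \<in> Z} - {Min {j. (i, j) \<in> Z}})"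
      using e by (auto simp: nonempty_def)
  next
    fix e assume "e \<in> Sigma nonempty (\<lambda>i. {j. (i, j) \<in> Z} - {Min {j. (i, j) \<in> Z}})"
    then obtain i j where e: "e = (i, j)" "(i, j) \<in> Z" "j \<noteq> Min {j. (i, j) \<in> Z}" by blast
    then have "Min {j. (i, j) \<in> Z} < j" using Min_le[OF fin[of i], of j] by simp
    moreover have "Min {j. (i, j) \<in> Z} \<in> {j. (i, j) \<in> Z}" using e fin by (intro Min_in) auto
    ultimately show "e \<in> extra" using e by (auto simp: extra_def)
  qed
  moreover have "finite nonempty"
    by (rule finite_subset[of _ "{..<k}"]) (use Z_lt nonempty_def in blast)+
  ultimately have "card extra = (\<Sum>i\<in>nonempty. card ({j. (i, j) \<in> Z} - {Min {j. (i, j) \<in> Z}}))"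
    using fin by (simp add: card_SigmaI)
  also have "\<dots> = (\<Sum>i\<in>nonempty. card {j. (i, j) \<in> Z} - 1)"
  proof (rule sum.cong[OF refl])
    fix i assume "i \<in> nonempty"
    then have "Min {j. (i, j) \<in> Z} \<in> {j. (i, j) \<in> Z}"
      using fin by (intro Min_in) (auto simp: nonempty_def)
    then show "card ({j. (i, j) \<in> Z} - {Min {j. (i, j) \<in> Z}}) = card {j. (i, j) \<in> Z} - 1"
      by (rule card_Diff_singleton)
  qed
  finally show ?thesis .
qed

lemma loops_blow_up:
  "loops V' edges src' nx' merged' = loops (verts G) {..<k} (org G) (nxt G) merged +
     (\<Sum>i\<in>nonempty. card {j. (i, j) \<in> Z} - 1)"
  unfolding loops_def num_classes_blow_up isolated_vertices card_extra
  by (simp add: card_image)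

end

end

section \<open>States of a plane graph and spanning trees\<close>

locale colored_plane_graph =
  fixes k :: nat and G :: "('v, nat \<times> bool) plane_graph" and col :: "nat \<Rightarrow> color"
  assumes ordered: "ordered_plane_graph k G"
begin

abbreviation "V \<equiv> verts G"
abbreviation "X \<equiv> {..<k} \<times> (UNIV :: bool set)"
abbreviation "\<pi> S \<equiv> flip S \<circ> nxt G"
abbreviation "circles S \<equiv> loops V {..<k} (org G) (nxt G) S"
abbreviation "adj S \<equiv> {(org G x, org G (plane_graph.rev G x)) | x. x \<in> S \<times> UNIV}"

lemma finite_V: "finite V" and V_nonempty: "V \<noteq> {}"
  and org_in: "\<And>x. x \<in> X \<Longrightarrow> org G x \<in> V"
  and nxt_G: "bij_betw (nxt G) X X"
  and orbit_nxt: "\<And>x. x \<in> X \<Longrightarrow> orbit (nxt G) x = {y \<in> X. org G y = org G x}"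
  and rev_G: "\<And>i s. i < k \<Longrightarrow> plane_graph.rev G (i, s) = (i, \<not> s)"
  and connected: "\<And>v w. v \<in> V \<Longrightarrow> w \<in> V \<Longrightarrow> (v, w) \<in> (adj {..<k})\<^sup>*"
  and euler: "2 * card V + 2 * (if X = {} then 1 else card (orbit (nxt G \<circ> plane_graph.rev G) ` X))
      = 2 * k + 4"
proof -
  have card_X: "card X = 2 * k" by (simp add: card_cartesian_product)
  have *: "connected_plane_graph G" "gdarts G = X"
    and rev: "\<forall>i<k. \<forall>s. plane_graph.rev G (i, s) = (i, \<not> s)"
    using ordered unfolding ordered_plane_graph_def by blast+
  from *(1) show "finite V" "V \<noteq> {}" "\<And>x. x \<in> X \<Longrightarrow> org G x \<in> V" "bij_betw (nxt G) X X"
    "\<And>x. x \<in> X \<Longrightarrow> orbit (nxt G) x = {y \<in> X. org G y = org G x}"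
    "\<And>v w. v \<in> V \<Longrightarrow> w \<in> V \<Longrightarrow> (v, w) \<in> (adj {..<k})\<^sup>*"
    "2 * card V + 2 * (if X = {} then 1 else card (orbit (nxt G \<circ> plane_graph.rev G) ` X)) = 2 * k + 4"
    unfolding connected_plane_graph_def *(2) card_X by blast+
  show "\<And>i s. i < k \<Longrightarrow> plane_graph.rev G (i, s) = (i, \<not> s)" using rev by blast
qed

lemma nxt_in: "x \<in> X \<Longrightarrow> nxt G x \<in> X"
  using nxt_G by (metis bij_betw_apply)

lemma flip_in: "x \<in> X \<Longrightarrow> flip S x \<in> X"
  by (auto simp: flip_def)

lemma flip_flip [simp]: "flip S (flip S x) = x"
  by (cases x) (auto simp: flip_def)

lemma org_nxt: "x \<in> X \<Longrightarrow> org G (nxt G x) = org G x"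
  using orbit_nxt[of x] orbit.base[of "nxt G" x] by auto

lemma flip_bij: "bij_betw (flip S) X X"
  by (rule bij_betw_byWitness[where f'="flip S"]) (simp, simp, (rule image_subsetI, erule flip_in)+)

lemma \<pi>_bij: "bij_betw (\<pi> S) X X"
  by (rule bij_betw_trans[OF nxt_G flip_bij])

text \<open>Switching one edge exchanges its two half-edges as targets, so surgery on states becomes
  multiplication by a transposition.\<close>

lemma flip_toggle:
  "\<pi> (sym_diff S {i}) = transpose (i, False) (i, True) \<circ> \<pi> S"
  by (auto simp: fun_eq_iff flip_def transpose_def prod_eq_iff)

lemma circles_toggle_le:
  assumes "i < k"
  shows "circles (sym_diff S {i}) \<le> Suc (circles S)"
  unfolding loops_def flip_toggle
  using num_classes_transpose_le[of X "(i, False)" "(i, True)" "\<pi> S"] assms by simp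

lemma circles_toggle_merge:
  assumes "i < k" "((i, False), (i, True)) \<notin> gen_equiv (graph_on X (\<pi> S))"
  shows "circles S = Suc (circles (sym_diff S {i}))"
  unfolding loops_def flip_toggle
  using num_classes_transpose_merge[OF _ \<pi>_bij _ _ assms(2)] assms(1) by simp

lemma no_isolated:
  assumes "0 < k"
  shows "V - org G ` X = {}"
proof (rule ccontr)
  assume "V - org G ` X \<noteq> {}"
  then obtain v where v: "v \<in> V" "v \<notin> org G ` X" by blast
  let ?w = "org G (0, False)"
  have w: "?w \<in> V" "?w \<in> org G ` X" using assms org_in by auto
  have "(v, ?w) \<in> (adj {..<k})\<^sup>*" using connected v w by blast
  then show False using v(2) w(2) by (cases rule: converse_rtranclE) auto
qed

lemma circles_eq: "0 < k \<Longrightarrow> circles S = num_classes X (graph_on X (\<pi> S))"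
  unfolding loops_def by (simp only: no_isolated card.empty add_0_right)

text \<open>With all edges merged the circles are the faces. For \<open>k = 0\<close> the circle of
  the only vertex stands for the face that orbits on darts do not show.\<close>

lemma euler_circles: "card V + circles {..<k} = k + 2"
proof (cases "k = 0")
  case True
  then show ?thesis using euler by (simp add: loops_def num_classes_def quotient_def)
next
  case False
  let ?r = "plane_graph.rev G"
  have rev: "flip {..<k} x = ?r x" if "x \<in> X" for x
    using that rev_G by (cases x) (auto simp: flip_def)
  have rev_bij: "bij_betw ?r X X"
    using flip_bij rev bij_betw_cong[of X "flip {..<k}" ?r X] by blast
  have "card (orbit (nxt G \<circ> ?r) ` X) = num_classes X (graph_on X (nxt G \<circ> ?r))"
    by (rule card_orbits) (use bij_betw_trans[OF rev_bij nxt_G] in auto)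
  \<comment> \<open>The permutations "reverse, then \<open>nxt G\<close>" and "\<open>nxt G\<close>,
    then reverse" are conjugate by the reversal, which is \<open>flip\<close> for the full edge
    set.\<close>
  also have "\<dots> = num_classes X (graph_on X (\<pi> {..<k}))"
  proof (rule num_classes_eqI[where f="flip {..<k}" and g="flip {..<k}"])
    show "(flip {..<k} x, flip {..<k} y) \<in> gen_equiv (graph_on X (\<pi> {..<k}))"
      if "(x, y) \<in> graph_on X (nxt G \<circ> ?r)" for x y
    proof (rule gen_equiv_base)
      from that have "x \<in> X" "y = nxt G (flip {..<k} x)"
        using rev[of x] unfolding mem_graph_on by simp_all
      then show "(flip {..<k} x, flip {..<k} y) \<in> graph_on X (\<pi> {..<k})"
        using flip_in[of x "{..<k}"] unfolding mem_graph_on comp_def by (simp only: simp_thms)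
    qed
    show "(flip {..<k} x, flip {..<k} y) \<in> gen_equiv (graph_on X (nxt G \<circ> ?r))"
      if "(x, y) \<in> graph_on X (\<pi> {..<k})" for x y
    proof (rule gen_equiv_base)
      from that have x: "x \<in> X" and y: "y = flip {..<k} (nxt G x)"
        unfolding mem_graph_on comp_def by (simp_all only:)
      have "flip {..<k} y = (nxt G \<circ> ?r) (flip {..<k} x)"
        using rev[OF flip_in[OF x], of "{..<k}"] y by (simp only: flip_flip comp_def)
      then show "(flip {..<k} x, flip {..<k} y) \<in> graph_on X (nxt G \<circ> ?r)"
        using flip_in[OF x, of "{..<k}"] unfolding mem_graph_on by blast
    qed
  qed (use flip_in in auto)
  finally have calc: "card (orbit (nxt G \<circ> ?r) ` X) = num_classes X (graph_on X (\<pi> {..<k}))" .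
  have "2 * card V + 2 * num_classes X (graph_on X (\<pi> {..<k})) = 2 * k + 4"
  proof -
    have "(0, False) \<in> X" using False by simp
    then have "X \<noteq> {}" by blast
    from euler[unfolded if_not_P[OF this]] show ?thesis unfolding calc .
  qed
  then show ?thesis using circles_eq[of "{..<k}"] False by linarith
qed

lemma circles_all_le:
  assumes "finite A" "A \<subseteq> {..<k}" "A \<inter> S = {}"
  shows "circles (S \<union> A) \<le> circles S + card A"
  using assms
proof (induction A rule: finite_induct)
  case (insert i A)
  let ?T = "S \<union> A"
  have "S \<union> insert i A = ?T - {i} \<union> ({i} - ?T)" using insert.hyps(2) insert.prems by auto
  then have "circles (S \<union> insert i A) \<le> Suc (circles ?T)"
    using circles_toggle_le[of i ?T] insert.prems by simp
  then show ?case using insert by simp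
qed simp

lemma circles_pos: "0 < circles S"
  using num_classes_pos[of X] finite_V V_nonempty
  by (cases "k = 0") (auto simp: loops_def card_gt_0_iff lessThan_empty_iff)

section \<open>Connectedness, cycles and spanning trees\<close>

lemma adj_sym: "S \<subseteq> {..<k} \<Longrightarrow> (v, w) \<in> (adj S)\<^sup>* \<Longrightarrow> (w, v) \<in> (adj S)\<^sup>*"
proof -
  assume S: "S \<subseteq> {..<k}"
  have "sym (adj S)"
  proof (rule symI)
    fix a b assume "(a, b) \<in> adj S"
    then obtain i s where "i \<in> S" "a = org G (i, s)" "b = org G (plane_graph.rev G (i, s))" by auto
    moreover have "plane_graph.rev G (i, s) = (i, \<not> s)" "plane_graph.rev G (i, \<not> s) = (i, s)"
      using rev_G S \<open>i \<in> S\<close> by auto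
    ultimately have "b = org G (i, \<not> s)" "a = org G (plane_graph.rev G (i, \<not> s))" "(i, \<not> s) \<in> S \<times> UNIV"
      by auto
    then show "(b, a) \<in> adj S" by blast
  qed
  then show "(v, w) \<in> (adj S)\<^sup>* \<Longrightarrow> (w, v) \<in> (adj S)\<^sup>*" by (meson sym_rtrancl symD)
qed

text \<open>\<open>nxt G\<close> stays at its vertex and \<open>flip S\<close> changes the vertex
  only along an edge of \<open>S\<close>; a single circle visits all corners, hence all
  vertices.\<close>

lemma one_circle_connected:
  assumes S: "S \<subseteq> {..<k}" and one: "circles S = 1" and vw: "v \<in> V" "w \<in> V"
  shows "(v, w) \<in> (adj S)\<^sup>*"
proof (cases "k = 0")
  case True
  then have "card V = 1" using one by (simp add: loops_def num_classes_def quotient_def)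
  then show ?thesis using vw by (auto simp: card_1_singleton_iff)
next
  case False
  then have iso: "V - org G ` X = {}" by (simp add: no_isolated)
  then have "num_classes X (graph_on X (\<pi> S)) = 1" using one circles_eq[of S] False by simp
  moreover obtain x y where "x \<in> X" "v = org G x" "y \<in> X" "w = org G y" using iso vw by blast
  ultimately have "(x, y) \<in> gen_equiv (graph_on X (\<pi> S))" by (intro num_classes_one) auto
  then have "(org G x, org G y) \<in> (adj S)\<^sup>*"
  proof (induction rule: gen_equiv_induct)
    case (step x y)
    then have "x \<in> X" "y = flip S (nxt G x)" unfolding mem_graph_on comp_def by blast+
    obtain i s where n: "nxt G x = (i, s)" by (metis surj_pair)
    have i: "i < k" using nxt_in[OF \<open>x \<in> X\<close>] n by simp
    show ?case
    proof (cases "i \<in> S")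
      case True
      then have "y = plane_graph.rev G (i, s)"
        using \<open>y = _\<close> n i rev_G by (auto simp: flip_def)
      moreover have "(i, s) \<in> S \<times> UNIV" using True by simp
      ultimately have "(org G (i, s), org G y) \<in> adj S" by blast
      then show ?thesis using org_nxt[OF \<open>x \<in> X\<close>] n by auto
    next
      case False
      then have "y = nxt G x" using \<open>y = _\<close> n by (simp add: flip_def)
      then show ?thesis using org_nxt[OF \<open>x \<in> X\<close>] by simp
    qed
  next
    case (sym x y) then show ?case by (rule adj_sym[OF S])
  qed auto
  then show ?thesis using \<open>v = _\<close> \<open>w = _\<close> by simp
qed

text \<open>Growing the vertex set of a cycle along edges leaving it adds one edge per vertex.\<close>

lemma cycle_card_edges:
  assumes S: "S \<subseteq> {..<k}" and cycle: "edge_cycle G S xs"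
    and conn: "\<And>v w. v \<in> V \<Longrightarrow> w \<in> V \<Longrightarrow> (v, w) \<in> (adj S)\<^sup>*"
  shows "card V \<le> card S"
proof -
  let ?ends = "\<lambda>F U. \<forall>i\<in>F. \<forall>s. org G (i, s) \<in> U"
  \<comment> \<open>The cycle starts the induction, having as many edges as vertices. Chosen edges
    have both ends among the chosen vertices, so an edge leaving these is new.\<close>
  have grow: "\<exists>U F. U \<subseteq> V \<and> card U = n \<and> F \<subseteq> S \<and> card F = n \<and> ?ends F U"
    if "length xs \<le> n" "n \<le> card V" for n
    using that
  proof (induction n rule: dec_induct)
    case base
    have xs: "xs \<noteq> []" "set xs \<subseteq> S \<times> UNIV" "distinct (map fst xs)" "distinct (map (org G) xs)"
      "\<And>n. n < length xs \<Longrightarrow> org G (plane_graph.rev G (xs ! n)) = org G (xs ! (Suc n mod length xs))"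
      using cycle unfolding edge_cycle_def by auto
    have "?ends (fst ` set xs) (org G ` set xs)"
    proof (intro ballI allI)
      fix i s assume "i \<in> fst ` set xs"
      then obtain n s' where n: "n < length xs" "xs ! n = (i, s')"
        by (force simp: in_set_conv_nth)
      have i: "i < k" using nth_mem[OF n(1)] n(2) xs(2) S by auto
      have "org G (i, s') \<in> org G ` set xs" using nth_mem[OF n(1)] n(2) by auto
      moreover have "org G (i, \<not> s') \<in> org G ` set xs"
      proof -
        have "Suc n mod length xs < length xs" using xs(1) by simp
        then show ?thesis using xs(5)[OF n(1)] n(2) rev_G[OF i] nth_mem by (metis imageI)
      qed
      ultimately show "org G (i, s) \<in> org G ` set xs" by (cases "s = s'") auto
    qed
    moreover have "org G ` set xs \<subseteq> V" using xs(2) S org_in by blast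
    moreover have "fst ` set xs \<subseteq> S" using xs(2) by auto
    moreover have "card (org G ` set xs) = length xs" "card (fst ` set xs) = length xs"
      using xs(3,4) distinct_card by (metis length_map list.set_map)+
    ultimately show ?case by blast
  next
    case (step n)
    then obtain U F where UF: "U \<subseteq> V" "card U = n" "F \<subseteq> S" "card F = n" "?ends F U" by auto
    have "U \<noteq> {}" using UF(2) step.hyps(1) cycle by (auto simp: edge_cycle_def)
    then obtain u where u: "u \<in> U" by blast
    have "\<exists>w. w \<in> V - U" using UF(1,2) step.prems by (metis Diff_iff Suc_n_not_le_n subsetI subset_antisym)
    then obtain w where w: "w \<in> V" "w \<notin> U" by blast
    have "(u, w) \<in> (adj S)\<^sup>*" using conn u w UF(1) by blast
    then have "\<exists>a b. (a, b) \<in> adj S \<and> a \<in> U \<and> b \<notin> U"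
      using u w(2) by (induction rule: rtrancl_induct) blast+
    then obtain i s where i: "i \<in> S" "org G (i, s) \<in> U" "org G (plane_graph.rev G (i, s)) \<notin> U" by blast
    then have ik: "i < k" using S by auto
    let ?b = "org G (i, \<not> s)"
    have b: "?b \<notin> U" using i(3) rev_G[OF ik] by simp
    have "i \<notin> F" using b UF(5) by blast
    have "insert ?b U \<subseteq> V" using UF(1) org_in ik by auto
    moreover have "finite U" using UF(1) finite_V finite_subset by blast
    then have "card (insert ?b U) = Suc n" using b UF(2) by simp
    moreover have "finite F" using UF(3) S by (meson finite_lessThan finite_subset)
    then have "card (insert i F) = Suc n" using \<open>i \<notin> F\<close> UF(4) by simp
    moreover have "insert i F \<subseteq> S" using UF(3) i(1) by blast
    moreover have "?ends (insert i F) (insert ?b U)"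
    proof (intro ballI allI)
      fix j r assume "j \<in> insert i F"
      then show "org G (j, r) \<in> insert ?b U"
        using UF(5) i(2) by (cases "j = i"; cases "r = s") auto
    qed
    ultimately show ?case by blast
  qed
  have "length xs \<le> card V"
  proof -
    have "set (map (org G) xs) \<subseteq> V" using cycle S org_in unfolding edge_cycle_def by auto
    moreover have "card (set (map (org G) xs)) = length xs"
      using cycle distinct_card unfolding edge_cycle_def by (metis length_map)
    ultimately show ?thesis using card_mono[OF finite_V] by metis
  qed
  from grow[OF this order_refl] obtain F where "F \<subseteq> S" "card F = card V" by (elim exE conjE) iprover
  then show ?thesis using S by (metis card_mono finite_lessThan finite_subset)
qed

text \<open>Merging the other \<open>k - card S\<close> edges one by one gives at most
  \<open>1 + k - card S\<close> circles, while the full state has \<open>k + 2 - card V\<close>. So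
  \<open>card S < card V\<close>, too few edges for a connected graph with a cycle.\<close>

lemma one_circle_spanning_tree:
  assumes S: "S \<subseteq> {..<k}" and one: "circles S = 1"
  shows "spanning_tree k G S"
proof -
  have "circles (S \<union> ({..<k} - S)) \<le> circles S + card ({..<k} - S)"
    by (rule circles_all_le) auto
  moreover have "S \<union> ({..<k} - S) = {..<k}" using S by blast
  moreover have "card ({..<k} - S) = k - card S"
    using S by (simp add: card_Diff_subset finite_subset[of S "{..<k}"])
  moreover have "card S \<le> k" using S by (metis card_lessThan card_mono finite_lessThan)
  ultimately have "card S < card V" using euler_circles one by simp
  then have "\<not> edge_cycle G S xs" for xs
    using cycle_card_edges[OF S _ one_circle_connected[OF S one]] by fastforce
  then show ?thesis
    unfolding spanning_tree_def using S one_circle_connected[OF S one] by blast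
qed

text \<open>Otherwise \<open>flip\<close> never leaves a class, hence neither does
  \<open>nxt G\<close>. Then all corners at a vertex and, across edges, all corners of the connected
  graph lie on one circle.\<close>

lemma exists_merging_edge:
  assumes "circles S \<noteq> 1"
  shows "\<exists>i<k. ((i, False), (i, True)) \<notin> gen_equiv (graph_on X (\<pi> S))"
proof (rule ccontr)
  assume "\<not> ?thesis"
  then have same: "((i, False), (i, True)) \<in> gen_equiv (graph_on X (\<pi> S))" if "i < k" for i
    using that by blast
  let ?E = "gen_equiv (graph_on X (\<pi> S))"
  have "k \<noteq> 0"
  proof
    assume "k = 0"
    then have "circles S = 1" using euler by (simp add: loops_def num_classes_def quotient_def)
    then show False using assms by simp
  qed
  have switch: "((i, s), (i, s')) \<in> ?E" if "i < k" for i s s'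
    using same[OF that] gen_equiv_sym[OF same[OF that]] by (cases s; cases s') auto
  have nxt_rel: "(x, nxt G x) \<in> ?E" if x: "x \<in> X" for x
  proof -
    have "(x, flip S (nxt G x)) \<in> ?E"
      by (rule gen_equiv_base) (use x in \<open>auto simp: graph_on_def\<close>)
    moreover have "(flip S (nxt G x), nxt G x) \<in> ?E"
      using switch[of "fst (nxt G x)"] nxt_in[OF x] by (cases "nxt G x") (simp add: flip_def)
    ultimately show ?thesis by (rule gen_equiv_trans)
  qed
  have same_org: "(x, y) \<in> ?E" if x: "x \<in> X" and y: "y \<in> X" "org G y = org G x" for x y
  proof -
    have "y \<in> orbit (nxt G) x" using orbit_nxt[OF x] y by blast
    then have "y \<in> X \<and> (x, y) \<in> ?E"
    proof induction
      case base then show ?case using nxt_in[OF x] nxt_rel[OF x] by blast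
    next
      case (step y)
      note y = conjunct1[OF step.IH] conjunct2[OF step.IH]
      show ?case by (rule conjI[OF nxt_in[OF y(1)] gen_equiv_trans[OF y(2) nxt_rel[OF y(1)]]])
    qed
    then show ?thesis by blast
  qed
  let ?x = "(0, False)"
  have x: "?x \<in> X" using \<open>k \<noteq> 0\<close> by simp
  have reach: "\<forall>y\<in>X. org G y = w \<longrightarrow> (?x, y) \<in> ?E" if "(org G ?x, w) \<in> (adj {..<k})\<^sup>*" for w
    using that
  proof (induction rule: rtrancl_induct)
    case base
    show ?case using same_org[OF x] by blast
  next
    case (step v w)
    then obtain i s where z: "i < k" "v = org G (i, s)" "w = org G (plane_graph.rev G (i, s))" by auto
    then have w: "w = org G (i, \<not> s)" using rev_G by simp
    have "(i, s) \<in> X" using z by simp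
    from bspec[OF step.IH this] have "(?x, (i, s)) \<in> ?E" using z(2) by (simp only: simp_thms)
    also have "((i, s), (i, \<not> s)) \<in> ?E" using z by (intro switch)
    finally have "(?x, (i, \<not> s)) \<in> ?E" .
    then have "(?x, y) \<in> ?E" if "y \<in> X" "org G y = w" for y
    proof (rule gen_equiv_trans)
      show "((i, \<not> s), y) \<in> ?E" by (rule same_org) (use that z(1) w in simp_all)
    qed
    then show ?case by (intro ballI impI)
  qed
  have "num_classes X (graph_on X (\<pi> S)) = 1"
  proof (rule num_classes_oneI[OF x])
    fix y assume y: "y \<in> X"
    show "(?x, y) \<in> ?E"
      by (rule reach[OF connected[OF org_in[OF x] org_in[OF y]], rule_format, OF y refl])
  qed
  then have "circles S = 1" using circles_eq[of S] \<open>k \<noteq> 0\<close> by simp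
  then show False using assms by simp
qed

text \<open>Each of the \<open>n\<close> switches unites two circles and changes the state in a
  single place.\<close>

lemma near_spanning_tree:
  assumes "S \<subseteq> {..<k}" "circles S = Suc n"
  shows "\<exists>F. spanning_tree k G F \<and> card (sym_diff S F) \<le> n"
  using assms
proof (induction n arbitrary: S)
  case 0
  then have "spanning_tree k G S" by (intro one_circle_spanning_tree) auto
  moreover have "card (S - S \<union> (S - S)) \<le> 0" by simp
  ultimately show ?case by blast
next
  case (Suc n)
  then obtain i where i: "i < k" "((i, False), (i, True)) \<notin> gen_equiv (graph_on X (\<pi> S))"
    using exists_merging_edge[of S] by auto
  let ?T = "sym_diff S {i}"
  have "circles ?T = Suc n" using circles_toggle_merge[OF i] Suc.prems(2) by simp
  moreover have "?T \<subseteq> {..<k}" using Suc.prems(1) i(1) by auto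
  ultimately obtain F where F: "spanning_tree k G F" "card (sym_diff ?T F) \<le> n"
    using Suc.IH by blast
  have "F \<subseteq> {..<k}" using F(1) by (simp add: spanning_tree_def)
  then have fin: "finite (sym_diff ?T F)" using Suc.prems(1) by (meson finite_Diff finite_Un finite_lessThan finite_subset finite.intros)
  have "card (sym_diff S F) \<le> card (insert i (sym_diff ?T F))"
    using fin by (intro card_mono) auto
  also have "\<dots> \<le> Suc (card (sym_diff ?T F))" using fin by (simp add: card_insert_if)
  finally show ?case using F by (meson Suc_le_mono le_trans)
qed

text \<open>The right-hand side is the number of special edges of the state
  \<open>F\<close>.\<close>

lemma tree_weight_eq: "tree_weight k col F = card {i. i < k \<and> (i \<in> F \<longleftrightarrow> col i = Sheaf)}"
proof -
  have "{i. i < k \<and> (i \<in> F \<longleftrightarrow> col i = Sheaf)} =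
      {i. i < k \<and> col i = Sheaf \<and> i \<in> F} \<union> {i. i < k \<and> col i = Chain \<and> i \<notin> F}"
    (is "?A = ?B")
  proof (rule set_eqI)
    show "i \<in> ?A \<longleftrightarrow> i \<in> ?B" for i by (cases "col i") auto
  qed
  also have "card \<dots> = tree_weight k col F"
    unfolding tree_weight_def by (rule card_Un_disjoint) auto
  finally show ?thesis by simp
qed

lemma finite_spanning_trees: "finite {F. spanning_tree k G F}"
  by (rule finite_subset[of _ "Pow {..<k}"]) (auto simp: spanning_tree_def)

text \<open>States and sets of special edges correspond by switching all chains, which preserves
  symmetric differences. So \<open>T\<close> differs from the special set of \<open>F\<close>
  exactly where the state \<open>?S\<close> differs from \<open>F\<close>.\<close>

lemma card_le_max_tree_weight:
  assumes T: "T \<subseteq> {..<k}"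
  shows "card T \<le> max_tree_weight k G col + (circles {i. i < k \<and> (i \<in> T \<longleftrightarrow> col i = Sheaf)} - 1)"
proof -
  let ?S = "{i. i < k \<and> (i \<in> T \<longleftrightarrow> col i = Sheaf)}"
  have "circles ?S = Suc (circles ?S - 1)" using circles_pos[of ?S] by simp
  then obtain F where F: "spanning_tree k G F" "card (sym_diff ?S F) \<le> circles ?S - 1"
    using near_spanning_tree[of ?S] by blast
  let ?W = "{i. i < k \<and> (i \<in> F \<longleftrightarrow> col i = Sheaf)}"
  have "finite F" using F(1) finite_subset by (auto simp: spanning_tree_def)
  then have "card T \<le> card (?W \<union> (sym_diff ?S F))"
    using T by (intro card_mono) auto
  also have "\<dots> \<le> card ?W + card (sym_diff ?S F)" by (rule card_Un_le)
  also have "card ?W \<le> max_tree_weight k G col"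
    unfolding max_tree_weight_def tree_weight_eq[symmetric]
    using F(1) finite_spanning_trees by (intro Max_ge) auto
  finally show ?thesis using F(2) by simp
qed

lemma max_tree_weight_le: "max_tree_weight k G col \<le> k"
proof -
  \<comment> \<open>A maximum needs a nonempty set: the state without merged edges leads to some
    spanning tree.\<close>
  have "circles {} = Suc (circles {} - 1)" using circles_pos[of "{}"] by simp
  then have "\<exists>F. spanning_tree k G F" using near_spanning_tree[of "{}"] by blast
  then have "max_tree_weight k G col \<in> tree_weight k col ` {F. spanning_tree k G F}"
    unfolding max_tree_weight_def using finite_spanning_trees by (intro Max_in) auto
  moreover have "tree_weight k col F \<le> k" for F
    unfolding tree_weight_eq using card_mono[of "{..<k}" "{i. i < k \<and> (i \<in> F \<longleftrightarrow> col i = Sheaf)}"] by auto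
  ultimately show ?thesis by auto
qed

end

section \<open>Polynomiality and the twist number\<close>

lemma A_pow_add: "A_pow a * A_pow b = A_pow (a + b)"
  by (simp add: A_pow_def mult_single)

lemma A_pow_0: "A_pow 0 = 1"
  by (simp add: A_pow_def)

lemma A_pow_power: "A_pow a ^ n = A_pow (a * int n)"
  by (induction n) (simp_all add: A_pow_0 A_pow_add algebra_simps)

lemma A_pow_sum: "finite I \<Longrightarrow> A_pow (\<Sum>i\<in>I. f i) = (\<Prod>i\<in>I. A_pow (f i))"
  by (induction I rule: finite_induct) (simp_all add: A_pow_0 flip: A_pow_add)

text \<open>Weights of an edge of a chain that is merged (\<open>plain_weight\<close>) or separated
  (\<open>special_weight\<close>), and dually for sheafs; \<open>r\<close> is the signed exponent. If \<open>r = 0\<close>, the only edge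
  is already merged or separated, respectively.\<close>

definition plain_weight :: "int \<Rightarrow> laurent" where
  "plain_weight r = A_pow (sgn r)"

definition special_weight :: "int \<Rightarrow> laurent" where
  "special_weight r = (if r = 0 then 0 else A_pow (- sgn r))"

definition twist_size :: "int \<Rightarrow> nat" where
  "twist_size r = (if r = 0 then 1 else nat \<bar>r\<bar>)"

text \<open>\<open>B\<close> is the set of special edges of one chain or sheaf, and the last factor
  stands for the circles closed off between them. Truncated subtraction makes it 1 for empty
  \<open>B\<close>.\<close>

definition state_weight :: "int \<Rightarrow> nat set \<Rightarrow> laurent" where
  "state_weight r B = special_weight r ^ card B * plain_weight r ^ (twist_size r - card B) *
     loop_value ^ (card B - 1)"

lemma plain_weight_power: "plain_weight r ^ twist_size r = A_pow r"
  by (auto simp: plain_weight_def twist_size_def A_pow_power A_pow_0 sgn_if)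

lemma state_weight_empty: "state_weight r {} = A_pow r"
  by (simp add: state_weight_def plain_weight_power)

text \<open>If every special edge split off a circle, each edge would contribute
  \<open>-A^-3\<close> for \<open>r > 0\<close> and \<open>-A^3\<close> for \<open>r < 0\<close>,
  that is \<open>A\<close> times \<open>-A^-4\<close> or \<open>A^-1\<close> times
  \<open>-A^4\<close>. For \<open>r = 0\<close> the single factor is 1.\<close>

lemma twist_value:
  "(special_weight r * loop_value + plain_weight r) ^ twist_size r = A_pow r * neg_A4_pow r"
proof -
  consider "r = 0" | "0 < r" | "r < 0" by linarith
  then show ?thesis
  proof cases
    case 1
    then show ?thesis
      by (simp add: special_weight_def plain_weight_def twist_size_def neg_A4_pow_def A_pow_0)
  next
    case 2
    have "special_weight r * loop_value + plain_weight r = A_pow 1 * - A_pow (- 4)"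
      using 2 by (simp add: special_weight_def plain_weight_def loop_value_def A_pow_add
          right_diff_distrib)
    moreover have "A_pow 1 ^ twist_size r = A_pow r"
      using 2 by (simp add: A_pow_power twist_size_def)
    ultimately show ?thesis
      using 2 by (simp only: power_mult_distrib) (simp add: twist_size_def neg_A4_pow_def)
  next
    case 3
    have "special_weight r * loop_value + plain_weight r = A_pow (- 1) * - A_pow 4"
      using 3 by (simp add: special_weight_def plain_weight_def loop_value_def A_pow_add
          right_diff_distrib)
    moreover have "A_pow (- 1) ^ twist_size r = A_pow r"
      using 3 by (simp add: A_pow_power twist_size_def)
    ultimately show ?thesis
      using 3 by (simp only: power_mult_distrib) (simp add: twist_size_def neg_A4_pow_def)
  qed
qed

text \<open>The power in \<open>twist_value\<close> is expanded over the sets \<open>B\<close> of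
  special edges. A nonempty \<open>B\<close> splits off \<open>card B - 1\<close> circles instead of
  \<open>card B\<close>, whence the factor \<open>loop_value\<close>; the empty set gives
  \<open>A_pow r\<close>.\<close>

lemma sum_state_weight:
  "loop_value * (\<Sum>B\<in>Pow {..<twist_size r} - {{}}. state_weight r B) = A_pow r * (neg_A4_pow r - 1)"
proof -
  let ?N = "{..<twist_size r}"
  let ?s = "special_weight r" and ?p = "plain_weight r"
  have fin: "finite B" if "B \<subseteq> ?N" for B using that finite_subset by blast
  have "A_pow r * neg_A4_pow r = (\<Prod>j\<in>?N. ?s * loop_value + ?p)"
    by (simp add: twist_value)
  also have "\<dots> = (\<Sum>B\<in>Pow ?N. (\<Prod>j\<in>B. ?s * loop_value) * (\<Prod>j\<in>?N - B. ?p))"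
    by (rule prod_add) simp
  also have "\<dots> = ?p ^ twist_size r +
      (\<Sum>B\<in>Pow ?N - {{}}. (\<Prod>j\<in>B. ?s * loop_value) * (\<Prod>j\<in>?N - B. ?p))"
    by (subst sum.remove[of _ "{}"]) simp_all
  also have "(\<Sum>B\<in>Pow ?N - {{}}. (\<Prod>j\<in>B. ?s * loop_value) * (\<Prod>j\<in>?N - B. ?p))
      = (\<Sum>B\<in>Pow ?N - {{}}. loop_value * state_weight r B)"
  proof (rule sum.cong[OF refl])
    fix B assume B: "B \<in> Pow ?N - {{}}"
    then have "card (?N - B) = twist_size r - card B" using fin by (simp add: card_Diff_subset)
    moreover have "card B = Suc (card B - 1)" using B fin by (auto simp: card_gt_0_iff)
    then have "loop_value ^ card B = loop_value * loop_value ^ (card B - 1)"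
      by (metis power_Suc)
    ultimately show "(\<Prod>j\<in>B. ?s * loop_value) * (\<Prod>j\<in>?N - B. ?p) = loop_value * state_weight r B"
      by (simp add: state_weight_def power_mult_distrib mult_ac)
  qed
  finally show ?thesis
    by (simp add: plain_weight_power sum_distrib_left algebra_simps)
qed

text \<open>Families are grouped by the set \<open>T\<close> of indices with nonempty value. Those
  with a given \<open>T\<close> again form a product set, so their sum factorizes.\<close>

lemma sum_PiE_support:
  fixes g :: "'i \<Rightarrow> 'b set \<Rightarrow> 'a :: comm_ring_1"
  assumes I: "finite I" and P: "\<And>i. i \<in> I \<Longrightarrow> finite (P i) \<and> {} \<in> P i"
  shows "(\<Sum>B\<in>PiE I P. F {i \<in> I. B i \<noteq> {}} * (\<Prod>i\<in>I. g i (B i))) =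
    (\<Sum>T\<in>Pow I. F T * (\<Prod>i\<in>I. if i \<in> T then \<Sum>C\<in>P i - {{}}. g i C else g i {}))"
proof -
  have fin: "finite (PiE I P)" using I P by (intro finite_PiE) auto
  have "(\<Sum>B\<in>PiE I P. F {i \<in> I. B i \<noteq> {}} * (\<Prod>i\<in>I. g i (B i))) =
    (\<Sum>T\<in>Pow I. \<Sum>B\<in>{B \<in> PiE I P. {i \<in> I. B i \<noteq> {}} = T}. F {i \<in> I. B i \<noteq> {}} * (\<Prod>i\<in>I. g i (B i)))"
  proof (rule sum.group[symmetric, OF fin])
    show "(\<lambda>B. {i \<in> I. B i \<noteq> {}}) ` PiE I P \<subseteq> Pow I" by blast
  qed (simp add: I)
  also have "\<dots> = (\<Sum>T\<in>Pow I. F T * (\<Prod>i\<in>I. if i \<in> T then \<Sum>C\<in>P i - {{}}. g i C else g i {}))"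
  proof (rule sum.cong[OF refl])
    fix T assume T: "T \<in> Pow I"
    let ?P = "\<lambda>i. if i \<in> T then P i - {{}} else {{}}"
    have eq: "{B \<in> PiE I P. {i \<in> I. B i \<noteq> {}} = T} = PiE I ?P"
    proof (intro equalityI subsetI)
      fix B assume "B \<in> {B \<in> PiE I P. {i \<in> I. B i \<noteq> {}} = T}"
      then have B: "B \<in> PiE I P" and BT: "{i \<in> I. B i \<noteq> {}} = T" by blast+
      have "B i \<in> ?P i" if "i \<in> I" for i
        using PiE_mem[OF B that] that BT by (cases "i \<in> T") auto
      then show "B \<in> PiE I ?P" using B by (simp add: PiE_iff)
    next
      fix B assume B: "B \<in> PiE I ?P"
      have BP: "B i \<in> P i \<and> (B i \<noteq> {} \<longleftrightarrow> i \<in> T)" if "i \<in> I" for i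
        using PiE_mem[OF B that] P[OF that] by (cases "i \<in> T") auto
      then have "{i \<in> I. B i \<noteq> {}} = T" using T by blast
      moreover have "B \<in> PiE I P" using B BP by (simp add: PiE_iff)
      ultimately show "B \<in> {B \<in> PiE I P. {i \<in> I. B i \<noteq> {}} = T}" by blast
    qed
    have "(\<Sum>B\<in>{B \<in> PiE I P. {i \<in> I. B i \<noteq> {}} = T}. F {i \<in> I. B i \<noteq> {}} * (\<Prod>i\<in>I. g i (B i)))
        = (\<Sum>B\<in>{B \<in> PiE I P. {i \<in> I. B i \<noteq> {}} = T}. F T * (\<Prod>i\<in>I. g i (B i)))"
      by (rule sum.cong) auto
    also have "\<dots> = F T * (\<Sum>B\<in>PiE I ?P. \<Prod>i\<in>I. g i (B i))"
      unfolding eq by (simp add: sum_distrib_left)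
    also have "(\<Sum>B\<in>PiE I ?P. \<Prod>i\<in>I. g i (B i)) = (\<Prod>i\<in>I. \<Sum>C\<in>?P i. g i C)"
      by (rule prod_sum_PiE[symmetric]) (use I P in auto)
    also have "\<dots> = (\<Prod>i\<in>I. if i \<in> T then \<Sum>C\<in>P i - {{}}. g i C else g i {})"
      by (rule prod.cong) auto
    finally show "(\<Sum>B\<in>{B \<in> PiE I P. {i \<in> I. B i \<noteq> {}} = T}. F {i \<in> I. B i \<noteq> {}} * (\<Prod>i\<in>I. g i (B i)))
      = F T * (\<Prod>i\<in>I. if i \<in> T then \<Sum>C\<in>P i - {{}}. g i C else g i {})" .
  qed
  finally show ?thesis .
qed

section \<open>Polynomials with Laurent coefficients\<close>

lemma mpoly_eval_superset:
  assumes "finite K" "Poly_Mapping.keys Q \<subseteq> K"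
  shows "mpoly_eval Q x = (\<Sum>m\<in>K. Poly_Mapping.lookup Q m *
        (\<Prod>i\<in>Poly_Mapping.keys m. x i ^ Poly_Mapping.lookup m i))"
  unfolding mpoly_eval_def
  by (rule sum.mono_neutral_left) (use assms in \<open>auto simp: in_keys_iff\<close>)

lemma mpoly_eval_add: "mpoly_eval (Q + R) x = mpoly_eval Q x + mpoly_eval R x"
proof -
  let ?K = "Poly_Mapping.keys Q \<union> Poly_Mapping.keys R"
  have "finite ?K" by simp
  from mpoly_eval_superset[OF this] show ?thesis
    using keys_add[of Q R] by (simp add: lookup_add distrib_right sum.distrib)
qed

lemma mpoly_eval_sum: "mpoly_eval (\<Sum>a\<in>I. Q a) x = (\<Sum>a\<in>I. mpoly_eval (Q a) x)"
  by (induction I rule: infinite_finite_induct) (simp_all add: mpoly_eval_add, simp_all add: mpoly_eval_def)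

lemma mpoly_vars_sum: "mpoly_vars (\<Sum>a\<in>I. Q a) \<subseteq> (\<Union>a\<in>I. mpoly_vars (Q a))"
  unfolding mpoly_vars_def using keys_sum[of Q I] by blast

definition squarefree_monom :: "nat set \<Rightarrow> nat \<Rightarrow>\<^sub>0 nat" where
  "squarefree_monom U = (\<Sum>i\<in>U. Poly_Mapping.single i 1)"

lemma lookup_squarefree_monom:
  "finite U \<Longrightarrow> Poly_Mapping.lookup (squarefree_monom U) i = (if i \<in> U then 1 else 0)"
  by (simp add: squarefree_monom_def lookup_sum lookup_single when_def)

lemma keys_squarefree_monom: "finite U \<Longrightarrow> Poly_Mapping.keys (squarefree_monom U) = U"
  by (auto simp: in_keys_iff lookup_squarefree_monom split: if_splits)

lemma mpoly_eval_squarefree_monom: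
  assumes "finite U"
  shows "mpoly_eval (Poly_Mapping.single (squarefree_monom U) c) x = c * (\<Prod>i\<in>U. x i)"
proof -
  have "mpoly_eval (Poly_Mapping.single (squarefree_monom U) c) x = (\<Sum>m\<in>{squarefree_monom U}.
      Poly_Mapping.lookup (Poly_Mapping.single (squarefree_monom U) c) m *
        (\<Prod>i\<in>Poly_Mapping.keys m. x i ^ Poly_Mapping.lookup m i))"
    by (rule mpoly_eval_superset) auto
  then show ?thesis
    using assms by (simp add: keys_squarefree_monom lookup_squarefree_monom)
qed

lemma mpoly_vars_squarefree_monom:
  "finite U \<Longrightarrow> mpoly_vars (Poly_Mapping.single (squarefree_monom U) c) \<subseteq> U"
  by (auto simp: mpoly_vars_def keys_squarefree_monom split: if_splits)

text \<open>Each product of factors \<open>x i - 1\<close> is expanded over the subsets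
  \<open>U\<close> of \<open>T\<close>, so squarefree monomials suffice.\<close>

lemma exists_mpoly:
  fixes c :: "nat set \<Rightarrow> laurent"
  assumes I: "finite I"
  shows "\<exists>Q. mpoly_vars Q \<subseteq> I \<and> (\<forall>x. mpoly_eval Q x = (\<Sum>T\<in>Pow I. c T * (\<Prod>i\<in>T. x i - 1)))"
proof -
  let ?q = "\<lambda>T U. Poly_Mapping.single (squarefree_monom U) (c T * (\<Prod>i\<in>T - U. - 1))"
  let ?Q = "\<Sum>T\<in>Pow I. \<Sum>U\<in>Pow T. ?q T U"
  have fin: "finite U" if "T \<in> Pow I" "U \<in> Pow T" for T U
    using that I finite_subset by (metis PowD)
  have "mpoly_vars (?q T U) \<subseteq> I" if "T \<in> Pow I" "U \<in> Pow T" for T U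
    using mpoly_vars_squarefree_monom[OF fin[OF that], of "c T * (\<Prod>i\<in>T - U. - 1)"] that by blast
  then have "mpoly_vars (\<Sum>U\<in>Pow T. ?q T U) \<subseteq> I" if "T \<in> Pow I" for T
    by (rule order_trans[OF mpoly_vars_sum UN_least]) (use that in blast)
  then have "mpoly_vars ?Q \<subseteq> I"
    by (rule order_trans[OF mpoly_vars_sum UN_least])
  moreover have "mpoly_eval ?Q x = (\<Sum>T\<in>Pow I. c T * (\<Prod>i\<in>T. x i - 1))" for x
    unfolding mpoly_eval_sum
  proof (rule sum.cong[OF refl])
    fix T assume T: "T \<in> Pow I"
    then have "finite T" using I finite_subset by blast
    have "(\<Sum>U\<in>Pow T. mpoly_eval (?q T U) x) =
        (\<Sum>U\<in>Pow T. c T * ((\<Prod>i\<in>U. x i) * (\<Prod>i\<in>T - U. - 1)))"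
      by (rule sum.cong[OF refl]) (simp only: mpoly_eval_squarefree_monom[OF fin[OF T]] mult_ac)
    also have "\<dots> = c T * (\<Prod>i\<in>T. x i + - 1)"
      by (subst prod_add[OF \<open>finite T\<close>]) (simp only: sum_distrib_left)
    finally show "(\<Sum>U\<in>Pow T. mpoly_eval (?q T U) x) = c T * (\<Prod>i\<in>T. x i - 1)" by simp
  qed
  ultimately show ?thesis by blast
qed

section \<open>The bracket of the blown-up graph\<close>

context blown_up
begin

abbreviation "r \<equiv> signed_exponent col t"

definition edge_mark :: "nat \<times> nat \<Rightarrow> mark" where
  "edge_mark = (\<lambda>(i, j). if 0 < t i then Pos else if t i < 0 then Neg
     else case col i of Chain \<Rightarrow> Merged | Sheaf \<Rightarrow> Separated)"

sublocale blow: rotation_system V' edges src' nx'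
proof
  have "finite (verts G)"
    using ordered unfolding ordered_plane_graph_def connected_plane_graph_def by blast
  moreover have "{Inr (i, j) | i j. i < k \<and> col i = Chain \<and> 0 < j \<and> j < m i} \<subseteq> Inr ` edges" by auto
  then have "finite {Inr (i, j) :: 'v + nat \<times> nat | i j. i < k \<and> col i = Chain \<and> 0 < j \<and> j < m i}"
    using finite_edges finite_subset by blast
  ultimately show "finite V'" by (simp add: blow_up_def Let_def m_def)
qed (rule finite_edges bij_nx')+

lemma blow_up_marked: "blow_up k G col t = blow.marked edge_mark"
proof -
  have "{((i, j), s) | i j s. i < k \<and> j < m i} = edges \<times> (UNIV :: bool set)" by auto
  then show ?thesis
    unfolding blow.marked_def
    by (intro marked_graph.equality) (auto simp: blow_up_def Let_def m_def edge_mark_def)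
qed

lemma twist_size: "twist_size (r i) = m i"
  by (cases "col i") (simp_all add: twist_size_def m_def signed_exponent_def)

text \<open>In a sheaf merging and separating exchange roles and \<open>r i = - t i\<close>; the two
  changes cancel, so the weights depend on \<open>r i\<close> alone. For \<open>t i = 0\<close> the
  inserted smoothing makes the edge ordinary, and a special edge has weight 0.\<close>

lemma mark_weight_edge:
  assumes "Z \<subseteq> edges" "(i, j) \<in> edges"
  shows "mark_weight (edge_mark (i, j)) ((i, j) \<in> merged' Z) =
    (if (i, j) \<in> Z then special_weight (r i) else plain_weight (r i))"
  using assms
  by (cases "col i"; cases "t i" "0 :: int" rule: linorder_cases)
    (auto simp: merged'_def edge_mark_def special_weight_def plain_weight_def signed_exponent_def A_pow_0)

text \<open>The exponent splits into that of the state of \<open>G\<close> and a contribution from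
  each chain or sheaf, so the summand becomes a product over the edges of \<open>G\<close>.\<close>

lemma summand_blow_up:
  assumes Z: "Z = Sigma {..<k} B" and B: "\<And>i. i < k \<Longrightarrow> B i \<subseteq> {..<m i}"
  shows "(\<Prod>e\<in>edges. mark_weight (edge_mark e) (e \<in> merged' Z)) *
      loop_value ^ (loops V' edges src' nx' (merged' Z) - 1) =
    loop_value ^ (loops (verts G) {..<k} (org G) (nxt G)
        {i. i < k \<and> (i \<in> {i \<in> {..<k}. B i \<noteq> {}} \<longleftrightarrow> col i = Sheaf)} - 1) *
      (\<Prod>i<k. state_weight (r i) (B i))"
proof -
  have Z_sub: "Z \<subseteq> edges" unfolding Z edges_def using B by (intro Sigma_mono) auto
  have ne: "nonempty Z = {i \<in> {..<k}. B i \<noteq> {}}" using Z_sub by (auto simp: nonempty_def Z)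
  have merged: "merged Z = {i. i < k \<and> (i \<in> {i \<in> {..<k}. B i \<noteq> {}} \<longleftrightarrow> col i = Sheaf)}"
    unfolding merged_def[OF Z_sub] ne ..
  let ?c = "loops (verts G) {..<k} (org G) (nxt G) (merged Z)"
  interpret planar: colored_plane_graph k G col by standard (rule ordered)
  \<comment> \<open>Positivity makes the truncated subtraction of 1 commute with adding the extra
    circles.\<close>
  have c: "0 < ?c" by (rule planar.circles_pos)
  have fib: "{j. (i, j) \<in> Z} = (if i < k then B i else {})" for i by (auto simp: Z)
  have "(\<Sum>i\<in>nonempty Z. card {j. (i, j) \<in> Z} - 1) = (\<Sum>i<k. card (B i) - 1)"
    unfolding fib ne by (rule sum.mono_neutral_cong_left) auto
  then have "loops V' edges src' nx' (merged' Z) - 1 = (?c - 1) + (\<Sum>i<k. card (B i) - 1)"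
    using loops_blow_up[OF Z_sub] c by simp
  then have "loop_value ^ (loops V' edges src' nx' (merged' Z) - 1) =
      loop_value ^ (?c - 1) * (\<Prod>i<k. loop_value ^ (card (B i) - 1))"
    by (simp only: power_add power_sum)
  moreover have "(\<Prod>e\<in>edges. mark_weight (edge_mark e) (e \<in> merged' Z)) =
      (\<Prod>i<k. special_weight (r i) ^ card (B i) * plain_weight (r i) ^ (twist_size (r i) - card (B i)))"
  proof -
    have "(\<Prod>e\<in>edges. mark_weight (edge_mark e) (e \<in> merged' Z)) =
        (\<Prod>e\<in>edges. case e of (i, j) \<Rightarrow> if j \<in> B i then special_weight (r i) else plain_weight (r i))"
      by (rule prod.cong[OF refl]) (auto simp: mark_weight_edge[OF Z_sub], simp_all add: Z)
    also have "\<dots> = (\<Prod>i<k. \<Prod>j<m i. if j \<in> B i then special_weight (r i) else plain_weight (r i))"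
      unfolding edges_def by (rule prod.Sigma[symmetric]) auto
    also have "\<dots> = (\<Prod>i<k. special_weight (r i) ^ card (B i) * plain_weight (r i) ^ (twist_size (r i) - card (B i)))"
    proof (rule prod.cong[OF refl])
      fix i assume "i \<in> {..<k}"
      then have Bi: "B i \<subseteq> {..<m i}" using B by auto
      then have "finite (B i)" using finite_subset by blast
      have "{..<m i} \<inter> {j. j \<in> B i} = B i" "{..<m i} \<inter> - {j. j \<in> B i} = {..<m i} - B i"
        using Bi by auto
      then show "(\<Prod>j<m i. if j \<in> B i then special_weight (r i) else plain_weight (r i)) =
          special_weight (r i) ^ card (B i) * plain_weight (r i) ^ (twist_size (r i) - card (B i))"
        using Bi \<open>finite (B i)\<close> by (simp add: prod.If_cases card_Diff_subset twist_size)
    qed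
    finally show ?thesis .
  qed
  ultimately show ?thesis
    by (simp add: merged state_weight_def prod.distrib mult_ac)
qed

text \<open>States correspond to sets \<open>Z\<close> of special edges and these to families of
  fibers \<open>B i\<close>; the circles of \<open>G\<close> depend only on which fibers are
  nonempty.\<close>

lemma bracket_blow_up:
  "bracket (twisted_diagram k G col t) = (\<Sum>T\<in>Pow {..<k}.
     loop_value ^ (loops (verts G) {..<k} (org G) (nxt G) {i. i < k \<and> (i \<in> T \<longleftrightarrow> col i = Sheaf)} - 1) *
     (\<Prod>i<k. if i \<in> T then \<Sum>B\<in>Pow {..<twist_size (r i)} - {{}}. state_weight (r i) B
       else A_pow (r i)))" (is "_ = (\<Sum>T\<in>_. ?F T * _)")
proof -
  let ?f = "\<lambda>S. (\<Prod>e\<in>edges. mark_weight (edge_mark e) (e \<in> S)) *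
      loop_value ^ (loops V' edges src' nx' S - 1)"
  let ?B = "PiE {..<k} (\<lambda>i. Pow {..<twist_size (r i)})"
  have "bracket (twisted_diagram k G col t) = (\<Sum>S\<in>Pow edges. ?f S)"
    unfolding twisted_diagram_def
    by (subst blow_up_marked) (simp only: blow.bracket_diag blow.state_sum_def)
  also have "\<dots> = (\<Sum>Z\<in>Pow edges. ?f (merged' Z))"
  \<comment> \<open>\<open>merged'\<close> is an involution on sets of edges, so it also recovers
    \<open>Z\<close> from the state.\<close>
  proof (rule sum.reindex_bij_witness[of _ merged' merged'])
    fix Z assume "Z \<in> Pow edges"
    then have Z: "Z \<subseteq> edges" by blast
    have sub: "merged' Z \<subseteq> edges" unfolding merged'_def[OF Z] by blast
    then show "merged' Z \<in> Pow edges" "merged' Z \<in> Pow edges" by blast+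
    show "merged' (merged' Z) = Z"
      unfolding merged'_def[OF sub] unfolding merged'_def[OF Z] using Z by auto
    then show "merged' (merged' Z) = Z" "?f (merged' (merged' Z)) = ?f Z" by simp_all
  qed
  also have "\<dots> = (\<Sum>B\<in>?B. ?f (merged' (Sigma {..<k} B)))"
  proof (rule sum.reindex_bij_witness[of _ "\<lambda>B. Sigma {..<k} B" "\<lambda>Z. \<lambda>i\<in>{..<k}. {j. (i, j) \<in> Z}"])
    fix Z assume "Z \<in> Pow edges"
    then have Z: "\<And>i j. (i, j) \<in> Z \<Longrightarrow> i < k \<and> j < m i" by auto
    then show "Sigma {..<k} (\<lambda>i\<in>{..<k}. {j. (i, j) \<in> Z}) = Z" by auto
    then show "?f (merged' (Sigma {..<k} (\<lambda>i\<in>{..<k}. {j. (i, j) \<in> Z}))) = ?f (merged' Z)" by simp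
    show "(\<lambda>i\<in>{..<k}. {j. (i, j) \<in> Z}) \<in> ?B" using Z by (auto simp: twist_size)
  next
    fix B assume B: "B \<in> ?B"
    then show "(\<lambda>i\<in>{..<k}. {j. (i, j) \<in> Sigma {..<k} B}) = B"
      by (auto simp: fun_eq_iff PiE_iff extensional_def)
    show "Sigma {..<k} B \<in> Pow edges"
      unfolding edges_def Pow_iff using B by (intro Sigma_mono) (auto simp: PiE_iff twist_size)
  qed
  also have "\<dots> = (\<Sum>B\<in>?B. ?F {i \<in> {..<k}. B i \<noteq> {}} * (\<Prod>i<k. state_weight (r i) (B i)))"
    by (intro sum.cong refl summand_blow_up) (auto simp: PiE_iff twist_size)
  also have "\<dots> = (\<Sum>T\<in>Pow {..<k}. ?F T * (\<Prod>i<k. if i \<in> T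
      then \<Sum>B\<in>Pow {..<twist_size (r i)} - {{}}. state_weight (r i) B else state_weight (r i) {}))"
    by (rule sum_PiE_support) auto
  finally show ?thesis by (simp only: state_weight_empty)
qed

text \<open>Each \<open>i\<close> in \<open>T\<close> takes one factor \<open>loop_value\<close>
  from the power, by \<open>sum_state_weight\<close>. The bound
  \<open>card_le_max_tree_weight\<close> guarantees that enough are available and that the truncated
  exponent is the true difference.\<close>

lemma scaled_bracket_blow_up:
  defines "p \<equiv> max_tree_weight k G col"
  shows "loop_value ^ p * bracket (twisted_diagram k G col t) = A_pow (\<Sum>i<k. r i) *
    (\<Sum>T\<in>Pow {..<k}. loop_value ^ (p + (loops (verts G) {..<k} (org G) (nxt G)
        {i. i < k \<and> (i \<in> T \<longleftrightarrow> col i = Sheaf)} - 1) - card T) * (\<Prod>i\<in>T. neg_A4_pow (r i) - 1))"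
  unfolding bracket_blow_up sum_distrib_left
proof (rule sum.cong[OF refl])
  fix T assume T: "T \<in> Pow {..<k}"
  let ?c = "loops (verts G) {..<k} (org G) (nxt G) {i. i < k \<and> (i \<in> T \<longleftrightarrow> col i = Sheaf)} - 1"
  let ?W = "\<lambda>i. \<Sum>B\<in>Pow {..<twist_size (r i)} - {{}}. state_weight (r i) B"
  let ?y = "\<lambda>i. neg_A4_pow (r i) - 1"
  interpret planar: colored_plane_graph k G col by standard (rule ordered)
  have le: "card T \<le> p + ?c" unfolding p_def by (rule planar.card_le_max_tree_weight) (use T in auto)
  have fin: "finite T" using T finite_subset by blast
  have IT: "{..<k} \<inter> {i. i \<in> T} = T" "{..<k} \<inter> - {i. i \<in> T} = {..<k} - T" using T by auto
  have "loop_value ^ p * (loop_value ^ ?c * (\<Prod>i<k. if i \<in> T then ?W i else A_pow (r i))) =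
      loop_value ^ (p + ?c) * ((\<Prod>i\<in>T. ?W i) * (\<Prod>i\<in>{..<k} - T. A_pow (r i)))"
    using IT by (simp add: prod.If_cases power_add mult.assoc)
  also have "loop_value ^ (p + ?c) = loop_value ^ (p + ?c - card T) * (\<Prod>i\<in>T. loop_value)"
    using le by (simp flip: power_add)
  also have "loop_value ^ (p + ?c - card T) * (\<Prod>i\<in>T. loop_value) *
        ((\<Prod>i\<in>T. ?W i) * (\<Prod>i\<in>{..<k} - T. A_pow (r i))) =
      loop_value ^ (p + ?c - card T) * ((\<Prod>i\<in>T. loop_value * ?W i) * (\<Prod>i\<in>{..<k} - T. A_pow (r i)))"
    by (simp only: prod.distrib mult_ac)
  also have "(\<Prod>i\<in>T. loop_value * ?W i) = (\<Prod>i\<in>T. A_pow (r i)) * (\<Prod>i\<in>T. ?y i)"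
    by (simp only: sum_state_weight prod.distrib)
  also have "(\<Prod>i\<in>T. A_pow (r i)) * (\<Prod>i\<in>T. ?y i) * (\<Prod>i\<in>{..<k} - T. A_pow (r i)) =
      A_pow (\<Sum>i<k. r i) * (\<Prod>i\<in>T. ?y i)"
  proof -
    have "A_pow (\<Sum>i<k. r i) = (\<Prod>i\<in>{..<k} - T. A_pow (r i)) * (\<Prod>i\<in>T. A_pow (r i))"
      using T by (simp add: A_pow_sum prod.subset_diff[of T "{..<k}"])
    then show ?thesis by (simp only: mult_ac)
  qed
  finally show "loop_value ^ p * (loop_value ^ ?c * (\<Prod>i<k. if i \<in> T then ?W i else A_pow (r i))) =
      A_pow (\<Sum>i<k. r i) * (loop_value ^ (p + ?c - card T) * (\<Prod>i\<in>T. ?y i))"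
    by (simp only: mult_ac)
qed

end

section \<open>Twist classes and the edges of the colored graph\<close>

lemma link_diagram_of_links:
  assumes "L \<in> links" "D \<in> L"
  shows "link_diagram D"
proof -
  obtain D0 where "link_diagram D0" "equivclp diagram_move D0 D"
    using assms unfolding links_def by (auto elim!: quotientE)
  from this(2,1) show ?thesis
    by (induction rule: equivclp_induct) (auto simp: diagram_move_def)
qed

text \<open>Reflexivity has to come from the generating pairs of the transitive closure: a crossing
  is paired with itself through one of its own corners.\<close>

lemma equiv_twist_equiv:
  assumes "link_diagram D"
  shows "equiv (crossings D) (twist_equiv D)"
proof -
  let ?R = "{(x, y). x \<in> crossings D \<and> y \<in> crossings D \<and>
     (\<exists>h\<in>x. \<exists>g\<in>y. (h, g) \<in> region D \<and> (rot D (rot D h), rot D (rot D g)) \<in> region D)}"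
  have rot: "rot D h \<in> darts D" if "h \<in> darts D" for h
    using assms that unfolding link_diagram_def by (meson bij_betw_apply)
  have region: "equiv (darts D) (region D)" using assms unfolding link_diagram_def by blast
  have "(x, x) \<in> ?R" if x: "x \<in> crossings D" for x
  proof -
    obtain h where h: "x = vertex_at D h" "h \<in> darts D"
      using x by (auto simp: crossings_def crossing_darts_def)
    \<comment> \<open>The corner \<open>rot D h\<close> serves as witness since \<open>orbit\<close>
      starts with the first iterate.\<close>
    then have "rot D h \<in> x" "rot D (rot D (rot D h)) \<in> darts D" "rot D h \<in> darts D"
      using rot by (simp_all add: vertex_at_def orbit.base)
    then show ?thesis using x region by (auto simp: equiv_def refl_on_def)
  qed
  then have "refl_on (crossings D) (?R\<^sup>+)" by (intro refl_onI) blast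
  moreover have "sym ?R"
    using region unfolding equiv_def by (auto intro!: symI dest: symD)
  then have "sym (?R\<^sup>+)" by (rule sym_trancl)
  moreover have "?R\<^sup>+ \<subseteq> crossings D \<times> crossings D" by (rule trancl_subset_Sigma) blast
  ultimately show ?thesis unfolding twist_equiv_def by (intro equivI) auto
qed

text \<open>Edge \<open>i\<close> is sent to the twist class of the crossing of the edge
  \<open>(i, 0)\<close> replacing it; distinct \<open>i\<close> give distinct classes by the last
  clause of \<open>colored_graph_of\<close>.\<close>

lemma edges_le_twist_number:
  assumes D: "link_diagram D" and G: "colored_graph_of D u k G col t"
  shows "k \<le> twist_number D"
proof -
  from G obtain S \<phi> \<psi> where t: "\<forall>i<k. t i \<noteq> 0"
    and iso: "marked_graph_iso \<phi> \<psi> (blow_up k G col t) (signed_graph D S)"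
    and classes: "\<forall>((i, j), s) \<in> gdarts (blow_up k G col t). \<forall>((i', j'), s') \<in> gdarts (blow_up k G col t).
          (vertex_at D (\<psi> ((i, j), s)), vertex_at D (\<psi> ((i', j'), s'))) \<in> twist_equiv D \<longleftrightarrow> i = i'"
    unfolding colored_graph_of_def by blast
  let ?d = "\<lambda>i. ((i, 0), False) :: (nat \<times> nat) \<times> bool"
  let ?x = "\<lambda>i. vertex_at D (\<psi> (?d i))"
  let ?c = "\<lambda>i. twist_equiv D `` {?x i}"
  have d: "?d i \<in> gdarts (blow_up k G col t)" if "i < k" for i
    using that t by (auto simp: blow_up_def Let_def)
  have "bij_betw \<psi> (gdarts (blow_up k G col t)) (S \<inter> crossing_darts D)"
    using iso by (simp add: marked_graph_iso_def signed_graph_def Let_def)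
  then have x: "?x i \<in> crossings D" if "i < k" for i
    using d[OF that] unfolding crossings_def by (metis IntD2 bij_betw_apply imageI)
  have rel: "(?x i, ?x i') \<in> twist_equiv D \<longleftrightarrow> i = i'" if "i < k" "i' < k" for i i'
    using bspec[OF bspec[OF classes d[OF that(1)], unfolded prod.case] d[OF that(2)]] by simp
  have "inj_on ?c {..<k}"
  proof (rule inj_onI)
    fix i i' assume i: "i \<in> {..<k}" "i' \<in> {..<k}" and eq: "?c i = ?c i'"
    from eq have "(?x i, ?x i') \<in> twist_equiv D"
      by (rule eq_equiv_class[OF _ equiv_twist_equiv[OF D]]) (use x i in simp)
    then show "i = i'" using rel i by simp
  qed
  moreover have "?c ` {..<k} \<subseteq> crossings D // twist_equiv D"
    using x by (auto intro: quotientI)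
  moreover have "finite (crossings D // twist_equiv D)"
    using D by (simp add: link_diagram_def crossings_def crossing_darts_def quotient_def)
  ultimately have "card {..<k} \<le> card (crossings D // twist_equiv D)" by (rule card_inj_on_le)
  then show ?thesis by (simp add: twist_number_def)
qed

theorem theorem4:
  fixes L :: "nat diagram set" and D :: "nat diagram" and u :: nat
    and k :: nat and G :: "('v, nat \<times> bool) plane_graph"
    and col :: "nat \<Rightarrow> color" and t0 :: "nat \<Rightarrow> int"
  assumes "L \<in> links" and "D \<in> L"
    and "connected_diagram D"
    and "reduced_diagram D" and "twists_bigon_connected D"
    and "twist_number D = link_twist_number L"
    and "u \<in> darts D"
    and "colored_graph_of D u k G col t0"
  shows "(\<exists>Q :: laurent_mpoly. mpoly_vars Q \<subseteq> {..<k} \<and>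
           (\<forall>t :: nat \<Rightarrow> int.
              loop_value ^ max_tree_weight k G col * bracket (twisted_diagram k G col t)
              = A_pow (\<Sum>i<k. signed_exponent col t i) *
                mpoly_eval Q (\<lambda>i. neg_A4_pow (signed_exponent col t i))))
         \<and> max_tree_weight k G col \<le> link_twist_number L"
proof
  have ordered: "ordered_plane_graph k G"
    using assms(8) by (simp add: colored_graph_of_def)
  let ?p = "max_tree_weight k G col"
  \<comment> \<open>The coefficients are determined by \<open>G\<close>, \<open>col\<close> and
    \<open>T\<close>, which makes \<open>Q\<close> independent of \<open>t\<close>.\<close>
  let ?c = "\<lambda>T. loop_value ^ (?p + (loops (verts G) {..<k} (org G) (nxt G)
        {i. i < k \<and> (i \<in> T \<longleftrightarrow> col i = Sheaf)} - 1) - card T)"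
  obtain Q where Q: "mpoly_vars Q \<subseteq> {..<k}"
    "\<And>x. mpoly_eval Q x = (\<Sum>T\<in>Pow {..<k}. ?c T * (\<Prod>i\<in>T. x i - 1))"
    using exists_mpoly[of "{..<k}" ?c] by auto
  have "loop_value ^ ?p * bracket (twisted_diagram k G col t) =
      A_pow (\<Sum>i<k. signed_exponent col t i) * mpoly_eval Q (\<lambda>i. neg_A4_pow (signed_exponent col t i))" for t
  proof -
    interpret blown_up k G col t by standard (rule ordered)
    show ?thesis unfolding Q(2) by (rule scaled_bracket_blow_up)
  qed
  with Q(1) show "\<exists>Q :: laurent_mpoly. mpoly_vars Q \<subseteq> {..<k} \<and>
           (\<forall>t :: nat \<Rightarrow> int.
              loop_value ^ max_tree_weight k G col * bracket (twisted_diagram k G col t)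
              = A_pow (\<Sum>i<k. signed_exponent col t i) *
                mpoly_eval Q (\<lambda>i. neg_A4_pow (signed_exponent col t i)))" by blast
next
  interpret colored_plane_graph k G col
    by standard (use assms(8) in \<open>simp add: colored_graph_of_def\<close>)
  have "max_tree_weight k G col \<le> k" by (rule max_tree_weight_le)
  also have "k \<le> twist_number D"
    by (rule edges_le_twist_number[OF link_diagram_of_links[OF assms(1,2)] assms(8)])
  finally show "max_tree_weight k G col \<le> link_twist_number L" using assms(6) by simp
qed

end
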